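(* Let $G$ be a directed graph and $(s,t)$ a vertex pair in $G$ such that $t$ is reachable from $s$, and let $C$ be any subset of the $(s,t)$ cut-vertices. Then one can compute in polynomial time an oracle of size $O(|C|)$ that, for any three vertices $x,y,z\in C$, reports whether there is a $y$ to $z$ path in $G-x$ in $O(1)$ time.
   Context: A vertex $x$ is an $(s,t)$ cut-vertex if there is no $s$ to $t$ path in $G-x$, where $G-x$ denotes $G$ with vertex $x$ and its incident edges removed. Size is measured in machine words. *)

theory Defs
  imports "Graph_Theory.Arc_Walk" "HOL-Computational_Algebra.Polynomial"
begin

section \<open>Cut-vertices\<close>

definition has_path :: "('a, 'b) pre_digraph \<Rightarrow> 'a \<Rightarrow> 'a \<Rightarrow> bool" where
  "has_path G u v \<longleftrightarrow> (\<exists>p. pre_digraph.apath G u p v)"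

lemma (in wf_digraph) has_path_iff_reachable: "has_path G u v \<longleftrightarrow> u \<rightarrow>\<^sup>* v"
  unfolding has_path_def reachable_awalk by (meson apath_awalk_to_apath awalkI_apath)

text \<open>
  Paths have to start and end at vertices of the graph. Hence there is no path from or to a deleted
  vertex, and \<open>s\<close> and \<open>t\<close> are themselves \<open>(s, t)\<close> cut-vertices.
\<close>

definition st_cut_vertex :: "('a, 'b) pre_digraph \<Rightarrow> 'a \<Rightarrow> 'a \<Rightarrow> 'a \<Rightarrow> bool" where
  "st_cut_vertex G s t x \<longleftrightarrow> x \<in> verts G \<and> \<not> has_path (pre_digraph.del_vert G x) s t"

section \<open>Word RAM\<close>

text \<open>
  A unit-cost word RAM with \<open>w\<close>-bit words, programmed in structured form. Registers and memory
  cells are indexed by naturals and hold words, i.e. naturals below \<open>2 ^ w\<close>; results that do not fit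
  are reduced modulo \<open>2 ^ w\<close>. A program mentions only finitely many registers; memory is accessed
  by indirect addressing. As usual, the word length is required to be at least a constant multiple of
  the logarithm of the instance size; programs do not know it.
\<close>

datatype operand = Const nat | Reg nat

datatype binop = Add | Sub | Mul | Div | Mod | And | Or | Xor | Shl | Shr

datatype test = Lt operand operand | Le operand operand | Eq operand operand | Ne operand operand

datatype com =
    Skip
  | Move nat operand
  | Op nat binop operand operand
  | Load nat operand
  | Store operand operand  \<comment> \<open>address, value\<close>
  | Seq com com
  | Cond test com com
  | While test com

record state =
  reg :: "nat \<Rightarrow> nat"
  mem :: "nat \<Rightarrow> nat"

fun operand_val :: "nat \<Rightarrow> state \<Rightarrow> operand \<Rightarrow> nat" where
  "operand_val w \<sigma> (Const k) = take_bit w k"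
| "operand_val w \<sigma> (Reg r) = reg \<sigma> r"

text \<open>Subtraction is truncated at zero; division and remainder by zero follow HOL.\<close>

fun binop_val :: "binop \<Rightarrow> nat \<Rightarrow> nat \<Rightarrow> nat" where
  "binop_val Add a b = a + b"
| "binop_val Sub a b = a - b"
| "binop_val Mul a b = a * b"
| "binop_val Div a b = a div b"
| "binop_val Mod a b = a mod b"
| "binop_val And a b = and a b"
| "binop_val Or a b = or a b"
| "binop_val Xor a b = xor a b"
| "binop_val Shl a b = push_bit b a"
| "binop_val Shr a b = drop_bit b a"

fun test_val :: "nat \<Rightarrow> state \<Rightarrow> test \<Rightarrow> bool" where
  "test_val w \<sigma> (Lt a b) \<longleftrightarrow> operand_val w \<sigma> a < operand_val w \<sigma> b"
| "test_val w \<sigma> (Le a b) \<longleftrightarrow> operand_val w \<sigma> a \<le> operand_val w \<sigma> b"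
| "test_val w \<sigma> (Eq a b) \<longleftrightarrow> operand_val w \<sigma> a = operand_val w \<sigma> b"
| "test_val w \<sigma> (Ne a b) \<longleftrightarrow> operand_val w \<sigma> a \<noteq> operand_val w \<sigma> b"

text \<open>
  \<open>exec w c \<sigma> k \<sigma>'\<close>: on the machine with \<open>w\<close>-bit words, program \<open>c\<close> started in \<open>\<sigma>\<close> halts in \<open>\<sigma>'\<close>
  after exactly \<open>k\<close> steps. Every instruction and every evaluation of a test costs one step.
\<close>

inductive exec :: "nat \<Rightarrow> com \<Rightarrow> state \<Rightarrow> nat \<Rightarrow> state \<Rightarrow> bool" for w where
  Skip: "exec w Skip \<sigma> 1 \<sigma>"
| Move: "exec w (Move r a) \<sigma> 1 (\<sigma>\<lparr>reg := (reg \<sigma>)(r := operand_val w \<sigma> a)\<rparr>)"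
| Op: "exec w (Op r f a b) \<sigma> 1
    (\<sigma>\<lparr>reg := (reg \<sigma>)(r := take_bit w (binop_val f (operand_val w \<sigma> a) (operand_val w \<sigma> b)))\<rparr>)"
| Load: "exec w (Load r a) \<sigma> 1 (\<sigma>\<lparr>reg := (reg \<sigma>)(r := mem \<sigma> (operand_val w \<sigma> a))\<rparr>)"
| Store: "exec w (Store a b) \<sigma> 1
    (\<sigma>\<lparr>mem := (mem \<sigma>)(operand_val w \<sigma> a := operand_val w \<sigma> b)\<rparr>)"
| Seq: "exec w c \<sigma> k \<sigma>' \<Longrightarrow> exec w d \<sigma>' l \<sigma>'' \<Longrightarrow> exec w (Seq c d) \<sigma> (k + l) \<sigma>''"
| CondTrue: "test_val w \<sigma> b \<Longrightarrow> exec w c \<sigma> k \<sigma>' \<Longrightarrow> exec w (Cond b c d) \<sigma> (Suc k) \<sigma>'"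
| CondFalse: "\<not> test_val w \<sigma> b \<Longrightarrow> exec w d \<sigma> k \<sigma>' \<Longrightarrow> exec w (Cond b c d) \<sigma> (Suc k) \<sigma>'"
| WhileFalse: "\<not> test_val w \<sigma> b \<Longrightarrow> exec w (While b c) \<sigma> 1 \<sigma>"
| WhileTrue: "test_val w \<sigma> b \<Longrightarrow> exec w c \<sigma> k \<sigma>' \<Longrightarrow> exec w (While b c) \<sigma>' l \<sigma>'' \<Longrightarrow>
    exec w (While b c) \<sigma> (Suc (k + l)) \<sigma>''"

lemma exec_deterministic:
  assumes "exec w c \<sigma> k \<sigma>'" "exec w c \<sigma> l \<sigma>''"
  shows "k = l \<and> \<sigma>' = \<sigma>''"
  using assms
proof (induction arbitrary: l \<sigma>'' rule: exec.induct)
  case (Seq c \<sigma> k \<sigma>' d l \<sigma>'')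
  from Seq.prems Seq.IH show ?case by (elim exec.cases[of w "Seq c d"]) blast+
next
  case (CondTrue \<sigma> b c k \<sigma>' d)
  from CondTrue.prems CondTrue.IH CondTrue.hyps show ?case by (elim exec.cases[of w "Cond b c d"]) blast+
next
  case (CondFalse \<sigma> b d k \<sigma>' c)
  from CondFalse.prems CondFalse.IH CondFalse.hyps show ?case by (elim exec.cases[of w "Cond b c d"]) blast+
next
  case (WhileFalse \<sigma> b c)
  from WhileFalse.prems WhileFalse.hyps show ?case by (elim exec.cases[of w "While b c"]) blast+
next
  case (WhileTrue \<sigma> b c k \<sigma>' l \<sigma>'')
  from WhileTrue.prems WhileTrue.IH WhileTrue.hyps show ?case
    by (elim exec.cases[of w "While b c"]) blast+
qed (auto elim: exec.cases)

text \<open>Initial state: the given words at the start of memory and in the first registers, 0 elsewhere.\<close>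

definition init_state :: "nat list \<Rightarrow> nat list \<Rightarrow> state" where
  "init_state rs ms =
    \<lparr>reg = (\<lambda>i. if i < length rs then rs ! i else 0),
     mem = (\<lambda>i. if i < length ms then ms ! i else 0)\<rparr>"

text \<open>
  The output of a preprocessing run is the block of memory whose start address and length are found
  in registers 0 and 1.
\<close>

definition output_block :: "state \<Rightarrow> nat list" where
  "output_block \<sigma> = map (\<lambda>i. mem \<sigma> (reg \<sigma> 0 + i)) [0..<reg \<sigma> 1]"

section \<open>Problem instances\<close>

text \<open>
  Inputs are graphs with vertices \<open>{..<n}\<close> and arcs \<open>{..<m}\<close> (loops and parallel arcs allowed), given
  by their arc list, and a vertex set given as a list in arbitrary order.
\<close>

definition numbered_digraph :: "(nat, nat) pre_digraph \<Rightarrow> bool" where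
  "numbered_digraph G \<longleftrightarrow> fin_digraph G \<and>
    verts G = {..<card (verts G)} \<and> arcs G = {..<card (arcs G)}"

definition graph_size :: "(nat, nat) pre_digraph \<Rightarrow> nat" where
  "graph_size G = card (verts G) + card (arcs G)"

definition encode_instance :: "(nat, nat) pre_digraph \<Rightarrow> nat \<Rightarrow> nat \<Rightarrow> nat list \<Rightarrow> nat list" where
  "encode_instance G s t cs =
    [card (verts G), card (arcs G), s, t, length cs]
      @ concat (map (\<lambda>e. [tail G e, head G e]) [0..<card (arcs G)]) @ cs"

text \<open>
  On the machine with \<open>w\<close>-bit words, the query program \<open>Q\<close>, started on a memory holding nothing but
  the oracle \<open>D\<close>, decides within \<open>T\<close> steps for all \<open>x, y, z \<in> C\<close> whether \<open>G - x\<close> has a path from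
  \<open>y\<close> to \<open>z\<close>. The answer, 1 or 0, is left in register 0.
\<close>

definition answers_queries ::
  "nat \<Rightarrow> com \<Rightarrow> nat \<Rightarrow> nat list \<Rightarrow> (nat, nat) pre_digraph \<Rightarrow> nat set \<Rightarrow> bool" where
  "answers_queries w Q T D G C \<longleftrightarrow>
    (\<forall>x\<in>C. \<forall>y\<in>C. \<forall>z\<in>C. \<exists>k \<sigma>.
      exec w Q (init_state [x, y, z] D) k \<sigma> \<and> k \<le> T \<and>
      reg \<sigma> 0 = of_bool (has_path (pre_digraph.del_vert G x) y z))"

end

theory Submission
  imports Defs
begin

text \<open>
  All paths from \<open>s\<close> to \<open>t\<close> visit the cut-vertices in the same order, so identify \<open>C\<close> with
  \<open>{0..<k}\<close>. For \<open>y \<le> z\<close>, \<open>G - x\<close> has a path from \<open>y\<close> to \<open>z\<close> unless \<open>y \<le> x \<le> z\<close>. For \<open>z < y < x\<close>,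
  let \<open>low a\<close> be the least position reached from \<open>a\<close> in \<open>G - (a + 1)\<close>. The positions below \<open>x\<close> that
  reach \<open>z\<close> in \<open>G - x\<close> are those up to the rightmost minimum \<open>u\<close> of \<open>low\<close> on \<open>{z..<x}\<close>. Dually,
  for \<open>x < y\<close>, the positions above \<open>x\<close> reached from \<open>y\<close> are those from some \<open>a\<close> on, again given by a range
  minimum. For \<open>z < x < y\<close> a path has to jump over \<open>x\<close>, and whether \<open>a\<close> reaches \<open>u\<close> in \<open>G - x\<close> is a
  comparison of \<open>u\<close> with a number that depends on \<open>a\<close> only.

  Range minima are found in constant time with linear space: a sparse table serves whole blocks of
  logarithmic length, a bit mask per position serves queries inside a block. Vertices are mapped to
  positions by two-level perfect hashing.

  All tables are defined by arithmetic expressions with bounded sums over previous tables. Such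
  expressions compile to RAM programs whose running time and values are polynomially bounded, which
  leaves only their values to be verified.
\<close>

section \<open>Compiling expressions to the word RAM\<close>

text \<open>Vertex names range below \<open>n\<close>, while the oracle has only O(k) words for
  \<open>k\<close> cut-vertices, so an array indexed by names would be too long; hence the
  dictionary, made deterministic by trying every multiplier.

  The crux is \<open>z < x < y\<close>. Whether \<open>a\<close> reaches \<open>u\<close> in
  \<open>G - x\<close> seems to depend on three positions. What removes \<open>x\<close>: a jump
  from \<open>a\<close> over any other vertex \<open>x'\<close> that lands at or before
  \<open>u\<close> cannot meet \<open>x\<close>, since jumps are restricted to extremal ends. It is
  therefore also a path in \<open>G - x\<close>, and from its landing place \<open>u\<close> is
  reached by going forward. So the least landing place of \<open>a\<close> over all
  \<open>x'\<close> decides.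

  The single parameter \<open>L = (n + m + 2) ^ 8\<close> bounds all table lengths and stored
  values. Intermediate values stay below some \<open>L ^ c\<close> that fits in a word, so
  evaluation over the naturals and execution on words agree. Without sums, \<open>c\<close> itself
  bounds the number of steps: constant query time.

  The size bound 1620 is 18 tables of \<open>90 * k\<close> words: hashing loses a factor 9 against
  ideal collision counts, which costs \<open>9 * (9 * k) + 9 * k\<close> slots.\<close>

definition runs :: "nat \<Rightarrow> com \<Rightarrow> state \<Rightarrow> nat \<Rightarrow> (state \<Rightarrow> bool) \<Rightarrow> bool" where
  "runs w c \<sigma> T Q \<longleftrightarrow> (\<exists>k \<sigma>'. exec w c \<sigma> k \<sigma>' \<and> k \<le> T \<and> Q \<sigma>')"

lemma runs_weaken: "runs w c \<sigma> T Q \<Longrightarrow> T \<le> T' \<Longrightarrow> (\<And>\<sigma>'. Q \<sigma>' \<Longrightarrow> Q' \<sigma>') \<Longrightarrow> runs w c \<sigma> T' Q'"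
  unfolding runs_def by (meson le_trans)

lemma runs_Move:
  "Q (\<sigma>\<lparr>reg := (reg \<sigma>)(r := operand_val w \<sigma> a)\<rparr>) \<Longrightarrow> runs w (Move r a) \<sigma> 1 Q"
  unfolding runs_def using exec.Move by blast

lemma runs_Op:
  "Q (\<sigma>\<lparr>reg := (reg \<sigma>)(r := take_bit w (binop_val f (operand_val w \<sigma> a) (operand_val w \<sigma> b)))\<rparr>) \<Longrightarrow>
    runs w (Op r f a b) \<sigma> 1 Q"
  unfolding runs_def using exec.Op by blast

lemma runs_Load:
  "Q (\<sigma>\<lparr>reg := (reg \<sigma>)(r := mem \<sigma> (operand_val w \<sigma> a))\<rparr>) \<Longrightarrow> runs w (Load r a) \<sigma> 1 Q"
  unfolding runs_def using exec.Load by blast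

lemma runs_Store:
  "Q (\<sigma>\<lparr>mem := (mem \<sigma>)(operand_val w \<sigma> a := operand_val w \<sigma> b)\<rparr>) \<Longrightarrow>
    runs w (Store a b) \<sigma> 1 Q"
  unfolding runs_def using exec.Store by blast

lemma runs_Seq:
  "runs w c \<sigma> T (\<lambda>\<sigma>'. runs w d \<sigma>' T' Q) \<Longrightarrow> runs w (Seq c d) \<sigma> (T + T') Q"
  unfolding runs_def by (meson add_mono exec.Seq)

lemma runs_Cond:
  "(test_val w \<sigma> b \<Longrightarrow> runs w c \<sigma> T Q) \<Longrightarrow> (\<not> test_val w \<sigma> b \<Longrightarrow> runs w d \<sigma> T Q) \<Longrightarrow>
    runs w (Cond b c d) \<sigma> (Suc T) Q"
  unfolding runs_def by (meson Suc_le_mono exec.CondFalse exec.CondTrue)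

lemma runs_While_False: "\<not> test_val w \<sigma> b \<Longrightarrow> Q \<sigma> \<Longrightarrow> runs w (While b c) \<sigma> 1 Q"
  unfolding runs_def using exec.WhileFalse by blast

lemma runs_While_True:
  "test_val w \<sigma> b \<Longrightarrow> runs w c \<sigma> T (\<lambda>\<sigma>'. runs w (While b c) \<sigma>' T' Q) \<Longrightarrow>
    runs w (While b c) \<sigma> (Suc (T + T')) Q"
  unfolding runs_def by (meson Suc_le_mono add_mono exec.WhileTrue)

text \<open>The invariant is indexed by the round, so \<open>n - i\<close> rounds remain. Each pays
  one step for its test, and the final failing test pays the last one.\<close>

lemma runs_While_count:
  assumes inv: "\<And>i \<sigma>. i < n \<Longrightarrow> I i \<sigma> \<Longrightarrow> test_val w \<sigma> b \<and> runs w c \<sigma> T (I (Suc i))"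
    and final: "\<And>\<sigma>. I n \<sigma> \<Longrightarrow> \<not> test_val w \<sigma> b \<and> Q \<sigma>"
    and "i \<le> n" "I i \<sigma>"
  shows "runs w (While b c) \<sigma> ((n - i) * Suc T + 1) Q"
  using \<open>i \<le> n\<close> \<open>I i \<sigma>\<close>
proof (induction i arbitrary: \<sigma> rule: inc_induct)
  case base
  then show ?case using final runs_While_False by auto
next
  case (step i)
  have "runs w c \<sigma> T (\<lambda>\<sigma>'. runs w (While b c) \<sigma>' ((n - Suc i) * Suc T + 1) Q)"
    using inv[OF step.hyps(2) step.prems] step.IH by (auto intro: runs_weaken)
  moreover have "test_val w \<sigma> b" using inv[OF step.hyps(2) step.prems] by blast
  ultimately have "runs w (While b c) \<sigma> (Suc (T + ((n - Suc i) * Suc T + 1))) Q"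
    by (intro runs_While_True) auto
  moreover have "Suc (T + ((n - Suc i) * Suc T + 1)) = (n - i) * Suc T + 1"
    using step.hyps by (simp add: Suc_diff_Suc[symmetric])
  ultimately show ?case by metis
qed

section \<open>Expressions with bounded sums, their semantics and their compilation\<close>

datatype exp =
    Num nat
  | Var nat
  | Mem exp
  | Bin binop exp exp
  | ILt exp exp exp exp
  | Sum nat exp exp
  | LetE nat exp exp

fun eval :: "exp \<Rightarrow> (nat \<Rightarrow> nat) \<Rightarrow> (nat \<Rightarrow> nat) \<Rightarrow> nat" where
  "eval (Num c) \<rho> \<mu> = c"
| "eval (Var v) \<rho> \<mu> = \<rho> v"
| "eval (Mem a) \<rho> \<mu> = \<mu> (eval a \<rho> \<mu>)"
| "eval (Bin f a b) \<rho> \<mu> = binop_val f (eval a \<rho> \<mu>) (eval b \<rho> \<mu>)"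
| "eval (ILt a b c d) \<rho> \<mu> = (if eval a \<rho> \<mu> < eval b \<rho> \<mu> then eval c \<rho> \<mu> else eval d \<rho> \<mu>)"
| "eval (Sum v a b) \<rho> \<mu> = (\<Sum>i<eval a \<rho> \<mu>. eval b (\<rho>(v := i)) \<mu>)"
| "eval (LetE v a b) \<rho> \<mu> = eval b (\<rho>(v := eval a \<rho> \<mu>)) \<mu>"

text \<open>The excluded operations may exceed every polynomial bound on their arguments or are not needed.\<close>

fun wf_exp :: "nat \<Rightarrow> exp \<Rightarrow> bool" where
  "wf_exp r (Num c) \<longleftrightarrow> True"
| "wf_exp r (Var v) \<longleftrightarrow> v < r"
| "wf_exp r (Mem a) \<longleftrightarrow> wf_exp r a"
| "wf_exp r (Bin f a b) \<longleftrightarrow> f \<in> {Add, Sub, Mul, Div, Mod, Shr} \<and> wf_exp r a \<and> wf_exp r b"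
| "wf_exp r (ILt a b c d) \<longleftrightarrow> wf_exp r a \<and> wf_exp r b \<and> wf_exp r c \<and> wf_exp r d"
| "wf_exp r (Sum v a b) \<longleftrightarrow> v < r \<and> wf_exp r a \<and> wf_exp r b"
| "wf_exp r (LetE v a b) \<longleftrightarrow> v < r \<and> wf_exp r a \<and> wf_exp r b"

text \<open>Only sums compile to loops, so these expressions become branching code without
  repetition and run in constant time.\<close>

fun sum_free :: "exp \<Rightarrow> bool" where
  "sum_free (Num c) \<longleftrightarrow> True"
| "sum_free (Var v) \<longleftrightarrow> True"
| "sum_free (Mem a) \<longleftrightarrow> sum_free a"
| "sum_free (Bin f a b) \<longleftrightarrow> sum_free a \<and> sum_free b"
| "sum_free (ILt a b c d) \<longleftrightarrow> sum_free a \<and> sum_free b \<and> sum_free c \<and> sum_free d"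
| "sum_free (Sum v a b) \<longleftrightarrow> False"
| "sum_free (LetE v a b) \<longleftrightarrow> sum_free a \<and> sum_free b"

text \<open>The result goes to register \<open>r\<close>, and everything from \<open>r\<close> on is
  scratch. A bound variable is an ordinary register; its old value is kept in \<open>r + 1\<close>
  and restored after the body, so no register below \<open>r\<close> is changed in the end.\<close>

fun compile :: "exp \<Rightarrow> nat \<Rightarrow> com" where
  "compile (Num c) r = Move r (Const c)"
| "compile (Var v) r = Move r (Reg v)"
| "compile (Mem a) r = Seq (compile a r) (Load r (Reg r))"
| "compile (Bin f a b) r =
    Seq (compile a r) (Seq (compile b (r + 1)) (Op r f (Reg r) (Reg (r + 1))))"
| "compile (ILt a b c d) r =
    Seq (compile a r) (Seq (compile b (r + 1))
      (Cond (Lt (Reg r) (Reg (r + 1))) (compile c r) (compile d r)))"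
| "compile (Sum v a b) r =
    Seq (compile a r) (Seq (Move (r + 1) (Reg v)) (Seq (Move (r + 2) (Const 0)) (Seq (Move v (Const 0))
     (Seq (While (Lt (Reg v) (Reg r))
        (Seq (compile b (r + 3)) (Seq (Op (r + 2) Add (Reg (r + 2)) (Reg (r + 3)))
          (Op v Add (Reg v) (Const 1)))))
     (Seq (Move v (Reg (r + 1))) (Move r (Reg (r + 2))))))))"
| "compile (LetE v a b) r =
    Seq (compile a r) (Seq (Move (r + 1) (Reg v)) (Seq (Move v (Reg r))
      (Seq (compile b (r + 2)) (Seq (Move v (Reg (r + 1))) (Move r (Reg (r + 2)))))))"

lemma eval_cong:
  "wf_exp r e \<Longrightarrow> (\<And>v. v < r \<Longrightarrow> \<rho> v = \<rho>' v) \<Longrightarrow> eval e \<rho> \<mu> = eval e \<rho>' \<mu>"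
proof (induction e arbitrary: \<rho> \<rho>')
  case (Sum v a b)
  have a: "eval a \<rho> \<mu> = eval a \<rho>' \<mu>" by (rule Sum.IH(1)) (use Sum.prems in auto)
  have "eval b (\<rho>(v := i)) \<mu> = eval b (\<rho>'(v := i)) \<mu>" for i
    by (rule Sum.IH(2)) (use Sum.prems in auto)
  then show ?case unfolding eval.simps a by (rule sum.cong[OF refl])
next
  case (LetE v a b)
  have a: "eval a \<rho> \<mu> = eval a \<rho>' \<mu>" by (rule LetE.IH(1)) (use LetE.prems in auto)
  have b: "eval b (\<rho>(v := i)) \<mu> = eval b (\<rho>'(v := i)) \<mu>" for i
    by (rule LetE.IH(2)) (use LetE.prems in auto)
  show ?case unfolding eval.simps a by (rule b)
next
  case (Bin f a b)
  have "eval a \<rho> \<mu> = eval a \<rho>' \<mu>" by (rule Bin.IH(1)) (use Bin.prems in auto)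
  moreover have "eval b \<rho> \<mu> = eval b \<rho>' \<mu>" by (rule Bin.IH(2)) (use Bin.prems in auto)
  ultimately show ?case unfolding eval.simps by (rule arg_cong2)
next
  case (ILt a b c d)
  have a: "eval a \<rho> \<mu> = eval a \<rho>' \<mu>" by (rule ILt.IH(1)) (use ILt.prems in auto)
  have b: "eval b \<rho> \<mu> = eval b \<rho>' \<mu>" by (rule ILt.IH(2)) (use ILt.prems in auto)
  have c: "eval c \<rho> \<mu> = eval c \<rho>' \<mu>" by (rule ILt.IH(3)) (use ILt.prems in auto)
  have d: "eval d \<rho> \<mu> = eval d \<rho>' \<mu>" by (rule ILt.IH(4)) (use ILt.prems in auto)
  show ?case unfolding eval.simps a b c d ..
next
  case (Mem a)
  have a: "eval a \<rho> \<mu> = eval a \<rho>' \<mu>" by (rule Mem.IH) (use Mem.prems in auto)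
  show ?case unfolding eval.simps a ..
qed auto

section \<open>Polynomial bounds on values and running times of compiled expressions\<close>

lemma pow_add_bound:
  fixes x y L :: nat
  assumes "2 \<le> L" "x \<le> L ^ p" "y \<le> L ^ q" "p < u" "q < u"
  shows "x + y \<le> L ^ u"
proof -
  have "x \<le> L ^ (u - 1)" "y \<le> L ^ (u - 1)"
    using assms by (auto intro: order_trans[OF _ power_increasing])
  then have "x + y \<le> 2 * L ^ (u - 1)" by simp
  also have "\<dots> \<le> L * L ^ (u - 1)" using assms by simp
  also have "\<dots> = L ^ u" using assms by (cases u) auto
  finally show ?thesis .
qed


lemma self_le_pow: "2 \<le> L \<Longrightarrow> c \<le> L ^ c" for L c :: nat
  by (metis less_exp less_imp_le_nat order_trans power_mono zero_le)

text \<open>Memory is bounded by \<open>L\<close> itself rather than by a power of it: all table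
  entries stay below \<open>L\<close>, so exponents do not accumulate from one table to the
  next.\<close>

definition env_ok :: "nat \<Rightarrow> nat \<Rightarrow> nat \<Rightarrow> state \<Rightarrow> bool" where
  "env_ok L c r \<sigma> \<longleftrightarrow> (\<forall>j<r. reg \<sigma> j \<le> L ^ c) \<and> (\<forall>a. mem \<sigma> a \<le> L)"

text \<open>The constant \<open>c\<close> is an exponent if there are loops and the number of steps
  itself if there are none. The second reading does not mention \<open>L\<close>, and constant query
  time rests on it.\<close>

definition exp_time :: "exp \<Rightarrow> nat \<Rightarrow> nat \<Rightarrow> nat" where
  "exp_time e L c = (if sum_free e then c else L ^ c)"

definition exp_post :: "exp \<Rightarrow> nat \<Rightarrow> state \<Rightarrow> state \<Rightarrow> bool" where
  "exp_post e r \<sigma> \<sigma>' \<longleftrightarrow> mem \<sigma>' = mem \<sigma> \<and> reg \<sigma>' r = eval e (reg \<sigma>) (mem \<sigma>) \<and>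
    (\<forall>j<r. reg \<sigma>' j = reg \<sigma> j)"

text \<open>The variables are the registers below \<open>q\<close>; those from \<open>r\<close> on hold intermediate results.\<close>

definition computes :: "nat \<Rightarrow> nat \<Rightarrow> nat \<Rightarrow> nat \<Rightarrow> exp \<Rightarrow> bool" where
  "computes q c c' r e \<longleftrightarrow> (\<forall>L w \<sigma>. 2 \<le> L \<longrightarrow> L ^ c' < 2 ^ w \<longrightarrow> env_ok L c q \<sigma> \<longrightarrow>
    eval e (reg \<sigma>) (mem \<sigma>) \<le> L ^ c' \<and> runs w (compile e r) \<sigma> (exp_time e L c') (exp_post e r \<sigma>))"

lemma computesD:
  assumes "computes q c c' r e" "2 \<le> L" "L ^ c' < 2 ^ w" "env_ok L c q \<sigma>"
  shows "eval e (reg \<sigma>) (mem \<sigma>) \<le> L ^ c'"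
    "runs w (compile e r) \<sigma> (exp_time e L c') (exp_post e r \<sigma>)"
  using assms unfolding computes_def by blast+

lemma exp_time_mono: "2 \<le> L \<Longrightarrow> c \<le> c' \<Longrightarrow> exp_time e L c \<le> exp_time e L c'"
  unfolding exp_time_def by (auto intro: power_increasing)

lemma exp_time_le_pow: "2 \<le> L \<Longrightarrow> exp_time e L c \<le> L ^ c"
  unfolding exp_time_def by (auto simp: self_le_pow)

lemma computes_mono:
  assumes "computes q c c1 r e" "c1 \<le> c2" shows "computes q c c2 r e"
  unfolding computes_def
proof (intro allI impI)
  fix L w :: nat and \<sigma> :: state assume L: "2 \<le> L" "L ^ c2 < 2 ^ w" "env_ok L c q \<sigma>"
  have le: "L ^ c1 \<le> L ^ c2" using L assms by (intro power_increasing) auto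
  then have "L ^ c1 < 2 ^ w" using L by linarith
  note D = computesD[OF assms(1) L(1) this L(3)]
  show "eval e (reg \<sigma>) (mem \<sigma>) \<le> L ^ c2 \<and> runs w (compile e r) \<sigma> (exp_time e L c2) (exp_post e r \<sigma>)"
    using D le runs_weaken[OF D(2) exp_time_mono[OF L(1) assms(2)]] by auto
qed

lemma env_ok_agree:
  "env_ok L c q \<sigma> \<Longrightarrow> mem \<sigma>' = mem \<sigma> \<Longrightarrow> (\<And>j. j < q \<Longrightarrow> reg \<sigma>' j = reg \<sigma> j) \<Longrightarrow> env_ok L c q \<sigma>'"
  unfolding env_ok_def by simp

text \<open>Subexpressions run after scratch registers have changed; their value depends only on the
  memory and on the variables below \<open>q\<close>.\<close>

lemma computes_agree:
  assumes "computes q c c' r e" "wf_exp q e" "2 \<le> L" "L ^ c' < 2 ^ w" "env_ok L c q \<sigma>"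
    and "mem \<sigma>' = mem \<sigma>" "\<And>j. j < q \<Longrightarrow> reg \<sigma>' j = reg \<sigma> j"
  shows "runs w (compile e r) \<sigma>' (exp_time e L c') (\<lambda>\<sigma>''. mem \<sigma>'' = mem \<sigma> \<and>
    reg \<sigma>'' r = eval e (reg \<sigma>) (mem \<sigma>) \<and> (\<forall>j<r. reg \<sigma>'' j = reg \<sigma>' j))"
proof -
  have "eval e (reg \<sigma>') (mem \<sigma>) = eval e (reg \<sigma>) (mem \<sigma>)" using assms(2,7) by (rule eval_cong)
  then show ?thesis
    using computesD(2)[OF assms(1,3,4) env_ok_agree[OF assms(5-7)]] assms(6)
    by (auto simp: exp_post_def elim: runs_weaken)
qed

lemma binop_bound:
  assumes "f \<in> {Add, Sub, Mul, Div, Mod, Shr}"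
  shows "binop_val f a b \<le> (a + 1) * (b + 1)"
proof -
  have "a \<le> (a + 1) * (b + 1)" by simp
  moreover have "a mod b \<le> a" "a div b \<le> a" "drop_bit b a \<le> a"
    by (simp_all add: drop_bit_eq_div)
  ultimately have "a mod b \<le> (a + 1) * (b + 1)" "a div b \<le> (a + 1) * (b + 1)"
    "drop_bit b a \<le> (a + 1) * (b + 1)" by linarith+
  then show ?thesis using assms by auto
qed

lemma computes_Bin:
  assumes f: "f \<in> {Add, Sub, Mul, Div, Mod, Shr}"
    and a: "computes q c c1 r a" and b: "computes q c c1 (Suc r) b" and wf: "wf_exp q b" "q \<le> r"
  shows "computes q c (c1 + c1 + 4) r (Bin f a b)"
  unfolding computes_def
proof (intro allI impI)
  fix L w :: nat and \<sigma> :: state assume L: "2 \<le> L" "L ^ (c1 + c1 + 4) < 2 ^ w" "env_ok L c q \<sigma>"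
  let ?va = "eval a (reg \<sigma>) (mem \<sigma>)" and ?vb = "eval b (reg \<sigma>) (mem \<sigma>)"
  have "L ^ c1 \<le> L ^ (c1 + c1 + 4)" using L by (intro power_increasing; auto)
  then have w: "L ^ c1 < 2 ^ w" using L by linarith
  note A = computesD[OF a L(1) w L(3)] and B = computesD[OF b L(1) w L(3)]
  have pos: "1 \<le> L ^ c1" using L by auto
  have "binop_val f ?va ?vb \<le> (?va + 1) * (?vb + 1)" using f by (rule binop_bound)
  \<comment> \<open>Incrementing at most doubles each bound because \<open>1 \<le> L ^ c1\<close>;
    the two factors 2 together cost an exponent of 2.\<close>
  also have "\<dots> \<le> (2 * L ^ c1) * (2 * L ^ c1)" using A(1) B(1) pos by (intro mult_le_mono) auto
  also have "\<dots> = 2 ^ 2 * L ^ (c1 + c1)" by (simp add: power_add)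
  also have "\<dots> \<le> L ^ 2 * L ^ (c1 + c1)" using L by (intro mult_le_mono power_mono) auto
  also have "\<dots> = L ^ (c1 + c1 + 2)" by (simp add: power_add power2_eq_square)
  also have "\<dots> \<le> L ^ (c1 + c1 + 4)" using L by (intro power_increasing) auto
  finally have val: "binop_val f ?va ?vb \<le> L ^ (c1 + c1 + 4)" .
  have time: "exp_time a L c1 + (exp_time b L c1 + 1) \<le> exp_time (Bin f a b) L (c1 + c1 + 4)"
  proof (cases "sum_free (Bin f a b)")
    case False
    have "exp_time a L c1 + (exp_time b L c1 + 1) \<le> L ^ c1 + (L ^ c1 + 1)"
      using exp_time_le_pow[OF L(1)] by (intro add_mono) auto
    also have "\<dots> \<le> L ^ (c1 + c1 + 4)"
    proof (rule pow_add_bound[OF L(1) order_refl])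
      show "L ^ c1 + 1 \<le> L ^ (c1 + 1)" by (rule pow_add_bound[OF L(1) order_refl, of _ 0]) auto
    qed auto
    finally show ?thesis using False by (simp add: exp_time_def)
  qed (simp add: exp_time_def)
  have "runs w (compile (Bin f a b) r) \<sigma> (exp_time a L c1 + (exp_time b L c1 + 1))
      (exp_post (Bin f a b) r \<sigma>)"
    unfolding compile.simps
  proof (intro runs_Seq runs_weaken[OF A(2) order_refl])
    fix \<sigma>' :: state assume p: "exp_post a r \<sigma> \<sigma>'"
    show "runs w (compile b (r + 1)) \<sigma>' (exp_time b L c1)
        (\<lambda>\<sigma>'. runs w (Op r f (Reg r) (Reg (r + 1))) \<sigma>' 1 (exp_post (Bin f a b) r \<sigma>))"
      unfolding Suc_eq_plus1[symmetric]
    proof (rule runs_weaken[OF computes_agree[OF b wf(1) L(1) w L(3)] order_refl])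
      show "mem \<sigma>' = mem \<sigma>" "\<And>j. j < q \<Longrightarrow> reg \<sigma>' j = reg \<sigma> j" using p wf(2) by (auto simp: exp_post_def)
      fix \<sigma>'' :: state assume q: "mem \<sigma>'' = mem \<sigma> \<and> reg \<sigma>'' (Suc r) = ?vb \<and> (\<forall>j<Suc r. reg \<sigma>'' j = reg \<sigma>' j)"
      have "take_bit w (binop_val f ?va ?vb) = binop_val f ?va ?vb"
        using val L(2) by (auto intro!: take_bit_nat_eq_self)
      then show "runs w (Op r f (Reg r) (Reg (Suc r))) \<sigma>'' 1 (exp_post (Bin f a b) r \<sigma>)"
        using p q by (intro runs_Op) (auto simp: exp_post_def)
    qed
  qed
  then show "eval (Bin f a b) (reg \<sigma>) (mem \<sigma>) \<le> L ^ (c1 + c1 + 4) \<and>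
      runs w (compile (Bin f a b) r) \<sigma> (exp_time (Bin f a b) L (c1 + c1 + 4)) (exp_post (Bin f a b) r \<sigma>)"
    using val time by (auto intro: runs_weaken)
qed

lemma computes_ILt:
  assumes a: "computes q c c2 r a" and b: "computes q c c2 (Suc r) b"
    and d: "computes q c c2 r d" and e: "computes q c c2 r e"
    and wf: "wf_exp q b" "wf_exp q d" "wf_exp q e" "q \<le> r"
  shows "computes q c (c2 + c2 + c2 + c2 + 4) r (ILt a b d e)"
  unfolding computes_def
proof (intro allI impI)
  fix L w :: nat and \<sigma> :: state assume L: "2 \<le> L" "L ^ (c2 + c2 + c2 + c2 + 4) < 2 ^ w" "env_ok L c q \<sigma>"
  let ?c' = "c2 + c2 + c2 + c2 + 4"
  have le: "L ^ c2 \<le> L ^ ?c'" using L by (intro power_increasing; auto)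
  then have w: "L ^ c2 < 2 ^ w" using L by linarith
  note A = computesD[OF a L(1) w L(3)] and D = computesD[OF d L(1) w L(3)] and E = computesD[OF e L(1) w L(3)]
  let ?T = "exp_time d L c2 + exp_time e L c2"
  have time: "exp_time a L c2 + (exp_time b L c2 + Suc ?T) \<le> exp_time (ILt a b d e) L ?c'"
  proof (cases "sum_free (ILt a b d e)")
    case False
    have "exp_time a L c2 + (exp_time b L c2 + Suc ?T) \<le> L ^ c2 + (L ^ c2 + Suc (L ^ c2 + L ^ c2))"
      using exp_time_le_pow[OF L(1)] by (intro add_mono Suc_leI le_imp_less_Suc) auto
    also have "\<dots> \<le> L ^ (c2 + 4)"
    proof (rule pow_add_bound[OF L(1) order_refl])
      have "1 \<le> L ^ c2" using L by simp
      then have "L ^ c2 + Suc (L ^ c2 + L ^ c2) \<le> 2 ^ 2 * L ^ c2" by simp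
      also have "\<dots> \<le> L ^ 2 * L ^ c2" using L by (intro mult_le_mono power_mono) auto
      also have "\<dots> = L ^ (c2 + 2)" by (simp add: power_add power2_eq_square)
      finally show "L ^ c2 + Suc (L ^ c2 + L ^ c2) \<le> L ^ (c2 + 2)" .
    qed auto
    also have "\<dots> \<le> L ^ ?c'" using L by (intro power_increasing) auto
    finally show ?thesis using False by (simp add: exp_time_def)
  qed (simp add: exp_time_def)
  have "runs w (compile (ILt a b d e) r) \<sigma> (exp_time a L c2 + (exp_time b L c2 + Suc ?T))
      (exp_post (ILt a b d e) r \<sigma>)"
    unfolding compile.simps
  proof (intro runs_Seq runs_weaken[OF A(2) order_refl])
    fix \<sigma>' :: state assume p: "exp_post a r \<sigma> \<sigma>'"
    show "runs w (compile b (r + 1)) \<sigma>' (exp_time b L c2)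
        (\<lambda>\<sigma>'. runs w (Cond (Lt (Reg r) (Reg (r + 1))) (compile d r) (compile e r)) \<sigma>' (Suc ?T)
          (exp_post (ILt a b d e) r \<sigma>))"
      unfolding Suc_eq_plus1[symmetric]
    proof (rule runs_weaken[OF computes_agree[OF b wf(1) L(1) w L(3)] order_refl])
      show "mem \<sigma>' = mem \<sigma>" "\<And>j. j < q \<Longrightarrow> reg \<sigma>' j = reg \<sigma> j" using p wf by (auto simp: exp_post_def)
      fix \<sigma>'' :: state assume q: "mem \<sigma>'' = mem \<sigma> \<and> reg \<sigma>'' (Suc r) = eval b (reg \<sigma>) (mem \<sigma>) \<and> (\<forall>j<Suc r. reg \<sigma>'' j = reg \<sigma>' j)"
      then have m: "mem \<sigma>'' = mem \<sigma>" "\<And>j. j < q \<Longrightarrow> reg \<sigma>'' j = reg \<sigma> j" "\<forall>j<r. reg \<sigma>'' j = reg \<sigma> j"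
        "reg \<sigma>'' r = eval a (reg \<sigma>) (mem \<sigma>)"
        using p wf by (auto simp: exp_post_def)
      show "runs w (Cond (Lt (Reg r) (Reg (Suc r))) (compile d r) (compile e r)) \<sigma>'' (Suc ?T)
          (exp_post (ILt a b d e) r \<sigma>)"
      proof (rule runs_Cond)
        assume "test_val w \<sigma>'' (Lt (Reg r) (Reg (Suc r)))"
        then show "runs w (compile d r) \<sigma>'' ?T (exp_post (ILt a b d e) r \<sigma>)"
          using m q by (intro runs_weaken[OF computes_agree[OF d wf(2) L(1) w L(3) m(1,2)]])
            (auto simp: exp_post_def)
      next
        assume "\<not> test_val w \<sigma>'' (Lt (Reg r) (Reg (Suc r)))"
        then show "runs w (compile e r) \<sigma>'' ?T (exp_post (ILt a b d e) r \<sigma>)"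
          using m q by (intro runs_weaken[OF computes_agree[OF e wf(3) L(1) w L(3) m(1,2)]])
            (auto simp: exp_post_def)
      qed
    qed
  qed
  moreover have "eval (ILt a b d e) (reg \<sigma>) (mem \<sigma>) \<le> L ^ ?c'"
    using D(1) E(1) le by auto
  ultimately show "eval (ILt a b d e) (reg \<sigma>) (mem \<sigma>) \<le> L ^ ?c' \<and>
      runs w (compile (ILt a b d e) r) \<sigma> (exp_time (ILt a b d e) L ?c') (exp_post (ILt a b d e) r \<sigma>)"
    using time by (auto intro: runs_weaken)
qed

lemma env_ok_upd:
  assumes "env_ok L c q \<sigma>" "x \<le> L ^ c1" "c \<le> c1" "2 \<le> L"
  shows "env_ok L c1 q (\<sigma>\<lparr>reg := (reg \<sigma>)(v := x)\<rparr>)"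
proof -
  have "L ^ c \<le> L ^ c1" using assms by (intro power_increasing) auto
  then show ?thesis using assms by (auto simp: env_ok_def intro: order_trans)
qed

lemma computes_LetE:
  assumes a: "computes q c c1 r a" and b: "computes q c1 c2 (r + 2) b"
    and wf: "wf_exp q b" "v < q" "q \<le> r" and c: "c \<le> c1" "c1 \<le> c2"
  shows "computes q c (c1 + c2 + 4) r (LetE v a b)"
  unfolding computes_def
proof (intro allI impI)
  fix L w :: nat and \<sigma> :: state assume L: "2 \<le> L" "L ^ (c1 + c2 + 4) < 2 ^ w" "env_ok L c q \<sigma>"
  let ?c' = "c1 + c2 + 4" and ?va = "eval a (reg \<sigma>) (mem \<sigma>)"
  let ?\<sigma> = "\<sigma>\<lparr>reg := (reg \<sigma>)(v := ?va)\<rparr>"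
  let ?vb = "eval b (reg ?\<sigma>) (mem ?\<sigma>)"
  have le: "L ^ c1 \<le> L ^ ?c'" "L ^ c2 \<le> L ^ ?c'"
    using L by (intro power_increasing; auto)+
  then have w: "L ^ c1 < 2 ^ w" "L ^ c2 < 2 ^ w" using L by linarith+
  note A = computesD[OF a L(1) w(1) L(3)]
  have ok: "env_ok L c1 q ?\<sigma>" using env_ok_upd[OF L(3) A(1) c(1) L(1)] .
  note B = computesD[OF b L(1) w(2) ok]
  have time: "exp_time a L c1 + (1 + (1 + (exp_time b L c2 + (1 + 1)))) \<le> exp_time (LetE v a b) L ?c'"
  proof (cases "sum_free (LetE v a b)")
    case False
    have "exp_time a L c1 + (1 + (1 + (exp_time b L c2 + (1 + 1)))) \<le> L ^ c1 + (L ^ c2 + 4)"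
      using exp_time_le_pow[OF L(1), of a c1] exp_time_le_pow[OF L(1), of b c2] by linarith
    also have "\<dots> \<le> L ^ ?c'"
    proof (rule pow_add_bound[OF L(1) order_refl])
      have "(4::nat) \<le> L ^ 2" using power_mono[of 2 L 2] L by simp
      then show "L ^ c2 + 4 \<le> L ^ (c2 + 3)" by (intro pow_add_bound[OF L(1) order_refl, of _ 2]) auto
    qed auto
    finally show ?thesis using False by (simp add: exp_time_def)
  qed (simp add: exp_time_def)
  have "runs w (compile (LetE v a b) r) \<sigma> (exp_time a L c1 + (1 + (1 + (exp_time b L c2 + (1 + 1)))))
      (exp_post (LetE v a b) r \<sigma>)"
    unfolding compile.simps
  proof (intro runs_Seq runs_weaken[OF A(2) order_refl] runs_Move)
    fix \<sigma>' :: state assume p: "exp_post a r \<sigma> \<sigma>'"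
    let ?\<sigma>1 = "\<sigma>'\<lparr>reg := (reg \<sigma>')(r + 1 := operand_val w \<sigma>' (Reg v))\<rparr>"
    let ?\<sigma>2 = "?\<sigma>1\<lparr>reg := (reg ?\<sigma>1)(v := operand_val w ?\<sigma>1 (Reg r))\<rparr>"
    have m: "mem ?\<sigma>2 = mem ?\<sigma>" "\<And>j. j < q \<Longrightarrow> reg ?\<sigma>2 j = reg ?\<sigma> j"
      using p wf by (auto simp: exp_post_def)
    show "runs w (compile b (r + 2)) ?\<sigma>2 (exp_time b L c2) (\<lambda>\<sigma>'. runs w (Seq (Move v (Reg (r + 1))) (Move r (Reg (r + 2)))) \<sigma>' (1 + 1)
              (exp_post (LetE v a b) r \<sigma>))"
    proof (rule runs_weaken[OF computes_agree[OF b wf(1) L(1) w(2) ok m] order_refl], assumption, intro runs_Seq runs_Move)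
      fix \<sigma>'' :: state assume q: "mem \<sigma>'' = mem ?\<sigma> \<and> reg \<sigma>'' (r + 2) = ?vb \<and> (\<forall>j<r + 2. reg \<sigma>'' j = reg ?\<sigma>2 j)"
      let ?\<sigma>3 = "\<sigma>''\<lparr>reg := (reg \<sigma>'')(v := operand_val w \<sigma>'' (Reg (r + 1)))\<rparr>"
      show "exp_post (LetE v a b) r \<sigma> (?\<sigma>3\<lparr>reg := (reg ?\<sigma>3)(r := operand_val w ?\<sigma>3 (Reg (r + 2)))\<rparr>)"
        using p q wf by (auto simp: exp_post_def)
    qed
  qed
  moreover have "eval (LetE v a b) (reg \<sigma>) (mem \<sigma>) \<le> L ^ ?c'"
    using B(1) le by simp
  ultimately show "eval (LetE v a b) (reg \<sigma>) (mem \<sigma>) \<le> L ^ ?c' \<and>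
      runs w (compile (LetE v a b) r) \<sigma> (exp_time (LetE v a b) L ?c') (exp_post (LetE v a b) r \<sigma>)"
    using time by (auto intro: runs_weaken)
qed

text \<open>At most \<open>L ^ c1\<close> rounds, each adding at most \<open>L ^ c2\<close>. The
  body is bounded relative to \<open>c1\<close> since the loop variable may grow up to the value of
  \<open>a\<close>.\<close>

lemma computes_Sum:
  assumes a: "computes q c c1 r a" and b: "computes q c1 c2 (r + 3) b"
    and wf: "wf_exp q b" "v < q" "q \<le> r" and c: "c \<le> c1" "c1 \<le> c2"
  shows "computes q c (c1 + c2 + 5) r (Sum v a b)"
  unfolding computes_def
proof (intro allI impI)
  fix L w :: nat and \<sigma> :: state
  assume L: "2 \<le> L" "L ^ (c1 + c2 + 5) < 2 ^ w" "env_ok L c q \<sigma>"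
  let ?c' = "c1 + c2 + 5" and ?va = "eval a (reg \<sigma>) (mem \<sigma>)"
  let ?\<sigma> = "\<lambda>i. \<sigma>\<lparr>reg := (reg \<sigma>)(v := i)\<rparr>"
  let ?vb = "\<lambda>i. eval b (reg (?\<sigma> i)) (mem (?\<sigma> i))"
  define acc where "acc i = (\<Sum>j<i. ?vb j)" for i
  have le: "L ^ c1 \<le> L ^ ?c'" "L ^ c2 \<le> L ^ ?c'" "L ^ (c1 + c2) \<le> L ^ ?c'"
    using L by (intro power_increasing; auto)+
  then have w: "L ^ c1 < 2 ^ w" "L ^ c2 < 2 ^ w" using L by linarith+
  have w2: "1 < (2::nat) ^ w"
  proof -
    have "1 \<le> L ^ ?c'" using L by simp
    then show ?thesis using L by linarith
  qed
  have w3: "0 < w" using w2 by (cases w) auto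
  note A = computesD[OF a L(1) w(1) L(3)]
  have ok: "env_ok L c1 q (?\<sigma> i)" if "i < ?va" for i
    using A(1) that by (intro env_ok_upd[OF L(3) _ c(1) L(1)]) simp
  note vb = computesD(1)[OF b L(1) w(2) ok]
  have acc: "acc i \<le> L ^ (c1 + c2)" if "i \<le> ?va" for i
  proof -
    have "acc i \<le> of_nat (card {..<i}) * L ^ c2" unfolding acc_def
      by (rule sum_bounded_above) (use vb that in auto)
    also have "\<dots> \<le> L ^ c1 * L ^ c2" using that A(1) by simp
    finally show ?thesis by (simp add: power_add)
  qed
  obtain T where T: "T = exp_time b L c2 + (1 + 1)" by blast
  define I :: "nat \<Rightarrow> state \<Rightarrow> bool" where "I i \<sigma>' \<longleftrightarrow> mem \<sigma>' = mem \<sigma> \<and> (\<forall>j<r. reg \<sigma>' j = ((reg \<sigma>)(v := i)) j) \<and>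
    reg \<sigma>' r = ?va \<and> reg \<sigma>' (Suc r) = reg \<sigma> v \<and> reg \<sigma>' (r + 2) = acc i" for i \<sigma>'
  have loop: "runs w (While (Lt (Reg v) (Reg r)) (Seq (compile b (r + 3))
        (Seq (Op (r + 2) Add (Reg (r + 2)) (Reg (r + 3))) (Op v Add (Reg v) (Const 1))))) \<sigma>'
      ((?va - 0) * Suc T + 1) (I ?va)" if "I 0 \<sigma>'" for \<sigma>'
  proof (rule runs_While_count[where I = I])
    fix i and \<sigma>1 :: state assume i: "i < ?va" and I: "I i \<sigma>1"
    have t: "test_val w \<sigma>1 (Lt (Reg v) (Reg r))" using I i wf by (simp add: I_def)
    have m: "mem \<sigma>1 = mem (?\<sigma> i)" "\<And>j. j < q \<Longrightarrow> reg \<sigma>1 j = reg (?\<sigma> i) j"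
      using I wf by (auto simp: I_def)
    have "runs w (Seq (compile b (r + 3))
        (Seq (Op (r + 2) Add (Reg (r + 2)) (Reg (r + 3))) (Op v Add (Reg v) (Const 1)))) \<sigma>1 T (I (Suc i))"
      unfolding T
    proof (intro runs_Seq runs_weaken[OF computes_agree[OF b wf(1) L(1) w(2) ok[OF i] m] order_refl], assumption,
        intro runs_Op)
      fix \<sigma>2 :: state assume q: "mem \<sigma>2 = mem (?\<sigma> i) \<and> reg \<sigma>2 (r + 3) = ?vb i \<and> (\<forall>j<r + 3. reg \<sigma>2 j = reg \<sigma>1 j)"
      let ?\<sigma>3 = "\<sigma>2\<lparr>reg := (reg \<sigma>2)(r + 2 := take_bit w (binop_val Add (operand_val w \<sigma>2 (Reg (r + 2)))
          (operand_val w \<sigma>2 (Reg (r + 3)))))\<rparr>"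
      have s: "acc (Suc i) = acc i + ?vb i" by (simp add: acc_def)
      have "acc (Suc i) < 2 ^ w" using acc[of "Suc i"] i le(3) L(2) by linarith
      then have tb: "take_bit w (acc i + ?vb i) = acc (Suc i)" "take_bit w (Suc i) = Suc i" "take_bit w 1 = (1::nat)"
        using s i A(1) w w2 w3 by (auto intro!: take_bit_nat_eq_self)
      have r: "reg \<sigma>2 (r + 2) = acc i" "reg \<sigma>2 (r + 3) = ?vb i" "reg \<sigma>2 v = i"
        using q I wf by (auto simp: I_def)
      show "I (Suc i) (?\<sigma>3\<lparr>reg := (reg ?\<sigma>3)(v := take_bit w (binop_val Add (operand_val w ?\<sigma>3 (Reg v))
          (operand_val w ?\<sigma>3 (Const 1))))\<rparr>)"
        using q I wf tb r by (auto simp: I_def)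
    qed
    then show "test_val w \<sigma>1 (Lt (Reg v) (Reg r)) \<and> runs w (Seq (compile b (r + 3))
        (Seq (Op (r + 2) Add (Reg (r + 2)) (Reg (r + 3))) (Op v Add (Reg v) (Const 1)))) \<sigma>1 T (I (Suc i))"
      using t by blast
  qed (use that wf in \<open>auto simp: I_def\<close>)
  have time: "exp_time a L c1 + (1 + (1 + (1 + (((?va - 0) * Suc T + 1) + (1 + 1)))))
      \<le> exp_time (Sum v a b) L ?c'"
  proof -
    have X: "1 \<le> L ^ c1" "1 \<le> L ^ c2" using L by auto
    have "T \<le> L ^ c2 + 2" using exp_time_le_pow[OF L(1), of b c2] T by simp
    then have "?va * Suc T \<le> L ^ c1 * (4 * L ^ c2)" using A(1) X by (intro mult_le_mono) auto
    also have "\<dots> = 4 * (L ^ c1 * L ^ c2)" by simp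
    finally have va: "?va * Suc T \<le> 4 * (L ^ c1 * L ^ c2)" .
    have "L ^ c1 * 1 \<le> L ^ c1 * L ^ c2" using X by (intro mult_le_mono) auto
    then have "exp_time a L c1 \<le> L ^ c1 * L ^ c2"
      using exp_time_le_pow[OF L(1), of a c1] by linarith
    moreover have "1 \<le> L ^ c1 * L ^ c2" using X by simp
    ultimately have "exp_time a L c1 + (1 + (1 + (1 + (((?va - 0) * Suc T + 1) + (1 + 1))))) \<le> 16 * (L ^ c1 * L ^ c2)"
      using va unfolding diff_zero by linarith
    also have "\<dots> \<le> L ^ 4 * (L ^ c1 * L ^ c2)"
      using power_mono[of 2 L 4] L by (intro mult_le_mono1) simp
    also have "\<dots> = L ^ (c1 + c2 + 4)" by (simp add: power_add)
    also have "\<dots> \<le> L ^ ?c'" using L by (intro power_increasing) auto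
    finally show ?thesis by (simp add: exp_time_def)
  qed
  have "runs w (compile (Sum v a b) r) \<sigma>
      (exp_time a L c1 + (1 + (1 + (1 + (((?va - 0) * Suc T + 1) + (1 + 1)))))) (exp_post (Sum v a b) r \<sigma>)"
    unfolding compile.simps
  proof (intro runs_Seq runs_weaken[OF A(2) order_refl] runs_Move)
    fix \<sigma>' :: state assume p: "exp_post a r \<sigma> \<sigma>'"
    let ?\<sigma>1 = "\<sigma>'\<lparr>reg := (reg \<sigma>')(r + 1 := operand_val w \<sigma>' (Reg v))\<rparr>"
    let ?\<sigma>2 = "?\<sigma>1\<lparr>reg := (reg ?\<sigma>1)(r + 2 := operand_val w ?\<sigma>1 (Const 0))\<rparr>"
    let ?\<sigma>3 = "?\<sigma>2\<lparr>reg := (reg ?\<sigma>2)(v := operand_val w ?\<sigma>2 (Const 0))\<rparr>"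
    have I0: "I 0 ?\<sigma>3" using p wf by (auto simp: I_def exp_post_def acc_def)
    show "runs w (While (Lt (Reg v) (Reg r)) (Seq (compile b (r + 3))
        (Seq (Op (r + 2) Add (Reg (r + 2)) (Reg (r + 3))) (Op v Add (Reg v) (Const 1))))) ?\<sigma>3
        ((?va - 0) * Suc T + 1) (\<lambda>\<sigma>'. runs w (Seq (Move v (Reg (r + 1))) (Move r (Reg (r + 2)))) \<sigma>' (1 + 1)
              (exp_post (Sum v a b) r \<sigma>))"
    proof (rule runs_weaken[OF loop[OF I0] order_refl], intro runs_Seq runs_Move)
      fix \<sigma>'' :: state assume q: "I ?va \<sigma>''"
      let ?\<sigma>4 = "\<sigma>''\<lparr>reg := (reg \<sigma>'')(v := operand_val w \<sigma>'' (Reg (r + 1)))\<rparr>"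
      show "exp_post (Sum v a b) r \<sigma> (?\<sigma>4\<lparr>reg := (reg ?\<sigma>4)(r := operand_val w ?\<sigma>4 (Reg (r + 2)))\<rparr>)"
        using q wf by (auto simp: exp_post_def I_def acc_def)
    qed
  qed
  moreover have "eval (Sum v a b) (reg \<sigma>) (mem \<sigma>) \<le> L ^ ?c'"
    using acc[of ?va] le by (simp add: acc_def)
  ultimately show "eval (Sum v a b) (reg \<sigma>) (mem \<sigma>) \<le> L ^ ?c' \<and>
      runs w (compile (Sum v a b) r) \<sigma> (exp_time (Sum v a b) L ?c') (exp_post (Sum v a b) r \<sigma>)"
    using time by (auto intro: runs_weaken)
qed

lemma computes_Num: "computes q c (Suc n) r (Num n)"
  unfolding computes_def
proof (intro allI impI)
  fix L w :: nat and \<sigma> :: state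
  assume L: "2 \<le> L" "L ^ Suc n < 2 ^ w" "env_ok L c q \<sigma>"
  have n: "n \<le> L ^ Suc n" using self_le_pow[OF L(1), of "Suc n"] by simp
  then have t: "take_bit w n = n" using L(2) by (auto intro!: take_bit_nat_eq_self)
  have "runs w (compile (Num n) r) \<sigma> 1 (exp_post (Num n) r \<sigma>)"
    by (simp only: compile.simps, rule runs_Move) (simp add: exp_post_def t)
  moreover have "1 \<le> exp_time (Num n) L (Suc n)" by (simp add: exp_time_def)
  ultimately show "eval (Num n) (reg \<sigma>) (mem \<sigma>) \<le> L ^ Suc n \<and>
      runs w (compile (Num n) r) \<sigma> (exp_time (Num n) L (Suc n)) (exp_post (Num n) r \<sigma>)"
    using n by (auto intro: runs_weaken)
qed

lemma computes_Var:
  assumes "v < q" shows "computes q c (Suc c) r (Var v)"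
  unfolding computes_def
proof (intro allI impI)
  fix L w :: nat and \<sigma> :: state
  assume L: "2 \<le> L" "L ^ Suc c < 2 ^ w" "env_ok L c q \<sigma>"
  have "L ^ c \<le> L ^ Suc c" using L by (intro power_increasing) auto
  then have "reg \<sigma> v \<le> L ^ Suc c" using L(3) assms by (auto simp: env_ok_def intro: order_trans)
  moreover have "runs w (compile (Var v) r) \<sigma> 1 (exp_post (Var v) r \<sigma>)"
    by (simp only: compile.simps, rule runs_Move) (simp add: exp_post_def)
  moreover have "1 \<le> exp_time (Var v) L (Suc c)" by (simp add: exp_time_def)
  ultimately show "eval (Var v) (reg \<sigma>) (mem \<sigma>) \<le> L ^ Suc c \<and>
      runs w (compile (Var v) r) \<sigma> (exp_time (Var v) L (Suc c)) (exp_post (Var v) r \<sigma>)"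
    by (auto intro: runs_weaken)
qed

lemma computes_Mem:
  assumes a: "computes q c c1 r a"
  shows "computes q c (Suc c1) r (Mem a)"
  unfolding computes_def
proof (intro allI impI)
  fix L w :: nat and \<sigma> :: state
  assume L: "2 \<le> L" "L ^ Suc c1 < 2 ^ w" "env_ok L c q \<sigma>"
  have le: "L ^ c1 \<le> L ^ Suc c1" using L by (intro power_increasing) auto
  then have w: "L ^ c1 < 2 ^ w" using L by linarith
  note A = computesD[OF a L(1) w L(3)]
  have "L \<le> L ^ Suc c1" using L by simp
  then have "eval (Mem a) (reg \<sigma>) (mem \<sigma>) \<le> L ^ Suc c1"
    using L(3) by (auto simp: env_ok_def simp del: power_Suc intro: order_trans)
  moreover have "runs w (compile (Mem a) r) \<sigma> (exp_time a L c1 + 1) (exp_post (Mem a) r \<sigma>)"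
    unfolding compile.simps
    by (intro runs_Seq runs_weaken[OF A(2) order_refl] runs_Load) (auto simp: exp_post_def)
  moreover have "exp_time a L c1 + 1 \<le> exp_time (Mem a) L (Suc c1)"
  proof (cases "sum_free a")
    case False
    have "L ^ c1 + 1 \<le> L ^ Suc c1" by (rule pow_add_bound[OF L(1) order_refl, of _ 0]) auto
    then show ?thesis using False by (simp add: exp_time_def)
  qed (simp add: exp_time_def)
  ultimately show "eval (Mem a) (reg \<sigma>) (mem \<sigma>) \<le> L ^ Suc c1 \<and>
      runs w (compile (Mem a) r) \<sigma> (exp_time (Mem a) L (Suc c1)) (exp_post (Mem a) r \<sigma>)"
    by (auto intro: runs_weaken)
qed

text \<open>The exponent is chosen before \<open>L\<close>, \<open>w\<close> and the state, so it is
  a constant of the program. Exponents of subterms are made equal by adding them up.\<close>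

theorem computes_exists: "wf_exp q e \<Longrightarrow> q \<le> r \<Longrightarrow> \<exists>c'. computes q c c' r e"
proof (induction e arbitrary: c r)
  case (Num n)
  show ?case using computes_Num by blast
next
  case (Var v)
  then have "v < q" by simp
  then show ?case using computes_Var[of v q c r] by blast
next
  case (Mem a)
  then show ?case using computes_Mem by (meson wf_exp.simps(3))
next
  case (Bin f a b)
  obtain c1 c2 where c1: "computes q c c1 r a" and c2: "computes q c c2 (Suc r) b"
    using Bin.IH(1)[of r c] Bin.IH(2)[of "Suc r" c] Bin.prems by auto
  have "computes q c (c1 + c2) r a" "computes q c (c1 + c2) (Suc r) b"
    using computes_mono[OF c1] computes_mono[OF c2] by auto
  with Bin.prems show ?case by (meson computes_Bin wf_exp.simps(4))
next
  case (ILt a b d e)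
  obtain c1 c2 c3 c4 where c1: "computes q c c1 r a" and c2: "computes q c c2 (Suc r) b"
    and c3: "computes q c c3 r d" and c4: "computes q c c4 r e"
    using ILt.IH(1)[of r c] ILt.IH(2)[of "Suc r" c] ILt.IH(3)[of r c] ILt.IH(4)[of r c] ILt.prems by auto
  let ?c = "c1 + c2 + c3 + c4"
  have "computes q c ?c r a" "computes q c ?c (Suc r) b" "computes q c ?c r d" "computes q c ?c r e"
    using computes_mono[OF c1] computes_mono[OF c2] computes_mono[OF c3] computes_mono[OF c4] by auto
  with ILt.prems show ?case by (meson computes_ILt wf_exp.simps(5))
next
  case (Sum v a b)
  obtain c1 where c1: "computes q c c1 r a" using Sum.IH(1)[of r c] Sum.prems by auto
  \<comment> \<open>The body sees a loop variable as large as the value of \<open>a\<close>, hence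
    the induction hypothesis at exponent \<open>c + c1\<close>.\<close>
  obtain c2 where c2: "computes q (c + c1) c2 (r + 3) b"
    using Sum.IH(2)[of "r + 3" "c + c1"] Sum.prems by auto
  have "computes q c (c + c1) r a" "computes q (c + c1) (c + c1 + c2) (r + 3) b"
    using computes_mono[OF c1] computes_mono[OF c2] by auto
  from computes_Sum[OF this] Sum.prems show ?case by auto
next
  case (LetE v a b)
  obtain c1 where c1: "computes q c c1 r a" using LetE.IH(1)[of r c] LetE.prems by auto
  obtain c2 where c2: "computes q (c + c1) c2 (r + 2) b"
    using LetE.IH(2)[of "r + 2" "c + c1"] LetE.prems by auto
  have "computes q c (c + c1) r a" "computes q (c + c1) (c + c1 + c2) (r + 2) b"
    using computes_mono[OF c1] computes_mono[OF c2] by auto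
  from computes_LetE[OF this] LetE.prems show ?case by auto
qed

section \<open>Cut-vertices on a path\<close>

text \<open>A whole set is deleted while the arc relation stays the same: the arguments below delete
  two vertices at once and compare different deletions.\<close>

definition avoids :: "('a, 'b) pre_digraph \<Rightarrow> 'a set \<Rightarrow> 'a \<Rightarrow> 'a \<Rightarrow> bool" where
  "avoids G B u v \<longleftrightarrow> (u, v) \<in> rtrancl_on (verts G - B) (arcs_ends G)"

lemma (in wf_digraph) has_path_iff_avoids: "has_path G u v \<longleftrightarrow> avoids G {} u v"
  by (simp add: has_path_iff_reachable reachable_def avoids_def)

lemma (in wf_digraph) has_path_del_vert_iff_avoids:
  "has_path (del_vert x) u v \<longleftrightarrow> avoids G {x} u v"
proof -
  interpret D: wf_digraph "del_vert x" by (rule wf_digraph_del_vert)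
  have "(u, v) \<in> rtrancl_on (verts G - {x}) (arcs_ends (del_vert x)) \<longleftrightarrow>
    (u, v) \<in> rtrancl_on (verts G - {x}) (arcs_ends G)" (is "?l \<longleftrightarrow> ?r")
  proof
    assume ?l
    then show ?r by (rule rtrancl_on_mono[OF _ order_refl, rotated])
      (auto simp: arcs_ends_conv del_vert_simps)
  next
    assume ?r
    then show ?l
    proof (induction rule: rtrancl_on_induct)
      case (step y z)
      then have "(y, z) \<in> arcs_ends (del_vert x)"
        by (auto simp: arcs_ends_conv del_vert_simps image_iff)
      with step show ?case by (auto intro: rtrancl_on_into_rtrancl_on)
    qed auto
  qed
  then show ?thesis by (simp add: D.has_path_iff_reachable reachable_def avoids_def verts_del_vert)
qed

lemma avoids_refl: "u \<in> verts G \<Longrightarrow> u \<notin> B \<Longrightarrow> avoids G B u u"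
  by (simp add: avoids_def)

lemma avoids_trans: "avoids G B u v \<Longrightarrow> avoids G B v z \<Longrightarrow> avoids G B u z"
  unfolding avoids_def by (rule rtrancl_on_trans)

lemma avoids_notin: "avoids G B u v \<Longrightarrow> u \<notin> B \<and> v \<notin> B"
  unfolding avoids_def using in_rtrancl_on_in_F by fastforce

lemma avoids_antimono: "avoids G B u v \<Longrightarrow> A \<subseteq> B \<Longrightarrow> avoids G A u v"
  unfolding avoids_def by (erule rtrancl_on_mono[rotated 2]) auto

text \<open>Cut the path at its first vertex \<open>h\<close> in \<open>X\<close>: up to there no
  other vertex of \<open>X\<close> has been met.\<close>

lemma avoids_first_hit:
  assumes "avoids G B u v"
  shows "avoids G (B \<union> X) u v \<or> (\<exists>h\<in>X. avoids G (B \<union> (X - {h})) u h)"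
  using assms unfolding avoids_def
proof (induction rule: rtrancl_on_induct)
  case base
  show ?case
  proof (cases "u \<in> X")
    case True
    with base have "(u, u) \<in> rtrancl_on (verts G - (B \<union> (X - {u}))) (arcs_ends G)"
      by (intro rtrancl_on_refl) auto
    with True show ?thesis by blast
  qed (use base in auto)
next
  case (step y z)
  from step.IH show ?case
  proof
    assume y: "(u, y) \<in> rtrancl_on (verts G - (B \<union> X)) (arcs_ends G)"
    show ?thesis
    proof (cases "z \<in> X")
      case True
      have "(u, y) \<in> rtrancl_on (verts G - (B \<union> (X - {z}))) (arcs_ends G)"
        using y by (rule rtrancl_on_mono[rotated 2]) auto
      then have "(u, z) \<in> rtrancl_on (verts G - (B \<union> (X - {z}))) (arcs_ends G)"
        using step by (auto intro: rtrancl_on_into_rtrancl_on[of u y])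
      with True show ?thesis by blast
    next
      case False
      then show ?thesis using y step by (auto intro: rtrancl_on_into_rtrancl_on[of u y])
    qed
  qed blast
qed

lemma avoids_last_hit:
  assumes "avoids G B u v"
  shows "avoids G (B \<union> X) u v \<or> (\<exists>h\<in>X. avoids G (B \<union> (X - {h})) h v)"
  using assms unfolding avoids_def
proof (induction rule: converse_rtrancl_on_induct)
  case base
  show ?case
  proof (cases "v \<in> X")
    case True
    with base have "(v, v) \<in> rtrancl_on (verts G - (B \<union> (X - {v}))) (arcs_ends G)"
      by (intro rtrancl_on_refl) auto
    with True show ?thesis by blast
  qed (use base in auto)
next
  case (step y z)
  from step.IH show ?case
  proof
    assume y: "(z, v) \<in> rtrancl_on (verts G - (B \<union> X)) (arcs_ends G)"
    show ?thesis
    proof (cases "y \<in> X")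
      case True
      have "(z, v) \<in> rtrancl_on (verts G - (B \<union> (X - {y}))) (arcs_ends G)"
        using y by (rule rtrancl_on_mono[rotated 2]) auto
      then have "(y, v) \<in> rtrancl_on (verts G - (B \<union> (X - {y}))) (arcs_ends G)"
        using step by (auto intro: converse_rtrancl_on_into_rtrancl_on[of y z])
      with True show ?thesis by blast
    next
      case False
      then show ?thesis using y step by (auto intro: converse_rtrancl_on_into_rtrancl_on[of y z])
    qed
  qed blast
qed

lemma avoids_hit:
  assumes "avoids G B u v"
  shows "avoids G (insert x B) u v \<or> avoids G B u x \<and> avoids G B x v"
  using avoids_first_hit[OF assms, of "{x}"] avoids_last_hit[OF assms, of "{x}"] by auto

section \<open>The linear order of the cut-vertices\<close>

locale cut_vertices = wf_digraph G for G :: "('a, 'b) pre_digraph" +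
  fixes s t :: 'a and C :: "'a set"
  assumes finC: "finite C" and cut: "c \<in> C \<Longrightarrow> c \<in> verts G \<and> \<not> avoids G {c} s t"
    and conn: "avoids G {} s t"
begin

text \<open>A single path from \<open>s\<close> to \<open>a\<close> that misses \<open>b\<close>
  fixes the order for all paths, since \<open>before_asym\<close> excludes the converse.\<close>

definition before :: "'a \<Rightarrow> 'a \<Rightarrow> bool" where
  "before a b \<longleftrightarrow> avoids G {b} s a"

lemma before_irrefl: "\<not> before a a"
  using avoids_notin unfolding before_def by fastforce

text \<open>A path from \<open>s\<close> to \<open>t\<close> must meet \<open>a\<close> or
  \<open>b\<close>; the one that it meets first comes before the other.\<close>

lemma before_total:
  assumes "a \<in> C" "b \<in> C" "a \<noteq> b" shows "before a b \<or> before b a"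
proof -
  have "\<not> avoids G ({} \<union> {a, b}) s t"
    using cut[OF assms(1)] avoids_antimono[of G "{a, b}" s t "{a}"] by auto
  then obtain h where "h \<in> {a, b}" "avoids G ({} \<union> ({a, b} - {h})) s h"
    using avoids_first_hit[OF conn, of "{a, b}"] by blast
  then show ?thesis using assms(3) by (auto simp: before_def insert_Diff_if)
qed

lemma last_hit_t:
  assumes "a \<in> C" "b \<in> C" "a \<noteq> b" shows "avoids G {b} a t \<or> avoids G {a} b t"
proof -
  have "\<not> avoids G ({} \<union> {a, b}) s t"
    using cut[OF assms(1)] avoids_antimono[of G "{a, b}" s t "{a}"] by auto
  then obtain h where "h \<in> {a, b}" "avoids G ({} \<union> ({a, b} - {h})) h t"
    using avoids_last_hit[OF conn, of "{a, b}"] by blast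
  then show ?thesis using assms(3) by (auto simp: insert_Diff_if)
qed

text \<open>The last of the two vertices on a path to \<open>t\<close> cannot be \<open>a\<close>:
  together with the path from \<open>s\<close> to \<open>a\<close> that would bypass the cut-vertex
  \<open>b\<close>.\<close>

lemma before_to_t:
  assumes "a \<in> C" "b \<in> C" "before a b" shows "avoids G {a} b t"
proof -
  have "a \<noteq> b" using assms before_irrefl by blast
  then have "avoids G {b} a t \<or> avoids G {a} b t" using last_hit_t assms by blast
  moreover have "\<not> avoids G {b} a t"
    using avoids_trans[of G "{b}" s a t] assms(3) cut[OF assms(2)] unfolding before_def by blast
  ultimately show ?thesis by blast
qed

lemma before_asym:
  assumes "a \<in> C" "b \<in> C" "before a b" shows "\<not> before b a"
  using before_to_t[OF assms] cut[OF assms(1)] avoids_trans[of G "{a}" s b t]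
  unfolding before_def by blast

text \<open>A path from \<open>s\<close> to \<open>a\<close> that avoids \<open>b\<close> cannot
  pass \<open>c\<close>, since its part up to \<open>c\<close> would put \<open>c\<close> before
  \<open>b\<close>.\<close>

lemma before_trans:
  assumes "a \<in> C" "b \<in> C" "c \<in> C" "before a b" "before b c" shows "before a c"
proof -
  have "avoids G {b} s a" using assms by (simp add: before_def)
  from avoids_hit[OF this, of c] show ?thesis
    using before_asym[OF assms(2,3,5)] by (auto simp: before_def intro: avoids_antimono)
qed

text \<open>If \<open>x\<close> comes after \<open>b\<close>, a path from \<open>s\<close> to
  \<open>b\<close> that avoids \<open>x\<close> has to pass \<open>a\<close>, and its rest is the
  wanted path. If \<open>x\<close> comes before \<open>a\<close>, a path from \<open>a\<close> to
  \<open>t\<close> that avoids \<open>x\<close> has to pass \<open>b\<close>.\<close>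

lemma avoids_forward:
  assumes C: "a \<in> C" "b \<in> C" "x \<in> C" and "before a b" "x \<noteq> a" "x \<noteq> b" "\<not> (before a x \<and> before x b)"
  shows "avoids G {x} a b"
proof (cases "before b x")
  case True
  then have "avoids G {x} s b" by (simp add: before_def)
  from avoids_hit[OF this, of a] show ?thesis
    using before_asym[OF C(1,2) assms(4)] by (auto simp: before_def intro: avoids_antimono)
next
  case False
  then have xb: "before x b" using before_total C assms by blast
  then have xa: "before x a" using before_total C assms by blast
  have "avoids G {x} a t" using before_to_t[OF C(3,1) xa] .
  from avoids_hit[OF this, of b] show ?thesis
  proof
    assume "avoids G {b, x} a t"
    then have "avoids G {b} a t" by (rule avoids_antimono) auto
    then have "avoids G {b} s t" using assms(4) avoids_trans[of G "{b}" s a t]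
      unfolding before_def by blast
    then show ?thesis using cut[OF C(2)] by blast
  qed blast
qed

lemma avoids_blocked:
  assumes C: "a \<in> C" "b \<in> C" "x \<in> C" and "before a x" "before x b"
  shows "\<not> avoids G {x} a b"
  using before_to_t[OF C(3,2) assms(5)] assms(4) cut[OF C(3)]
    avoids_trans[of G "{x}" s a b] avoids_trans[of G "{x}" s b t]
  unfolding before_def by blast

text \<open>Counting predecessors gives ranks that a bounded sum can compute.\<close>

definition pos :: "'a \<Rightarrow> nat" where
  "pos c = card {a \<in> C. before a c}"

lemma pos_less:
  assumes "a \<in> C" "b \<in> C" "before a b" shows "pos a < pos b"
  unfolding pos_def
proof (rule psubset_card_mono)
  show "{c \<in> C. before c a} \<subset> {c \<in> C. before c b}"
    using assms before_trans[OF _ assms(1,2) _ assms(3)] before_irrefl by blast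
qed (use finC in auto)

lemma pos_less_iff: "a \<in> C \<Longrightarrow> b \<in> C \<Longrightarrow> pos a < pos b \<longleftrightarrow> before a b"
  using pos_less before_total by (metis less_irrefl less_asym)

lemma pos_bij: "bij_betw pos C {..<card C}"
proof -
  have inj: "inj_on pos C"
    by (rule inj_onI) (metis before_total less_irrefl pos_less)
  have "pos ` C \<subseteq> {..<card C}"
  proof
    fix i assume "i \<in> pos ` C"
    then obtain c where c: "c \<in> C" "i = pos c" by blast
    have "{a \<in> C. before a c} \<subset> C" using c before_irrefl by blast
    then show "i \<in> {..<card C}" using c finC by (auto simp: pos_def psubset_card_mono)
  qed
  then have "pos ` C = {..<card C}" using inj finC
    by (metis card_image card_lessThan card_subset_eq finite_lessThan)
  with inj show ?thesis by (simp add: bij_betw_def)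
qed

end


text \<open>\<open>\<rho> x i j\<close> states that there is a path from \<open>i\<close> to \<open>j\<close> avoiding \<open>x\<close>; the vertices are
  the positions of the cut-vertices.\<close>

locale chain =
  fixes k :: nat and \<rho> :: "nat \<Rightarrow> nat \<Rightarrow> nat \<Rightarrow> bool"
  assumes refl: "i < k \<Longrightarrow> x < k \<Longrightarrow> x \<noteq> i \<Longrightarrow> \<rho> x i i"
    and ends: "x < k \<Longrightarrow> \<rho> x i j \<Longrightarrow> x \<noteq> i \<and> x \<noteq> j"
    and trans: "\<rho> x i j \<Longrightarrow> \<rho> x j l \<Longrightarrow> \<rho> x i l"
    and hit: "x < k \<Longrightarrow> y < k \<Longrightarrow> \<rho> x i j \<Longrightarrow> \<rho> y i j \<or> \<rho> x i y \<and> \<rho> x y j"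
    and forward: "i < k \<Longrightarrow> j < k \<Longrightarrow> x < k \<Longrightarrow> i \<le> j \<Longrightarrow> x < i \<or> j < x \<Longrightarrow> \<rho> x i j"
    and blocked: "i < k \<Longrightarrow> j < k \<Longrightarrow> x < k \<Longrightarrow> i < x \<Longrightarrow> x < j \<Longrightarrow> \<not> \<rho> x i j"

text \<open>The least \<open>i\<close> with \<open>P i\<close>, capped at \<open>b\<close>, and
  \<open>b\<close> if there is none. It is written as a count because bounded sums are what the
  expressions offer.\<close>

definition least_upto :: "nat \<Rightarrow> (nat \<Rightarrow> bool) \<Rightarrow> nat" where
  "least_upto b P = card {i. i < b \<and> (\<forall>j\<le>i. \<not> P j)}"

lemma least_upto_le: "least_upto b P \<le> b"
proof -
  have "card {i. i < b \<and> (\<forall>j\<le>i. \<not> P j)} \<le> card {..<b}" by (rule card_mono) auto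
  then show ?thesis by (simp add: least_upto_def)
qed

lemma least_upto_eq:
  assumes "P i" "i \<le> b" shows "least_upto b P = (LEAST i. P i)"
proof -
  have "(m < b \<and> (\<forall>j\<le>m. \<not> P j)) \<longleftrightarrow> m < (LEAST i. P i)" for m
  proof
    show "m < b \<and> (\<forall>j\<le>m. \<not> P j) \<Longrightarrow> m < (LEAST i. P i)"
      using LeastI[of P i] assms(1) by (meson not_le)
    assume m: "m < (LEAST i. P i)"
    then have "m < b" using Least_le[of P i] assms by linarith
    moreover have "\<not> P j" if "j \<le> m" for j using that m not_less_Least[of j P] by linarith
    ultimately show "m < b \<and> (\<forall>j\<le>m. \<not> P j)" by blast
  qed
  then have "{i. i < b \<and> (\<forall>j\<le>i. \<not> P j)} = {..<(LEAST i. P i)}" by auto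
  then show ?thesis by (simp add: least_upto_def)
qed

lemma least_upto_holds: "P i \<Longrightarrow> i \<le> b \<Longrightarrow> P (least_upto b P)"
  by (metis LeastI least_upto_eq)

lemma least_upto_minimal: "P i \<Longrightarrow> i \<le> b \<Longrightarrow> least_upto b P \<le> i"
  by (metis Least_le least_upto_eq)

text \<open>The rightmost minimum on \<open>{lo..<hi}\<close>. Strictness to the right yields the
  contradiction in \<open>reach_back_iff\<close>.\<close>

definition is_rmin :: "(nat \<Rightarrow> nat) \<Rightarrow> nat \<Rightarrow> nat \<Rightarrow> nat \<Rightarrow> bool" where
  "is_rmin d lo hi i \<longleftrightarrow> lo \<le> i \<and> i < hi \<and> (\<forall>j\<in>{lo..<i}. d i \<le> d j) \<and> (\<forall>j\<in>{i<..<hi}. d i < d j)"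

section \<open>Reachability against the order as comparisons with thresholds\<close>

context chain
begin

definition low :: "nat \<Rightarrow> nat" where
  "low a = least_upto a (\<rho> (Suc a) a)"

lemma low_reached:
  assumes "Suc a < k" shows "\<rho> (Suc a) a (low a)" "low a \<le> a"
proof -
  have "\<rho> (Suc a) a a" using refl assms by simp
  then show "\<rho> (Suc a) a (low a)" unfolding low_def by (rule least_upto_holds) simp
  show "low a \<le> a" unfolding low_def by (rule least_upto_le)
qed

lemma low_le: "\<rho> (Suc a) a z \<Longrightarrow> z \<le> a \<Longrightarrow> low a \<le> z"
  unfolding low_def by (rule least_upto_minimal)

text \<open>From \<open>low a\<close> every later position up to \<open>a\<close> is reached going
  forward without \<open>a + 1\<close>, so the positions reached from \<open>a\<close> are upward
  closed below \<open>a\<close>.\<close>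

lemma low_le_iff:
  assumes "z \<le> a" "Suc a < k" shows "low a \<le> z \<longleftrightarrow> \<rho> (Suc a) a z"
proof
  assume le: "low a \<le> z"
  have "\<rho> (Suc a) (low a) z" using assms le by (intro forward) auto
  with low_reached(1)[OF assms(2)] show "\<rho> (Suc a) a z" by (rule trans)
qed (use assms low_le in auto)

text \<open>Going from \<open>a\<close> to \<open>x\<close> requires passing \<open>i\<close>, by
  \<open>blocked\<close>; a path that avoids \<open>i\<close> therefore cannot meet
  \<open>x\<close>.\<close>

lemma avoid_later:
  assumes "\<rho> i a z" "a < i" "i \<le> x" "x < k" shows "\<rho> x a z"
proof (cases "i = x")
  case False
  then have "\<not> \<rho> i a x" using assms by (intro blocked) auto
  then show ?thesis using hit[of i x a z] assms by auto
qed (use assms in simp)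

text \<open>A position up to \<open>i\<close> reaches \<open>i\<close> going forward, and
  \<open>low i \<le> low z \<le> z\<close> takes \<open>i\<close> on to \<open>z\<close>. If some
  position after \<open>i\<close> reached \<open>z\<close>, the last such position \<open>a'\<close>
  would satisfy \<open>low a' \<le> low i\<close>, impossible to the right of the rightmost
  minimum.\<close>

lemma reach_back_iff:
  assumes i: "is_rmin low z x i" and a: "z \<le> a" "a < x" and x: "x < k"
  shows "\<rho> x a z \<longleftrightarrow> a \<le> i"
proof -
  have iz: "z \<le> i" "i < x" "low i \<le> low z"
    using i by (auto simp: is_rmin_def le_less)
  have zx: "z < x" using a by simp
  then have "low i \<le> z" using iz low_reached(2)[of z] x by simp
  then have "\<rho> (Suc i) i z" using iz x by (subst low_le_iff[symmetric]) auto
  then have rx: "\<rho> x i z" by (rule avoid_later) (use iz x in auto)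
  show ?thesis
  proof
    assume "a \<le> i"
    have "\<rho> x a i" using \<open>a \<le> i\<close> iz x a by (intro forward) auto
    then show "\<rho> x a z" using rx by (rule trans)
  next
    assume az: "\<rho> x a z"
    show "a \<le> i"
    proof (rule ccontr)
      assume "\<not> a \<le> i"
      \<comment> \<open>Being the last position that reaches \<open>z\<close>, \<open>a'\<close>
        cannot get there through \<open>a' + 1\<close>; it reaches \<open>z\<close> with
        \<open>a' + 1\<close> deleted, which is what \<open>low a'\<close> measures.\<close>
      define a' where "a' = Max {a. a < x \<and> \<rho> x a z}"
      have fin: "finite {a. a < x \<and> \<rho> x a z}" by simp
      have a': "a' < x" "\<rho> x a' z" and aa': "a \<le> a'"
        using Max_in[OF fin] Max_ge[OF fin, of a] az a(2) unfolding a'_def by blast+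
      have "\<rho> (Suc a') a' z"
      proof (cases "Suc a' = x")
        case False
        then have "\<not> \<rho> x (Suc a') z" using Max_ge[OF fin, of "Suc a'"] a' unfolding a'_def[symmetric] by auto
        then show ?thesis using hit[of x "Suc a'" a' z] a' x by auto
      qed (use a' in simp)
      then have l: "low a' \<le> z" using aa' a by (intro low_le) auto
      have ia': "i < a'" using aa' \<open>\<not> a \<le> i\<close> by simp
      have S: "Suc a' < k" using a' x by simp
      have lt: "low i < low a'" using i ia' a' by (auto simp: is_rmin_def)
      have "\<rho> (Suc a') a' (low a')" using low_reached(1)[OF S] .
      moreover have "\<rho> (Suc a') (low a') i" using l iz ia' S by (intro forward) auto
      moreover have "\<rho> (Suc a') i (low i)"
        by (rule avoid_later[OF low_reached(1)]) (use ia' S in auto)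
      ultimately have "\<rho> (Suc a') a' (low i)" using trans by blast
      moreover have "low i \<le> a'" using lt l aa' a by simp
      ultimately have "low a' \<le> low i" by (rule low_le)
      then show False using lt by simp
    qed
  qed
qed

text \<open>The two extremality clauses hold for the thresholds of an actual query, and they make a
  jump over one vertex usable while another one is deleted.\<close>

definition jump :: "nat \<Rightarrow> nat \<Rightarrow> nat \<Rightarrow> bool" where
  "jump a x d \<longleftrightarrow> d < x \<and> x < a \<and> \<rho> x a d \<and> (\<forall>a'\<in>{x<..<a}. \<not> \<rho> x a a') \<and> (\<forall>d'\<in>{d<..<x}. \<not> \<rho> x d' d)"

text \<open>Minimizing over the jumped vertex leaves one table entry per position. A jump ends below
  \<open>a\<close>, so the value \<open>a\<close> stands for no jump.\<close>

definition landing :: "nat \<Rightarrow> nat" where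
  "landing a = least_upto a (\<lambda>d. \<exists>x<a. jump a x d)"

lemma landing_le: "jump a x d \<Longrightarrow> landing a \<le> d"
  unfolding landing_def by (rule least_upto_minimal) (auto simp: jump_def)

lemma landing_jump:
  assumes "landing a < a" obtains x where "jump a x (landing a)"
proof -
  have "\<exists>d\<le>a. \<exists>x<a. jump a x d"
  proof (rule ccontr)
    assume "\<not> (\<exists>d\<le>a. \<exists>x<a. jump a x d)"
    then have "{i. i < a \<and> (\<forall>j\<le>i. \<not> (\<exists>x<a. jump a x j))} = {..<a}" by auto
    then have "landing a = a" by (simp add: landing_def least_upto_def)
    with assms show False by simp
  qed
  then obtain d where "d \<le> a" "\<exists>x<a. jump a x d" by blast
  then have "\<exists>x<a. jump a x (landing a)" unfolding landing_def by (intro least_upto_holds) auto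
  with that show thesis by blast
qed

text \<open>From left to right, the thresholds \<open>a\<close> and \<open>d\<close> themselves form
  a jump over \<open>x\<close>. From right to left, the best jump from \<open>a\<close> may cross
  another vertex \<open>x'\<close>, but it cannot meet \<open>x\<close>: on either side of
  \<open>x'\<close> this would violate one of the extremality clauses.\<close>

lemma reach_across_iff:
  assumes z: "z \<le> d" "d < x" and y: "x < a" "a \<le> y" "y < k"
    and d: "\<And>b. z \<le> b \<Longrightarrow> b < x \<Longrightarrow> \<rho> x b z \<longleftrightarrow> b \<le> d"
    and a: "\<And>b. x < b \<Longrightarrow> b \<le> y \<Longrightarrow> \<rho> x y b \<longleftrightarrow> a \<le> b"
  shows "\<rho> x y z \<longleftrightarrow> landing a \<le> d"
proof
  assume yz: "\<rho> x y z"
  have "\<rho> x a y" using y by (intro forward) auto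
  moreover have "\<rho> x z d" using z y by (intro forward) auto
  ultimately have ad: "\<rho> x a d" using yz trans by blast
  have ya: "\<rho> x y a" and dz: "\<rho> x d z" using a[of a] d[of d] z y by auto
  have "\<not> \<rho> x a b" if "x < b" "b < a" for b
    using that a[of b] y trans[OF ya] by auto
  moreover have "\<not> \<rho> x b d" if "d < b" "b < x" for b
    using that d[of b] z trans[OF _ dz] by auto
  ultimately have "jump a x d" using ad z y by (auto simp: jump_def)
  then show "landing a \<le> d" by (rule landing_le)
next
  assume le: "landing a \<le> d"
  have lt: "landing a < a" using le z y by simp
  then obtain x' where j: "jump a x' (landing a)" by (rule landing_jump)
  have ya: "\<rho> x y a" and dz: "\<rho> x d z" using a[of a] d[of d] z y by auto
  have x': "landing a < x'" "x' < a" "\<rho> x' a (landing a)" using j by (auto simp: jump_def)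
  have k: "x < k" "x' < k" using z y x' by auto
  have "\<rho> x a (landing a)"
  proof -
    have "\<not> (\<rho> x' a x \<and> \<rho> x' x (landing a))"
    proof (cases rule: linorder_cases[of x x'])
      case less
      then show ?thesis using j le z by (auto simp: jump_def)
    next
      case equal
      then show ?thesis using ends[of x' a x] k by auto
    next
      case greater
      then show ?thesis using j y by (auto simp: jump_def)
    qed
    then show ?thesis using hit[of x' x a "landing a"] x' k by blast
  qed
  moreover have "\<rho> x (landing a) d" using le z y by (intro forward) auto
  ultimately show "\<rho> x y z" using ya dz trans by blast
qed

end

text \<open>Reversing all arcs and the order of the positions preserves the axioms.\<close>

lemma chain_reverse:
  assumes "chain k \<rho>" shows "chain k (\<lambda>x i j. x < k \<and> i < k \<and> j < k \<and> \<rho> (k - Suc x) (k - Suc j) (k - Suc i))"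
proof -
  interpret chain k \<rho> by (rule assms)
  show ?thesis
  proof
    fix x y i j l
    let ?\<rho> = "\<lambda>x i j. x < k \<and> i < k \<and> j < k \<and> \<rho> (k - Suc x) (k - Suc j) (k - Suc i)"
    show "i < k \<Longrightarrow> x < k \<Longrightarrow> x \<noteq> i \<Longrightarrow> ?\<rho> x i i" by (auto intro!: refl)
    show "x < k \<Longrightarrow> ?\<rho> x i j \<Longrightarrow> x \<noteq> i \<and> x \<noteq> j"
      using ends[of "k - Suc x" "k - Suc j" "k - Suc i"] by auto
    show "?\<rho> x i j \<Longrightarrow> ?\<rho> x j l \<Longrightarrow> ?\<rho> x i l" by (blast intro: trans)
    show "x < k \<Longrightarrow> y < k \<Longrightarrow> ?\<rho> x i j \<Longrightarrow> ?\<rho> y i j \<or> ?\<rho> x i y \<and> ?\<rho> x y j"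
      using hit[of "k - Suc x" "k - Suc y" "k - Suc j" "k - Suc i"] by auto
    show "i < k \<Longrightarrow> j < k \<Longrightarrow> x < k \<Longrightarrow> i \<le> j \<Longrightarrow> x < i \<or> j < x \<Longrightarrow> ?\<rho> x i j"
      by (intro conjI forward; arith)
    show "i < k \<Longrightarrow> j < k \<Longrightarrow> x < k \<Longrightarrow> i < x \<Longrightarrow> x < j \<Longrightarrow> \<not> ?\<rho> x i j"
      using blocked[of "k - Suc j" "k - Suc i" "k - Suc x"] by auto
  qed
qed

section \<open>Range minima in linear space\<close>

lemma is_rmin_exists: "lo < hi \<Longrightarrow> \<exists>i. is_rmin d lo hi i"
proof (induction hi)
  case (Suc hi)
  show ?case
  proof (cases "lo = hi")
    case True
    then show ?thesis by (intro exI[of _ hi]) (auto simp: is_rmin_def)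
  next
    case False
    then obtain i where i: "is_rmin d lo hi i" using Suc by auto
    show ?thesis
    proof (cases "d i < d hi")
      case True
      then show ?thesis using i by (intro exI[of _ i]) (auto simp: is_rmin_def less_Suc_eq)
    next
      case False
      have "d hi \<le> d j" if "j \<in> {lo..<hi}" for j
      proof (cases rule: linorder_cases[of i j])
        case less
        then have "d i < d j" using i that by (auto simp: is_rmin_def)
        then show ?thesis using \<open>\<not> d i < d hi\<close> by simp
      next
        case equal
        then show ?thesis using False by simp
      next
        case greater
        then have "d i \<le> d j" using i that by (auto simp: is_rmin_def)
        then show ?thesis using \<open>\<not> d i < d hi\<close> by simp
      qed
      then show ?thesis using Suc.prems by (intro exI[of _ hi]) (auto simp: is_rmin_def)
    qed
  qed
qed simp

lemma is_rmin_unique: "is_rmin d lo hi i \<Longrightarrow> is_rmin d lo hi j \<Longrightarrow> i = j"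
proof (cases rule: linorder_cases[of i j])
  case less
  assume "is_rmin d lo hi i" "is_rmin d lo hi j"
  with less have "d i < d j" "d j \<le> d i" by (auto simp: is_rmin_def)
  then show ?thesis by simp
next
  case greater
  assume "is_rmin d lo hi i" "is_rmin d lo hi j"
  with greater have "d j < d i" "d i \<le> d j" by (auto simp: is_rmin_def)
  then show ?thesis by simp
qed

text \<open>A sum with at most one nonzero term, the form in which \<open>sparse_exp\<close>
  computes it.\<close>

definition rmin :: "(nat \<Rightarrow> nat) \<Rightarrow> nat \<Rightarrow> nat \<Rightarrow> nat" where
  "rmin d lo hi = (\<Sum>i<hi. if is_rmin d lo hi i then i else 0)"

lemma rmin_eq: "is_rmin d lo hi i \<Longrightarrow> rmin d lo hi = i"
proof -
  assume i: "is_rmin d lo hi i"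
  then have "(if is_rmin d lo hi j then j else 0) = (if j = i then i else 0)" for j
    using is_rmin_unique by auto
  then have "rmin d lo hi = (\<Sum>j<hi. if j = i then i else 0)" unfolding rmin_def by simp
  then show ?thesis using i by (simp add: is_rmin_def)
qed

lemma is_rmin_rmin: "lo < hi \<Longrightarrow> is_rmin d lo hi (rmin d lo hi)"
  using is_rmin_exists rmin_eq by metis

lemma rmin_le: "rmin d lo hi \<le> hi"
proof (cases "\<exists>i. is_rmin d lo hi i")
  case True
  then show ?thesis using rmin_eq by (metis is_rmin_def less_imp_le)
qed (simp add: rmin_def)

text \<open>The ranges may overlap, as those from the sparse table do. Ties go to the candidate of
  the right range, which keeps the result rightmost.\<close>

lemma is_rmin_combine:
  assumes "is_rmin d lo1 hi1 i" "is_rmin d lo2 hi2 j" "lo1 \<le> lo2" "lo2 \<le> hi1" "hi1 \<le> hi2"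
  shows "is_rmin d lo1 hi2 (if d i < d j then i else j)"
proof -
  have i: "lo1 \<le> i" "i < hi1" "\<And>l. lo1 \<le> l \<Longrightarrow> l < i \<Longrightarrow> d i \<le> d l" "\<And>l. i < l \<Longrightarrow> l < hi1 \<Longrightarrow> d i < d l"
    and j: "lo2 \<le> j" "j < hi2" "\<And>l. lo2 \<le> l \<Longrightarrow> l < j \<Longrightarrow> d j \<le> d l" "\<And>l. j < l \<Longrightarrow> l < hi2 \<Longrightarrow> d j < d l"
    using assms by (auto simp: is_rmin_def)
  have il: "d i \<le> d l" if "lo1 \<le> l" "l < hi1" for l
    using i(3)[of l] i(4)[of l] that by (cases rule: linorder_cases[of l i]) auto
  have jl: "d j \<le> d l" if "lo2 \<le> l" "l < hi2" for l
    using j(3)[of l] j(4)[of l] that by (cases rule: linorder_cases[of l j]) auto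
  show ?thesis
  proof (cases "d i < d j")
    case True
    have "d i < d l" if "i < l" "l < hi2" for l
    proof (cases "l < hi1")
      case False
      then have "d j \<le> d l" using that assms(4) by (intro jl) auto
      then show ?thesis using True by simp
    qed (use that i in simp)
    then show ?thesis using True i assms(5) by (auto simp: is_rmin_def)
  next
    case False
    have "d j \<le> d l" if "lo1 \<le> l" "l < j" for l
    proof (cases "lo2 \<le> l")
      case False
      then have "d i \<le> d l" using that assms(4) by (intro il) auto
      then show ?thesis using \<open>\<not> d i < d j\<close> by simp
    qed (use that j in simp)
    then show ?thesis using False j assms(3) by (auto simp: is_rmin_def)
  qed
qed

section \<open>Block masks and the sparse table\<close>

definition bits :: "nat \<Rightarrow> nat" where
  "bits k = card {i. i < k \<and> 0 < drop_bit i k}"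

text \<open>\<open>bits k\<close> is the bit length of \<open>k\<close>: the shifts by
  \<open>i\<close> are positive exactly below the least \<open>l\<close> with
  \<open>k < 2 ^ l\<close>, and \<open>l \<le> k\<close> makes counting over \<open>i < k\<close>
  enough.\<close>

lemma less_bits_iff: "i < bits k \<longleftrightarrow> 2 ^ i \<le> k"
proof (cases "k = 0")
  case True
  then show ?thesis by (simp add: bits_def)
next
  case False
  define l where "l = (LEAST l. k < 2 ^ l)"
  have l: "k < 2 ^ l" unfolding l_def by (rule LeastI[of _ k]) (rule less_exp)
  have iff: "2 ^ i \<le> k \<longleftrightarrow> i < l" for i
  proof
    assume "2 ^ i \<le> k"
    then have "(2::nat) ^ i < 2 ^ l" using l by linarith
    then show "i < l" by simp
  next
    assume "i < l"
    then show "2 ^ i \<le> k" unfolding l_def using not_less_Least[of i "\<lambda>l. k < 2 ^ l"] by simp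
  qed
  have "l \<le> k" unfolding l_def by (rule Least_le) (rule less_exp)
  have "i < k \<and> 0 < drop_bit i k \<longleftrightarrow> i < l" for i
  proof -
    have "0 < drop_bit i k \<longleftrightarrow> i < l"
      by (simp only: drop_bit_eq_div div_greater_zero_iff iff) simp
    then show ?thesis using \<open>l \<le> k\<close> by linarith
  qed
  then have "{i. i < k \<and> 0 < drop_bit i k} = {..<l}" by blast
  then show ?thesis using iff by (simp add: bits_def)
qed

lemma less_power_bits: "k < 2 ^ bits k"
  using less_bits_iff[of "bits k" k] by simp

lemma bits_le: "bits k \<le> k"
proof (cases "bits k")
  case (Suc n)
  then have "2 ^ n \<le> k" by (simp add: less_bits_iff[symmetric])
  with less_exp[of n] show ?thesis using Suc by linarith
qed simp

lemma bits_pos: "0 < k \<Longrightarrow> 0 < bits k"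
  using less_bits_iff[of 0 k] by simp

text \<open>With blocks of length \<open>bits k\<close>, masks are small enough to index a table of
  linear size.\<close>

lemma power_bits_le: "2 ^ bits k \<le> 2 * k + 1"
  using less_bits_iff[of "bits k - 1" k] by (cases "bits k") auto

definition lowest_bit :: "nat \<Rightarrow> nat \<Rightarrow> nat" where
  "lowest_bit b v = least_upto b (\<lambda>i. odd (drop_bit i v))"

text \<open>The floor of the binary logarithm for \<open>0 < v < 2 ^ b\<close>. It is tabulated
  because the machine has no instruction for it.\<close>

definition level :: "nat \<Rightarrow> nat \<Rightarrow> nat" where
  "level b v = card {i. i < b \<and> 0 < drop_bit (Suc i) v}"

lemma level:
  assumes "0 < v" "v < 2 ^ b"
  shows "2 ^ level b v \<le> v" "v < 2 ^ Suc (level b v)" "level b v < b"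
proof -
  have iff: "0 < drop_bit i v \<longleftrightarrow> i < bits v" for i
    by (simp add: drop_bit_eq_div div_greater_zero_iff less_bits_iff)
  have p: "0 < bits v" using bits_pos assms by simp
  have "bits v \<le> b"
  proof (rule ccontr)
    assume "\<not> bits v \<le> b"
    then have "2 ^ b \<le> v" by (simp add: less_bits_iff[symmetric])
    then show False using assms by simp
  qed
  then have "{i. i < b \<and> 0 < drop_bit (Suc i) v} = {..<bits v - 1}" unfolding iff using p by auto
  then have lv: "level b v = bits v - 1" by (simp add: level_def)
  then show "2 ^ level b v \<le> v" using p by (simp add: less_bits_iff[symmetric])
  show "v < 2 ^ Suc (level b v)" using lv p less_power_bits by simp
  show "level b v < b" using lv p \<open>bits v \<le> b\<close> by simp
qed

text \<open>Bit \<open>o\<close> of the mask of \<open>j\<close> tells whether position \<open>o\<close> of the block of \<open>j\<close> is the rightmost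
  minimum of the stretch from there to \<open>j\<close>.\<close>

definition mask_at :: "nat \<Rightarrow> (nat \<Rightarrow> nat) \<Rightarrow> nat \<Rightarrow> nat \<Rightarrow> bool" where
  "mask_at b d j o' \<longleftrightarrow> j div b * b + o' \<le> j \<and> (\<forall>u<j - (j div b * b + o'). d (j div b * b + o') < d (j div b * b + o' + 1 + u))"

definition block_mask :: "nat \<Rightarrow> (nat \<Rightarrow> nat) \<Rightarrow> nat \<Rightarrow> nat" where
  "block_mask b d j = (\<Sum>o'<b. if mask_at b d j o' then 2 ^ o' else 0)"

lemma bit_block_mask: "bit (block_mask b d j) i \<longleftrightarrow> i < b \<and> mask_at b d j i"
proof -
  have "block_mask b d j = horner_sum of_bool 2 (map (mask_at b d j) [0..<b])"
    unfolding horner_sum_eq_sum block_mask_def by (rule sum.cong) (simp_all add: of_bool_def atLeast0LessThan)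
  then show ?thesis by (auto simp: bit_horner_sum_bit_iff)
qed

lemma block_mask_less: "block_mask b d j < 2 ^ b"
proof -
  have "block_mask b d j = horner_sum of_bool 2 (map (mask_at b d j) [0..<b])"
    unfolding horner_sum_eq_sum block_mask_def by (rule sum.cong) (simp_all add: of_bool_def atLeast0LessThan)
  then show ?thesis using horner_sum_of_bool_2_less[of "map (mask_at b d j) [0..<b]"] by simp
qed

lemma mask_at_iff:
  assumes "i div b = j div b" "0 < b"
  shows "mask_at b d j (i mod b) \<longleftrightarrow> i \<le> j \<and> (\<forall>l\<in>{i<..j}. d i < d l)"
proof -
  have i: "j div b * b + i mod b = i" using assms by (metis div_mult_mod_eq)
  have "(\<forall>u<j - i. d i < d (i + 1 + u)) \<longleftrightarrow> (\<forall>l\<in>{i<..j}. d i < d l)" if "i \<le> j"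
  proof (intro iffI ballI allI impI)
    fix l assume a: "\<forall>u<j - i. d i < d (i + 1 + u)" and l: "l \<in> {i<..j}"
    have "d i < d (i + 1 + (l - i - 1))" by (rule a[rule_format]) (use l in auto)
    then show "d i < d l" using l by simp
  qed (use that in auto)
  then show ?thesis unfolding mask_at_def i by blast
qed

text \<open>A set bit marks a position below everything after it up to \<open>j\<close>; the first
  marked position from \<open>z\<close> on is the rightmost minimum. Shifting by
  \<open>z mod b\<close> drops the bits of the positions before \<open>z\<close>.\<close>

lemma in_block:
  assumes b: "0 < b" and z: "z \<le> j" "z div b = j div b"
  shows "is_rmin d z (Suc j) (z + lowest_bit b (drop_bit (z mod b) (block_mask b d j)))"
proof -
  let ?P = "\<lambda>i. odd (drop_bit i (drop_bit (z mod b) (block_mask b d j)))"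
  have P: "?P i \<longleftrightarrow> z mod b + i < b \<and> z + i \<le> j \<and> (\<forall>l\<in>{z + i<..j}. d (z + i) < d l)" for i
  proof -
    have "?P i \<longleftrightarrow> bit (block_mask b d j) (i + z mod b)"
      by (simp add: bit_iff_odd_drop_bit[symmetric] bit_drop_bit_eq add.commute)
    also have "\<dots> \<longleftrightarrow> z mod b + i < b \<and> mask_at b d j (z mod b + i)"
      by (simp add: bit_block_mask add.commute)
    also have "\<dots> \<longleftrightarrow> z mod b + i < b \<and> z + i \<le> j \<and> (\<forall>l\<in>{z + i<..j}. d (z + i) < d l)"
    proof (cases "z mod b + i < b")
      case True
      have "z + i = z div b * b + (z mod b + i)" by simp
      then have "(z + i) div b = z div b" "(z + i) mod b = z mod b + i"
        using True b by (metis add.right_neutral div_mult_self3 div_less neq0_conv mult.commute div_mult_self4,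
          metis mod_mult_self3 mod_less)
      then show ?thesis using mask_at_iff[of "z + i" b j d] z(2) b by simp
    qed simp
    finally show ?thesis .
  qed
  obtain m where m: "is_rmin d z (Suc j) m" using is_rmin_exists[of z "Suc j"] z by auto
  have zm: "z \<le> m" "m \<le> j" using m by (auto simp: is_rmin_def)
  have same: "z mod b + (m - z) < b"
  proof -
    have "j = z div b * b + j mod b" "z = z div b * b + z mod b"
      by (metis z(2) div_mult_mod_eq, metis div_mult_mod_eq)
    moreover have "j mod b < b" using b by simp
    ultimately show ?thesis using zm by linarith
  qed
  have "lowest_bit b (drop_bit (z mod b) (block_mask b d j)) = m - z"
    unfolding lowest_bit_def
  proof (subst least_upto_eq[where i = "m - z"])
    have Pm: "?P (m - z)" unfolding P using same zm m by (auto simp: is_rmin_def)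
    then show "?P (m - z)" .
    show "m - z \<le> b" using same by simp
    show "(LEAST i. ?P i) = m - z"
    proof (rule Least_equality)
      show "?P (m - z)" by (rule Pm)
      fix i assume "?P i"
      then have i: "z + i \<le> j" "\<forall>l\<in>{z + i<..j}. d (z + i) < d l" unfolding P by auto
      show "m - z \<le> i"
      proof (rule ccontr)
        assume "\<not> m - z \<le> i"
        then have "d m \<le> d (z + i)" "d (z + i) < d m" using i m zm by (auto simp: is_rmin_def)
        then show False by simp
      qed
    qed
  qed
  then show ?thesis using m zm by simp
qed

text \<open>Entry \<open>q * b + e\<close> with \<open>e < b\<close> answers the query for the \<open>2 ^ e\<close> blocks from block \<open>q\<close> on.\<close>

definition sparse :: "nat \<Rightarrow> nat \<Rightarrow> (nat \<Rightarrow> nat) \<Rightarrow> nat \<Rightarrow> nat" where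
  "sparse k b d p = rmin d (p div b * b) (min k (p div b * b + 2 ^ (p mod b) * b))"

lemma sparse:
  assumes "e < b" "(q + 2 ^ e) * b \<le> k"
  shows "is_rmin d (q * b) ((q + 2 ^ e) * b) (sparse k b d (q * b + e))"
proof -
  have "(q * b + e) div b = q" "(q * b + e) mod b = e" using assms by auto
  moreover have "min k (q * b + 2 ^ e * b) = (q + 2 ^ e) * b" using assms by (simp add: algebra_simps)
  moreover have "q * b < (q + 2 ^ e) * b" using assms by simp
  ultimately show ?thesis using is_rmin_rmin by (simp add: sparse_def)
qed

text \<open>The strict test sends ties to the second, right-hand candidate, as
  \<open>is_rmin_combine\<close> demands.\<close>

definition pick :: "(nat \<Rightarrow> nat) \<Rightarrow> nat \<Rightarrow> nat \<Rightarrow> nat" where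
  "pick d i j = (if d i < d j then i else j)"

text \<open>Called by \<open>rmq\<close> only if the block of \<open>z\<close> precedes that of
  \<open>j\<close>; then the last position of this block is below \<open>k\<close> and has a table
  entry.\<close>

definition block_suffix :: "nat \<Rightarrow> (nat \<Rightarrow> nat) \<Rightarrow> nat \<Rightarrow> nat" where
  "block_suffix b d z = z + lowest_bit b (drop_bit (z mod b) (block_mask b d (z div b * b + (b - 1))))"

lemma block_suffix:
  assumes "0 < b" shows "is_rmin d z ((z div b + 1) * b) (block_suffix b d z)"
proof -
  have "z = z div b * b + z mod b" by simp
  moreover have "z mod b < b" using assms by simp
  ultimately have "z \<le> z div b * b + (b - 1)" by linarith
  moreover have "(z div b * b + (b - 1)) div b = z div b"
    by (rule div_nat_eqI) (use assms in \<open>auto simp: algebra_simps\<close>)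
  moreover have "Suc (z div b * b + (b - 1)) = (z div b + 1) * b" using assms by (cases b) auto
  ultimately show ?thesis using in_block[OF assms, of z "z div b * b + (b - 1)" d]
    by (simp only: block_suffix_def)
qed

definition block_prefix :: "nat \<Rightarrow> (nat \<Rightarrow> nat) \<Rightarrow> nat \<Rightarrow> nat" where
  "block_prefix b d j = j div b * b + lowest_bit b (block_mask b d j)"

lemma block_prefix:
  assumes "0 < b" shows "is_rmin d (j div b * b) (Suc j) (block_prefix b d j)"
proof -
  have "j div b * b \<le> j" "j div b * b div b = j div b" "j div b * b mod b = 0" using assms by auto
  then show ?thesis using in_block[OF assms, of "j div b * b" j d] by (simp only: block_prefix_def drop_bit_0)
    (simp add: drop_bit_0)
qed

text \<open>Both ends of the range are inclusive, unlike in \<open>is_rmin\<close>. With at least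
  one full block in between, the middle part is covered by two entries of the sparse table.\<close>

definition rmq :: "nat \<Rightarrow> nat \<Rightarrow> (nat \<Rightarrow> nat) \<Rightarrow> nat \<Rightarrow> nat \<Rightarrow> nat" where
  "rmq k b d z j = (
    if z div b = j div b then z + lowest_bit b (drop_bit (z mod b) (block_mask b d j))
    else if z div b + 1 < j div b then let
        e = level b (j div b - (z div b + 1));
        i = sparse k b d ((z div b + 1) * b + e);
        i' = sparse k b d ((j div b - 2 ^ e) * b + e)
      in pick d (pick d (pick d (block_suffix b d z) i) i') (block_prefix b d j)
    else pick d (block_suffix b d z) (block_prefix b d j))"

text \<open>The number of middle blocks lies between \<open>2 ^ e\<close> and
  \<open>2 ^ (e + 1)\<close>, so the first \<open>2 ^ e\<close> and the last \<open>2 ^ e\<close> of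
  them cover them all, with overlap.\<close>

lemma middle_blocks:
  assumes b: "0 < b" "k < 2 ^ b" and j: "j < k" and qp: "q + 1 < j div b"
  defines "e \<equiv> level b (j div b - (q + 1))"
  shows "is_rmin d ((q + 1) * b) ((q + 1 + 2 ^ e) * b) (sparse k b d ((q + 1) * b + e))"
    "is_rmin d ((j div b - 2 ^ e) * b) (j div b * b) (sparse k b d ((j div b - 2 ^ e) * b + e))"
    "q + 1 \<le> j div b - 2 ^ e" "j div b - 2 ^ e \<le> q + 1 + 2 ^ e" "q + 1 + 2 ^ e \<le> j div b" "e < b"
proof -
  define p where "p = j div b"
  have pj: "p * b \<le> j" unfolding p_def by simp
  have len: "0 < p - (q + 1)" "p - (q + 1) < 2 ^ b"
  proof -
    have "p \<le> j" unfolding p_def by simp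
    then show "p - (q + 1) < 2 ^ b" using j b by linarith
  qed (use qp in \<open>simp add: p_def\<close>)
  have e': "e = level b (p - (q + 1))" by (simp add: e_def p_def)
  note e = level[OF len, folded e']
  show "e < b" by (rule e(3))
  show 1: "q + 1 \<le> j div b - 2 ^ e" "j div b - 2 ^ e \<le> q + 1 + 2 ^ e" "q + 1 + 2 ^ e \<le> j div b"
    using e qp unfolding p_def by auto
  show "is_rmin d ((q + 1) * b) ((q + 1 + 2 ^ e) * b) (sparse k b d ((q + 1) * b + e))"
  proof (rule sparse[OF e(3)])
    have "(q + 1 + 2 ^ e) * b \<le> p * b" using 1 unfolding p_def by (intro mult_le_mono) auto
    then show "(q + 1 + 2 ^ e) * b \<le> k" using pj j by linarith
  qed
  have "2 ^ e \<le> p" "p * b \<le> k" using e(1) pj j by linarith+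
  then show "is_rmin d ((j div b - 2 ^ e) * b) (j div b * b) (sparse k b d ((j div b - 2 ^ e) * b + e))"
    using sparse[OF e(3), of "p - 2 ^ e" k d] unfolding p_def[symmetric] by simp
qed

theorem rmq:
  assumes b: "0 < b" "k < 2 ^ b" and z: "z \<le> j" "j < k"
  shows "is_rmin d z (Suc j) (rmq k b d z j)"
proof (cases "z div b = j div b")
  case True
  then show ?thesis using in_block[OF b(1) z(1)] by (simp add: rmq_def)
next
  case False
  define q p where "q = z div b" and "p = j div b"
  have "q \<le> p" using z(1) by (simp add: q_def p_def div_le_mono)
  then have qp: "q < p" using False by (simp add: q_def p_def)
  note l = block_suffix[OF b(1), of d z, folded q_def] and r = block_prefix[OF b(1), of d j, folded p_def]
  have zq: "z < (q + 1) * b" using l by (auto simp: is_rmin_def)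
  have pj: "p * b \<le> j" unfolding p_def by simp
  have qb: "(q + 1) * b \<le> p * b" using qp by (intro mult_le_mono) auto
  show ?thesis
  proof (cases "q + 1 < p")
    case True
    define e where "e = level b (p - (q + 1))"
    note m = middle_blocks[OF b z(2), where q = q, folded p_def, OF True, folded e_def]
    define i1 i2 where "i1 = sparse k b d ((q + 1) * b + e)" and "i2 = sparse k b d ((p - 2 ^ e) * b + e)"
    have m1: "is_rmin d ((q + 1) * b) ((q + 1 + 2 ^ e) * b) i1" unfolding i1_def by (rule m(1))
    have m2: "is_rmin d ((p - 2 ^ e) * b) (p * b) i2" unfolding i2_def by (rule m(2))
    have 1: "is_rmin d z ((q + 1 + 2 ^ e) * b) (pick d (block_suffix b d z) i1)"
      unfolding pick_def by (rule is_rmin_combine[OF l m1]) (use zq in auto)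
    have 2: "is_rmin d z (p * b) (pick d (pick d (block_suffix b d z) i1) i2)"
      unfolding pick_def[of d "pick _ _ _"]
    proof (rule is_rmin_combine[OF 1 m2])
      have "(q + 1) * b \<le> (p - 2 ^ e) * b" using m(3) by (rule mult_le_mono1)
      then show "z \<le> (p - 2 ^ e) * b" using zq by linarith
      show "(p - 2 ^ e) * b \<le> (q + 1 + 2 ^ e) * b" using m(4) by (rule mult_le_mono1)
      show "(q + 1 + 2 ^ e) * b \<le> p * b" using m(5) by (rule mult_le_mono1)
    qed
    have "is_rmin d z (Suc j) (pick d (pick d (pick d (block_suffix b d z) i1) i2) (block_prefix b d j))"
      unfolding pick_def[of d "pick _ _ _" "block_prefix _ _ _"]
      by (rule is_rmin_combine[OF 2 r]) (use qb zq pj in linarith)+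
    then show ?thesis using False True
      unfolding rmq_def Let_def q_def[symmetric] p_def[symmetric] i1_def i2_def e_def by simp
  next
    case F: False
    have "is_rmin d z (Suc j) (pick d (block_suffix b d z) (block_prefix b d j))" unfolding pick_def
    proof (rule is_rmin_combine[OF l r])
      show "p * b \<le> (q + 1) * b" using F by (intro mult_le_mono1) simp
    qed (use qb zq pj in linarith)+
    then show ?thesis using False F
      unfolding rmq_def Let_def q_def[symmetric] p_def[symmetric] by simp
  qed
qed

section \<open>Perfect hashing\<close>

text \<open>The first factor of the modulus, the width of the cells, is at least the size of the universe;
  this makes primality of the modulus dispensable.\<close>

definition hash :: "nat \<Rightarrow> nat \<Rightarrow> nat \<Rightarrow> nat \<Rightarrow> nat" where
  "hash n a r x = (a * x) mod (n * r) div n"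

lemma hash_less: "0 < n \<Longrightarrow> 0 < r \<Longrightarrow> hash n a r x < r"
  unfolding hash_def by (simp add: less_mult_imp_div_less mult.commute)

lemma card_multiples_between:
  fixes \<delta> u l :: nat
  assumes "0 < \<delta>"
  shows "card {a. u \<le> a * \<delta> \<and> a * \<delta> < u + l} \<le> l div \<delta> + 1"
proof -
  define a0 where "a0 = (LEAST a. u \<le> a * \<delta>)"
  have "u \<le> u * \<delta>" using assms by simp
  then have a0: "u \<le> a0 * \<delta>" unfolding a0_def by (rule LeastI)
  have "{a. u \<le> a * \<delta> \<and> a * \<delta> < u + l} \<subseteq> {a0..<a0 + (l div \<delta> + 1)}"
  proof
    fix a assume a: "a \<in> {a. u \<le> a * \<delta> \<and> a * \<delta> < u + l}"
    then have "a0 \<le> a" unfolding a0_def by (auto intro: Least_le)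
    moreover have "a < a0 + (l div \<delta> + 1)"
    proof (rule ccontr)
      assume "\<not> a < a0 + (l div \<delta> + 1)"
      then have "(a0 + (l div \<delta> + 1)) * \<delta> \<le> a * \<delta>" by (intro mult_le_mono) auto
      moreover have "l < (l div \<delta> + 1) * \<delta>" using assms
        by (metis dividend_less_div_times add.commute mult_Suc plus_1_eq_Suc)
      ultimately have "u + l \<le> a * \<delta>" using a0 by (simp add: add_mult_distrib)
      then show False using a by simp
    qed
    ultimately show "a \<in> {a0..<a0 + (l div \<delta> + 1)}" by simp
  qed
  then have "card {a. u \<le> a * \<delta> \<and> a * \<delta> < u + l} \<le> card {a0..<a0 + (l div \<delta> + 1)}"
    by (intro card_mono) auto
  then show ?thesis by simp
qed

text \<open>As \<open>a * \<delta>\<close> stays below \<open>\<delta> * (n * r)\<close>, at most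
  \<open>\<delta> + 1\<close> multiples of \<open>n * r\<close> are candidates, each with a window
  of length \<open>2 * n\<close> holding at most \<open>2 * n div \<delta> + 1\<close> values
  \<open>a * \<delta>\<close>. The product is at most \<open>4 * n + \<delta> + 1\<close>, and
  \<open>\<delta> < n\<close>; the constant 9 is generous.\<close>

lemma card_near_multiples:
  fixes n r \<delta> :: nat
  assumes "0 < \<delta>" "\<delta> < n" "0 < r"
  shows "card {a. a < n * r \<and> (\<exists>c. c * (n * r) < a * \<delta> + n \<and> a * \<delta> < c * (n * r) + n)} \<le> 9 * n"
proof -
  let ?S = "\<lambda>c. {a. c * (n * r) - n \<le> a * \<delta> \<and> a * \<delta> < (c * (n * r) - n) + 2 * n}"
  have "{a. a < n * r \<and> (\<exists>c. c * (n * r) < a * \<delta> + n \<and> a * \<delta> < c * (n * r) + n)} \<subseteq> (\<Union>c\<in>{..\<delta>}. ?S c)"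
  proof
    fix a assume "a \<in> {a. a < n * r \<and> (\<exists>c. c * (n * r) < a * \<delta> + n \<and> a * \<delta> < c * (n * r) + n)}"
    then obtain c where a: "a < n * r" and c: "c * (n * r) < a * \<delta> + n" "a * \<delta> < c * (n * r) + n" by blast
    have "c \<le> \<delta>"
    proof (rule ccontr)
      assume "\<not> c \<le> \<delta>"
      then have "(\<delta> + 1) * (n * r) \<le> c * (n * r)" by (intro mult_le_mono) auto
      moreover have "a * \<delta> \<le> \<delta> * (n * r)" using a by (simp add: mult.commute)
      moreover have "n \<le> n * r" using assms by simp
      ultimately show False using c by (simp add: add_mult_distrib)
    qed
    moreover have "a \<in> ?S c" using c by auto
    ultimately show "a \<in> (\<Union>c\<in>{..\<delta>}. ?S c)" by blast
  qed
  moreover have fin: "finite (?S c)" for c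
  proof (rule finite_subset)
    show "?S c \<subseteq> {..(c * (n * r) - n) + 2 * n}"
    proof
      fix a assume "a \<in> ?S c"
      moreover have "a \<le> a * \<delta>" using assms by simp
      ultimately show "a \<in> {..(c * (n * r) - n) + 2 * n}" by (simp only: mem_Collect_eq atMost_iff) linarith
    qed
  qed simp
  ultimately have "card {a. a < n * r \<and> (\<exists>c. c * (n * r) < a * \<delta> + n \<and> a * \<delta> < c * (n * r) + n)} \<le> card (\<Union>c\<in>{..\<delta>}. ?S c)"
    by (intro card_mono finite_UN_I) auto
  also have "\<dots> \<le> (\<Sum>c\<in>{..\<delta>}. card (?S c))" by (rule card_UN_le) simp
  also have "\<dots> \<le> (\<Sum>c\<in>{..\<delta>}. 2 * n div \<delta> + 1)"
    by (intro sum_mono card_multiples_between assms)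
  also have "\<dots> = (\<delta> + 1) * (2 * n div \<delta> + 1)" by simp
  also have "\<dots> \<le> 9 * n"
  proof -
    have "\<delta> * (2 * n div \<delta>) \<le> 2 * n" by simp
    moreover have "2 * n div \<delta> \<le> 2 * n" by simp
    moreover have "(\<delta> + 1) * (2 * n div \<delta> + 1) = \<delta> * (2 * n div \<delta>) + \<delta> + 2 * n div \<delta> + 1"
      by simp
    ultimately have "(\<delta> + 1) * (2 * n div \<delta> + 1) \<le> 2 * n + \<delta> + 2 * n + 1" by linarith
    then show ?thesis using assms by linarith
  qed
  finally show ?thesis .
qed

text \<open>Equal cells put the residues of \<open>a * x\<close> and \<open>a * y\<close> less than
  \<open>n\<close> apart, so their difference lies near a multiple of the modulus.\<close>

lemma hash_collision:
  assumes "hash n a r x = hash n a r y" "0 < n" "x < y"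
  shows "\<exists>c. c * (n * r) < a * (y - x) + n \<and> a * (y - x) < c * (n * r) + n"
proof -
  let ?p = "n * r"
  have near: "u < v + n" if "u div n = v div n" for u v :: nat
  proof -
    have "u = u div n * n + u mod n" "v = u div n * n + v mod n" using that by (metis div_mult_mod_eq)+
    moreover have "u mod n < n" using assms by simp
    ultimately show ?thesis by linarith
  qed
  define cx cy where "cx = a * x div ?p" and "cy = a * y div ?p"
  have ax: "a * x = cx * ?p + a * x mod ?p" and ay: "a * y = cy * ?p + a * y mod ?p"
    unfolding cx_def cy_def by (simp_all only: div_mult_mod_eq)
  have "cx \<le> cy" unfolding cx_def cy_def using assms by (intro div_le_mono mult_le_mono) auto
  then have c: "cy * ?p = (cy - cx) * ?p + cx * ?p" by (metis add_mult_distrib le_add_diff_inverse2)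
  have "a * (y - x) + a * x = a * y" using assms by (simp add: diff_mult_distrib2)
  moreover have "a * x mod ?p < a * y mod ?p + n" "a * y mod ?p < a * x mod ?p + n"
    using assms(1) near unfolding hash_def by metis+
  ultimately show ?thesis using ax ay c by (intro exI[of _ "cy - cx"]) linarith
qed

lemma card_hash_collisions:
  assumes "x < n" "y < n" "x \<noteq> y" "0 < r"
  shows "card {a. a < n * r \<and> hash n a r x = hash n a r y} \<le> 9 * n"
proof -
  have *: "card {a. a < n * r \<and> hash n a r x = hash n a r y} \<le> 9 * n"
    if "x < y" "y < n" for x y
  proof -
    have "card {a. a < n * r \<and> hash n a r x = hash n a r y} \<le>
      card {a. a < n * r \<and> (\<exists>c. c * (n * r) < a * (y - x) + n \<and> a * (y - x) < c * (n * r) + n)}"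
      using hash_collision[of n _ r x y] that by (intro card_mono) auto
    also have "\<dots> \<le> 9 * n" using that assms by (intro card_near_multiples) auto
    finally show ?thesis .
  qed
  show ?thesis
  proof (cases "x < y")
    case False
    then have "card {a. a < n * r \<and> hash n a r y = hash n a r x} \<le> 9 * n" using assms by (intro *) auto
    then show ?thesis by (simp add: eq_commute)
  qed (use assms * in blast)
qed

text \<open>Ordered pairs, so that a bucket with \<open>b\<close> members contributes
  \<open>b * (b - 1)\<close>.\<close>

definition collisions :: "nat \<Rightarrow> nat set \<Rightarrow> (nat \<Rightarrow> nat) \<Rightarrow> nat \<Rightarrow> nat \<Rightarrow> nat" where
  "collisions n J f r a = card {(i, j). i \<in> J \<and> j \<in> J \<and> i \<noteq> j \<and> hash n a r (f i) = hash n a r (f j)}"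

text \<open>Averaging over all multipliers.\<close>

lemma few_collisions:
  assumes J: "finite J" "inj_on f J" "\<And>i. i \<in> J \<Longrightarrow> f i < n" and r: "0 < r" "0 < n"
  shows "\<exists>a<n * r. collisions n J f r a * r \<le> 9 * (card J * (card J - 1))"
proof (rule ccontr)
  assume "\<not> ?thesis"
  then have gt: "9 * (card J * (card J - 1)) < collisions n J f r a * r" if "a < n * r" for a
    using that by (meson not_le)
  define P where "P = {(i, j). i \<in> J \<and> j \<in> J \<and> i \<noteq> j}"
  have finP: "finite P" unfolding P_def using J by (auto intro: finite_subset[of _ "J \<times> J"])
  have cardP: "card P = card J * (card J - 1)"
  proof -
    have "P = (SIGMA i:J. J - {i})" unfolding P_def by auto
    then show ?thesis using J by simp
  qed
  have coll: "collisions n J f r a = (\<Sum>p\<in>P. if hash n a r (f (fst p)) = hash n a r (f (snd p)) then 1 else 0)" for a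
  proof -
    have "{(i, j). i \<in> J \<and> j \<in> J \<and> i \<noteq> j \<and> hash n a r (f i) = hash n a r (f j)} =
      {p\<in>P. hash n a r (f (fst p)) = hash n a r (f (snd p))}" unfolding P_def by auto
    then show ?thesis unfolding collisions_def using finP by (simp add: sum.If_cases Int_def)
  qed
  have "(\<Sum>a<n * r. collisions n J f r a) =
    (\<Sum>p\<in>P. \<Sum>a<n * r. if hash n a r (f (fst p)) = hash n a r (f (snd p)) then 1 else 0)"
    unfolding coll by (rule sum.swap)
  also have "\<dots> = (\<Sum>p\<in>P. card {a. a < n * r \<and> hash n a r (f (fst p)) = hash n a r (f (snd p))})"
    by (intro sum.cong refl) (simp add: sum.If_cases Int_def)
  also have "\<dots> \<le> (\<Sum>p\<in>P. 9 * n)"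
  proof (rule sum_mono)
    fix p assume "p \<in> P"
    then have "f (fst p) < n" "f (snd p) < n" "f (fst p) \<noteq> f (snd p)"
      using J unfolding P_def by (auto dest: inj_onD)
    then show "card {a. a < n * r \<and> hash n a r (f (fst p)) = hash n a r (f (snd p))} \<le> 9 * n"
      using r by (intro card_hash_collisions)
  qed
  also have "\<dots> = card J * (card J - 1) * (9 * n)" using cardP by simp
  finally have le: "(\<Sum>a<n * r. collisions n J f r a) * r \<le> card J * (card J - 1) * (9 * n) * r" by simp
  have "(\<Sum>a<n * r. 9 * (card J * (card J - 1))) < (\<Sum>a<n * r. collisions n J f r a * r)"
    by (rule sum_strict_mono) (use gt r in \<open>auto simp: lessThan_empty_iff\<close>)
  then have "n * r * (9 * (card J * (card J - 1))) < (\<Sum>a<n * r. collisions n J f r a) * r"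
    by (simp add: sum_distrib_right)
  then show False using le by (simp add: mult_ac)
qed


text \<open>Exhaustive search below \<open>n * r\<close> replaces the usual random choice.\<close>

definition multiplier :: "nat \<Rightarrow> nat set \<Rightarrow> (nat \<Rightarrow> nat) \<Rightarrow> nat \<Rightarrow> nat" where
  "multiplier n J f r = least_upto (n * r) (\<lambda>a. collisions n J f r a * r \<le> 9 * (card J * (card J - 1)))"

lemma multiplier_le: "multiplier n J f r \<le> n * r"
  unfolding multiplier_def by (rule least_upto_le)

lemma multiplier:
  assumes "finite J" "inj_on f J" "\<And>i. i \<in> J \<Longrightarrow> f i < n" "0 < r" "0 < n"
  shows "collisions n J f r (multiplier n J f r) * r \<le> 9 * (card J * (card J - 1))"
proof -
  obtain a where "a < n * r" "collisions n J f r a * r \<le> 9 * (card J * (card J - 1))"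
    using few_collisions[OF assms] by blast
  then show ?thesis unfolding multiplier_def
    by (intro least_upto_holds[where P = "\<lambda>a. collisions n J f r a * r \<le> 9 * (card J * (card J - 1))"]) auto
qed

section \<open>The two-level dictionary\<close>

locale dictionary =
  fixes n k :: nat and f g :: "nat \<Rightarrow> nat"
  assumes inj: "inj_on f {..<k}" and less: "j < k \<Longrightarrow> f j < n"
begin

definition bucket :: "nat \<Rightarrow> nat" where
  "bucket j = hash n (multiplier n {..<k} f k) k (f j)"

definition members :: "nat \<Rightarrow> nat set" where
  "members i = {j. j < k \<and> bucket j = i}"

text \<open>For \<open>b\<close> members the averaging bound is \<open>9 * (b * (b - 1))\<close>. It
  is strictly below this width, which forces the multiplier of the bucket to have no
  collision.\<close>

definition width :: "nat \<Rightarrow> nat" where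
  "width i = 9 * (card (members i) * card (members i))"

definition offset :: "nat \<Rightarrow> nat" where
  "offset i = (\<Sum>i'<i. width i')"

definition factor :: "nat \<Rightarrow> nat" where
  "factor i = multiplier n (members i) f (width i)"

definition slot :: "nat \<Rightarrow> nat" where
  "slot j = offset (bucket j) + hash n (factor (bucket j)) (width (bucket j)) (f j)"

definition table :: "nat \<Rightarrow> nat" where
  "table u = (\<Sum>j<k. if slot j = u then g j else 0)"

lemma finite_members: "finite (members i)"
  unfolding members_def by simp

lemma bucket_less: "j < k \<Longrightarrow> bucket j < k"
  unfolding bucket_def using less[of j] by (intro hash_less) auto

lemma card_members_le: "card (members i) \<le> k"
  using card_mono[of "{..<k}" "members i"] by (auto simp: members_def)

text \<open>With range \<open>k\<close> the first multiplier has at most \<open>9 * k\<close>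
  ordered collisions, which is a bound on the sum of \<open>b * (b - 1)\<close> over the bucket
  sizes \<open>b\<close>. The sizes add up to \<open>k\<close>, and
  \<open>9 * (9 * k) + 9 * k = 90 * k\<close>.\<close>

lemma sum_width: "(\<Sum>i<k. width i) \<le> 90 * k"
proof (cases "k = 0")
  case False
  then have n: "0 < n" using less[of 0] by simp
  let ?\<beta> = "\<lambda>i. card (members i)" and ?a = "multiplier n {..<k} f k"
  have "(\<Sum>i<k. ?\<beta> i) = card (\<Union>i\<in>{..<k}. members i)"
    by (rule card_UN_disjoint[symmetric]) (auto simp: members_def)
  also have "(\<Union>i\<in>{..<k}. members i) = {..<k}" using bucket_less by (auto simp: members_def)
  finally have 1: "(\<Sum>i<k. ?\<beta> i) = k" by simp
  have "collisions n {..<k} f k ?a = card (\<Union>i\<in>{..<k}. SIGMA j:members i. members i - {j})"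
    unfolding collisions_def bucket_def[symmetric]
    by (rule arg_cong[of _ _ card]) (auto simp: members_def bucket_less)
  also have "\<dots> = (\<Sum>i<k. card (SIGMA j:members i. members i - {j}))"
    by (rule card_UN_disjoint) (auto simp: members_def)
  also have "\<dots> = (\<Sum>i<k. ?\<beta> i * (?\<beta> i - 1))"
    using finite_members by simp
  finally have "(\<Sum>i<k. ?\<beta> i * (?\<beta> i - 1)) * k \<le> 9 * (k * (k - 1))"
    using multiplier[OF _ inj, of n k] less False n by simp
  also have "\<dots> \<le> 9 * k * k" by simp
  finally have 2: "(\<Sum>i<k. ?\<beta> i * (?\<beta> i - 1)) \<le> 9 * k" using False by simp
  have "width i = 9 * (?\<beta> i * (?\<beta> i - 1)) + 9 * ?\<beta> i" for i
    by (cases "?\<beta> i") (simp_all add: width_def algebra_simps)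
  then have "(\<Sum>i<k. width i) = 9 * (\<Sum>i<k. ?\<beta> i * (?\<beta> i - 1)) + 9 * (\<Sum>i<k. ?\<beta> i)"
    by (simp add: sum.distrib sum_distrib_left)
  then show ?thesis using 1 2 by linarith
qed simp

lemma offset_mono: "i \<le> i' \<Longrightarrow> offset i \<le> offset i'"
  unfolding offset_def by (rule sum_mono2) auto

lemma offset_le: "i \<le> k \<Longrightarrow> offset i \<le> 90 * k"
  using offset_mono[of i k] sum_width by (simp add: offset_def)

lemma slot_within:
  assumes "j < k" shows "offset (bucket j) \<le> slot j" "slot j < offset (Suc (bucket j))"
proof -
  have "j \<in> members (bucket j)" using assms by (simp add: members_def)
  then have "card (members (bucket j)) \<noteq> 0" using finite_members by auto
  then have "0 < width (bucket j)" by (simp add: width_def)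
  then have "hash n (factor (bucket j)) (width (bucket j)) (f j) < width (bucket j)"
    using less[OF assms] by (intro hash_less) auto
  then show "offset (bucket j) \<le> slot j" "slot j < offset (Suc (bucket j))"
    by (simp_all add: slot_def offset_def)
qed

lemma slot_less: "j < k \<Longrightarrow> slot j < 90 * k"
  using slot_within(2)[of j] offset_le[of "Suc (bucket j)"] bucket_less[of j] by simp

text \<open>Buckets own disjoint intervals of slots. Inside a bucket, the number of collisions times
  the width is less than the width, hence zero.\<close>

lemma slot_inj: "inj_on slot {..<k}"
proof (rule inj_onI, rule ccontr)
  fix i j assume ij: "i \<in> {..<k}" "j \<in> {..<k}" "slot i = slot j" "i \<noteq> j"
  have "bucket i = bucket j"
  proof (rule ccontr)
    assume "bucket i \<noteq> bucket j"
    then have "Suc (bucket i) \<le> bucket j \<or> Suc (bucket j) \<le> bucket i" by arith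
    then show False using slot_within[of i] slot_within[of j] ij
        offset_mono[of "Suc (bucket i)" "bucket j"] offset_mono[of "Suc (bucket j)" "bucket i"] by auto
  qed
  define b where "b = bucket i"
  let ?r = "width b" and ?\<beta> = "card (members b)"
  have b: "i \<in> members b" "j \<in> members b" "hash n (factor b) ?r (f i) = hash n (factor b) ?r (f j)"
    using ij \<open>bucket i = bucket j\<close> by (auto simp: members_def slot_def b_def)
  then have \<beta>: "0 < ?\<beta>" using finite_members card_gt_0_iff by blast
  have n: "0 < n" using less[of i] ij by simp
  have "collisions n (members b) f ?r (factor b) * ?r \<le> 9 * (?\<beta> * (?\<beta> - 1))"
    unfolding factor_def
    by (rule multiplier) (use finite_members less n \<beta> inj in \<open>auto simp: members_def width_def intro: inj_on_subset\<close>)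
  also have "\<dots> < ?r" using \<beta> by (simp add: width_def)
  finally have "collisions n (members b) f ?r (factor b) = 0" by simp
  moreover have "finite {(i, j). i \<in> members b \<and> j \<in> members b \<and> i \<noteq> j \<and>
      hash n (factor b) ?r (f i) = hash n (factor b) ?r (f j)}"
    by (rule finite_subset[of _ "members b \<times> members b"]) (use finite_members in auto)
  ultimately show False using b ij(4) by (auto simp: collisions_def)
qed

lemma table_slot:
  assumes "j < k" shows "table (slot j) = g j"
proof -
  have "slot i = slot j \<longleftrightarrow> i = j" if "i < k" for i
    using inj_on_eq_iff[OF slot_inj, of i j] that assms by simp
  then have "table (slot j) = (\<Sum>i<k. if i = j then g j else 0)"
    unfolding table_def by (intro sum.cong) auto
  then show ?thesis using assms by simp
qed

end

section \<open>Tabulation programs\<close>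

text \<open>Memory is divided into arrays of length \<open>L\<close>.\<close>

definition cell :: "nat \<Rightarrow> (nat \<Rightarrow> nat) \<Rightarrow> nat \<Rightarrow> nat \<Rightarrow> nat" where
  "cell L \<mu> A i = \<mu> (A * L + i)"

text \<open>With the length as a parameter, \<open>put L A i f\<close> describes the memory after
  \<open>i\<close> rounds of \<open>fill\<close>, as the loop invariant needs.\<close>

definition put :: "nat \<Rightarrow> nat \<Rightarrow> nat \<Rightarrow> (nat \<Rightarrow> nat) \<Rightarrow> (nat \<Rightarrow> nat) \<Rightarrow> nat \<Rightarrow> nat" where
  "put L A n f \<mu> = (\<lambda>a. if A * L \<le> a \<and> a < A * L + n then f (a - A * L) else \<mu> a)"

lemma put_0: "put L A 0 f \<mu> = \<mu>"
  by (auto simp: put_def)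

lemma put_Suc: "put L A (Suc i) f \<mu> = (put L A i f \<mu>)(A * L + i := f i)"
  by (auto simp: put_def fun_eq_iff less_Suc_eq)

lemma cell_put_same: "i < n \<Longrightarrow> cell L (put L A n f \<mu>) A i = f i"
  by (simp add: cell_def put_def)

lemma cell_put_other:
  assumes "A \<noteq> B" "i < L" "n \<le> L"
  shows "cell L (put L A n f \<mu>) B i = cell L \<mu> B i"
proof -
  have "\<not> (A * L \<le> B * L + i \<and> B * L + i < A * L + n)"
  proof (cases "A < B")
    case True
    then have "Suc A * L \<le> B * L" by (intro mult_le_mono) auto
    then show ?thesis using assms by simp
  next
    case False
    then have "Suc B * L \<le> A * L" using assms by (intro mult_le_mono) auto
    then show ?thesis using assms by simp
  qed
  then show ?thesis by (auto simp: cell_def put_def)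
qed

text \<open>Registers 0 and 1 hold \<open>L\<close> and the current index, available to
  \<open>e\<close> as variables. Variables stay below 20; register 20 keeps the length, while 21 and
  22 receive the value and its address.\<close>

definition fill :: "nat \<Rightarrow> exp \<Rightarrow> exp \<Rightarrow> com" where
  "fill A len e = Seq (compile len 20) (Seq (Move 1 (Const 0)) (While (Lt (Reg 1) (Reg 20))
    (Seq (compile e 21) (Seq (compile (Bin Add (Bin Mul (Num A) (Var 0)) (Var 1)) 22)
      (Seq (Store (Reg 22) (Reg 21)) (Op 1 Add (Reg 1) (Const 1)))))))"

text \<open>Entry \<open>i\<close> is evaluated on a memory that already holds the earlier entries
  of the same array. This admits recursively defined tables such as those of \<open>row_exp\<close>
  and \<open>pow_exp\<close>.\<close>

definition step :: "nat \<Rightarrow> (nat \<Rightarrow> nat) \<Rightarrow> nat \<Rightarrow> exp \<Rightarrow> exp \<Rightarrow> nat \<Rightarrow> (nat \<Rightarrow> nat) \<Rightarrow> bool" where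
  "step L \<mu> A len e n f \<longleftrightarrow> n \<le> L \<and> (\<forall>i<n. f i \<le> L) \<and> (\<forall>\<rho>. \<rho> 0 = L \<longrightarrow> eval len \<rho> \<mu> = n) \<and>
    (\<forall>i<n. \<forall>\<rho>. \<rho> 0 = L \<longrightarrow> \<rho> 1 = i \<longrightarrow> eval e \<rho> (put L A i f \<mu>) = f i)"

definition ready :: "nat \<Rightarrow> state \<Rightarrow> bool" where
  "ready L \<sigma> \<longleftrightarrow> reg \<sigma> 0 = L \<and> (\<forall>j<20. reg \<sigma> j \<le> L) \<and> (\<forall>a. mem \<sigma> a \<le> L)"

lemma ready_env_ok: "ready L \<sigma> \<Longrightarrow> env_ok L 1 20 \<sigma>"
  by (simp add: ready_def env_ok_def)

lemma computes_pow:
  assumes "computes q c c' r e" "2 \<le> L" "L ^ c' < 2 ^ w" "env_ok L c q \<sigma>" "wf_exp q e"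
    and "mem \<sigma>' = mem \<sigma>" "\<And>j. j < q \<Longrightarrow> reg \<sigma>' j = reg \<sigma> j"
  shows "runs w (compile e r) \<sigma>' (L ^ c') (\<lambda>\<sigma>''. mem \<sigma>'' = mem \<sigma> \<and>
    reg \<sigma>'' r = eval e (reg \<sigma>) (mem \<sigma>) \<and> (\<forall>j<r. reg \<sigma>'' j = reg \<sigma>' j))"
  by (rule runs_weaken[OF computes_agree[OF assms(1,5,2,3,4,6,7)] exp_time_le_pow[OF assms(2)]])

lemma fill_runs:
  assumes wf: "wf_exp 20 len" "wf_exp 20 e"
  shows "\<exists>c'. \<forall>L w \<sigma> n f. 2 \<le> L \<longrightarrow> L ^ c' < 2 ^ w \<longrightarrow> ready L \<sigma> \<longrightarrow> step L (mem \<sigma>) A len e n f \<longrightarrow>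
    runs w (fill A len e) \<sigma> (L ^ c') (\<lambda>\<sigma>'. ready L \<sigma>' \<and> mem \<sigma>' = put L A n f (mem \<sigma>))"
proof -
  let ?a = "Bin Add (Bin Mul (Num A) (Var 0)) (Var 1)"
  have wfa: "wf_exp 20 ?a" by simp
  obtain c1 c2 c3 where "computes 20 1 c1 20 len" "computes 20 1 c2 21 e" "computes 20 1 c3 22 ?a"
    using computes_exists[OF wf(1), of 20 1] computes_exists[OF wf(2), of 21 1]
      computes_exists[OF wfa, of 22 1] by auto
  note c123 = this
  define c where "c = c1 + c2 + c3"
  have c: "computes 20 1 c 20 len" "computes 20 1 c 21 e" "computes 20 1 c 22 ?a"
    by (rule computes_mono[OF c123(1)] computes_mono[OF c123(2)] computes_mono[OF c123(3)], simp add: c_def)+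
  have "runs w (fill A len e) \<sigma> (L ^ (c + 6)) (\<lambda>\<sigma>'. ready L \<sigma>' \<and> mem \<sigma>' = put L A n f (mem \<sigma>))"
    if L: "2 \<le> L" "L ^ (c + 6) < 2 ^ w" and r: "ready L \<sigma>" and s: "step L (mem \<sigma>) A len e n f" for L w \<sigma> n f
  proof -
    let ?\<mu> = "\<lambda>i. put L A i f (mem \<sigma>)"
    have n: "n \<le> L" and f: "\<And>i. i < n \<Longrightarrow> f i \<le> L" and evl: "eval len (reg \<sigma>) (mem \<sigma>) = n"
      and eve: "\<And>i \<rho>. i < n \<Longrightarrow> \<rho> 0 = L \<Longrightarrow> \<rho> 1 = i \<Longrightarrow> eval e \<rho> (?\<mu> i) = f i"
      using s r by (auto simp: step_def ready_def)
    have "L ^ c \<le> L ^ (c + 6)" "L ^ 1 \<le> L ^ (c + 6)" using L by (intro power_increasing; simp)+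
    then have "L ^ c \<le> L ^ (c + 6)" "L \<le> L ^ (c + 6)" by simp_all
    then have w: "L ^ c < 2 ^ w" "L < 2 ^ w" using L by linarith+
    have w1: "1 < (2::nat) ^ w" using w L by linarith
    then have w0: "0 < w" by (cases w) auto
    define T where "T = L ^ c + (L ^ c + (1 + 1))"
    define I :: "nat \<Rightarrow> state \<Rightarrow> bool" where
      "I i \<sigma>' \<longleftrightarrow> ready L \<sigma>' \<and> reg \<sigma>' 1 = i \<and> reg \<sigma>' 20 = n \<and> mem \<sigma>' = ?\<mu> i" for i \<sigma>'
    have loop: "runs w (While (Lt (Reg 1) (Reg 20))
      (Seq (compile e 21) (Seq (compile ?a 22) (Seq (Store (Reg 22) (Reg 21)) (Op 1 Add (Reg 1) (Const 1)))))) \<sigma>'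
        ((n - 0) * Suc T + 1) (\<lambda>\<sigma>'. ready L \<sigma>' \<and> mem \<sigma>' = ?\<mu> n)" if "I 0 \<sigma>'" for \<sigma>'
    proof (rule runs_While_count[where I = I])
      fix i and \<sigma>1 :: state assume i: "i < n" and I: "I i \<sigma>1"
      have t: "test_val w \<sigma>1 (Lt (Reg 1) (Reg 20))" using I i by (simp add: I_def)
      have ok: "env_ok L 1 20 \<sigma>1" using I ready_env_ok by (simp add: I_def)
      have ev: "eval e (reg \<sigma>1) (mem \<sigma>1) = f i" using eve[OF i] I by (simp add: I_def ready_def)
      have eva: "eval ?a (reg \<sigma>1) (mem \<sigma>1) = A * L + i" using I by (simp add: I_def ready_def)
      have "runs w (Seq (compile e 21) (Seq (compile ?a 22) (Seq (Store (Reg 22) (Reg 21)) (Op 1 Add (Reg 1) (Const 1)))))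
        \<sigma>1 T (I (Suc i))"
        unfolding T_def
      proof (intro runs_Seq runs_weaken[OF computes_pow[OF c(2) L(1) w(1) ok wf(2)] order_refl])
        show "mem \<sigma>1 = mem \<sigma>1" "\<And>j. reg \<sigma>1 j = reg \<sigma>1 j" by simp_all
        fix \<sigma>2 :: state assume p: "mem \<sigma>2 = mem \<sigma>1 \<and> reg \<sigma>2 21 = eval e (reg \<sigma>1) (mem \<sigma>1) \<and> (\<forall>j<21. reg \<sigma>2 j = reg \<sigma>1 j)"
        show "runs w (compile ?a 22) \<sigma>2 (L ^ c) (\<lambda>\<sigma>'. runs w (Seq (Store (Reg 22) (Reg 21)) (Op 1 Add (Reg 1) (Const 1)))
          \<sigma>' (1 + 1) (I (Suc i)))"
        proof (rule runs_weaken[OF computes_pow[OF c(3) L(1) w(1) ok wfa] order_refl])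
          show "mem \<sigma>2 = mem \<sigma>1" "\<And>j. j < 20 \<Longrightarrow> reg \<sigma>2 j = reg \<sigma>1 j" using p by auto
          fix \<sigma>3 :: state assume q: "mem \<sigma>3 = mem \<sigma>1 \<and> reg \<sigma>3 22 = eval ?a (reg \<sigma>1) (mem \<sigma>1) \<and> (\<forall>j<22. reg \<sigma>3 j = reg \<sigma>2 j)"
          have regs: "reg \<sigma>3 22 = A * L + i" "reg \<sigma>3 21 = f i" "\<And>j. j < 21 \<Longrightarrow> reg \<sigma>3 j = reg \<sigma>1 j"
            using p q ev eva by auto
          have tb: "take_bit w (Suc i) = Suc i" "take_bit w (Suc 0) = Suc 0"
            using i n w w1 w0 by (auto intro!: take_bit_nat_eq_self)
          show "runs w (Seq (Store (Reg 22) (Reg 21)) (Op 1 Add (Reg 1) (Const 1))) \<sigma>3 (1 + 1) (I (Suc i))"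
            by (intro runs_Seq runs_Store runs_Op)
              (use I i n f[OF i] regs q tb in \<open>auto simp: I_def ready_def put_Suc\<close>)
        qed
      qed
      with t show "test_val w \<sigma>1 (Lt (Reg 1) (Reg 20)) \<and> runs w (Seq (compile e 21) (Seq (compile ?a 22)
        (Seq (Store (Reg 22) (Reg 21)) (Op 1 Add (Reg 1) (Const 1))))) \<sigma>1 T (I (Suc i))" by blast
    qed (use that in \<open>auto simp: I_def\<close>)
    have time: "L ^ c + (1 + ((n - 0) * Suc T + 1)) \<le> L ^ (c + 6)"
    proof -
      have X: "1 \<le> L ^ c" using L by simp
      have "Suc T \<le> 5 * L ^ c" using X by (simp add: T_def)
      then have "n * Suc T \<le> L * (5 * L ^ c)" using n by (intro mult_le_mono) auto
      moreover have "L ^ c \<le> L * L ^ c" "1 \<le> L * L ^ c" using L X by auto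
      ultimately have "L ^ c + (1 + ((n - 0) * Suc T + 1)) \<le> 8 * (L * L ^ c)" by (simp only: diff_zero)
      also have "\<dots> \<le> L ^ 3 * (L * L ^ c)" using power_mono[of 2 L 3] L by (intro mult_le_mono1) simp
      also have "\<dots> = L ^ (c + 4)" by (simp add: power_add power3_eq_cube power4_eq_xxxx)
      also have "\<dots> \<le> L ^ (c + 6)" using L by (intro power_increasing) auto
      finally show ?thesis .
    qed
    have "runs w (fill A len e) \<sigma> (L ^ c + (1 + ((n - 0) * Suc T + 1))) (\<lambda>\<sigma>'. ready L \<sigma>' \<and> mem \<sigma>' = ?\<mu> n)"
      unfolding fill_def
    proof (intro runs_Seq runs_weaken[OF computes_pow[OF c(1) L(1) w(1) ready_env_ok[OF r] wf(1)] order_refl] runs_Move)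
      show "mem \<sigma> = mem \<sigma>" "\<And>j. reg \<sigma> j = reg \<sigma> j" by simp_all
      fix \<sigma>' :: state assume "mem \<sigma>' = mem \<sigma> \<and> reg \<sigma>' 20 = eval len (reg \<sigma>) (mem \<sigma>) \<and> (\<forall>j<20. reg \<sigma>' j = reg \<sigma> j)"
      then show "runs w (While (Lt (Reg 1) (Reg 20)) (Seq (compile e 21) (Seq (compile ?a 22)
        (Seq (Store (Reg 22) (Reg 21)) (Op 1 Add (Reg 1) (Const 1))))))
        (\<sigma>'\<lparr>reg := (reg \<sigma>')(1 := operand_val w \<sigma>' (Const 0))\<rparr>) ((n - 0) * Suc T + 1) (\<lambda>\<sigma>'. ready L \<sigma>' \<and> mem \<sigma>' = ?\<mu> n)"
        using r evl by (intro loop) (auto simp: I_def ready_def put_0)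
    qed
    then show ?thesis using time by (rule runs_weaken)
  qed
  then show ?thesis by blast
qed

fun prog :: "(nat \<times> exp \<times> exp) list \<Rightarrow> com" where
  "prog [] = Skip"
| "prog ((A, len, e) # ps) = Seq (fill A len e) (prog ps)"

fun steps :: "nat \<Rightarrow> (nat \<Rightarrow> nat) \<Rightarrow> (nat \<times> exp \<times> exp) list \<Rightarrow> (nat \<Rightarrow> nat) \<Rightarrow> bool" where
  "steps L \<mu> [] \<mu>' \<longleftrightarrow> \<mu>' = \<mu>"
| "steps L \<mu> ((A, len, e) # ps) \<mu>' \<longleftrightarrow> (\<exists>n f. step L \<mu> A len e n f \<and> steps L (put L A n f \<mu>) ps \<mu>')"

lemma prog_runs:
  assumes "\<forall>(A, len, e)\<in>set ps. wf_exp 20 len \<and> wf_exp 20 e"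
  shows "\<exists>c'. \<forall>L w \<sigma> \<mu>'. 2 \<le> L \<longrightarrow> L ^ c' < 2 ^ w \<longrightarrow> ready L \<sigma> \<longrightarrow> steps L (mem \<sigma>) ps \<mu>' \<longrightarrow>
    runs w (prog ps) \<sigma> (L ^ c') (\<lambda>\<sigma>'. ready L \<sigma>' \<and> mem \<sigma>' = \<mu>')"
  using assms
proof (induction ps)
  case Nil
  have "runs w Skip \<sigma> 1 (\<lambda>\<sigma>'. ready L \<sigma>' \<and> mem \<sigma>' = mem \<sigma>)" if "ready L \<sigma>" for w \<sigma> L
    using that unfolding runs_def by (intro exI[of _ 1] exI[of _ \<sigma>]) (use exec.Skip[of w \<sigma>] in simp)
  then show ?case by (intro exI[of _ 0]) auto
next
  case (Cons p ps)
  obtain A len e where p: "p = (A, len, e)" by (cases p)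
  have wf: "\<forall>(A, len, e)\<in>set ps. wf_exp 20 len \<and> wf_exp 20 e" "wf_exp 20 len" "wf_exp 20 e"
    using Cons.prems p by auto
  obtain c1 where c1: "\<And>L w \<sigma> \<mu>'. 2 \<le> L \<Longrightarrow> L ^ c1 < 2 ^ w \<Longrightarrow> ready L \<sigma> \<Longrightarrow> steps L (mem \<sigma>) ps \<mu>' \<Longrightarrow>
    runs w (prog ps) \<sigma> (L ^ c1) (\<lambda>\<sigma>'. ready L \<sigma>' \<and> mem \<sigma>' = \<mu>')"
    using Cons.IH[OF wf(1)] by blast
  obtain c2 where c2: "\<And>L w \<sigma> n f. 2 \<le> L \<Longrightarrow> L ^ c2 < 2 ^ w \<Longrightarrow> ready L \<sigma> \<Longrightarrow> step L (mem \<sigma>) A len e n f \<Longrightarrow>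
    runs w (fill A len e) \<sigma> (L ^ c2) (\<lambda>\<sigma>'. ready L \<sigma>' \<and> mem \<sigma>' = put L A n f (mem \<sigma>))"
    using fill_runs[OF wf(2,3), of A] by blast
  have "runs w (prog (p # ps)) \<sigma> (L ^ (c1 + c2 + 1)) (\<lambda>\<sigma>'. ready L \<sigma>' \<and> mem \<sigma>' = \<mu>')"
    if L: "2 \<le> L" "L ^ (c1 + c2 + 1) < 2 ^ w" and r: "ready L \<sigma>" "steps L (mem \<sigma>) (p # ps) \<mu>'" for L w \<sigma> \<mu>'
  proof -
    obtain n f where s: "step L (mem \<sigma>) A len e n f" "steps L (put L A n f (mem \<sigma>)) ps \<mu>'"
      using r p by auto
    have "L ^ c1 \<le> L ^ (c1 + c2 + 1)" "L ^ c2 \<le> L ^ (c1 + c2 + 1)" using L by (intro power_increasing; simp)+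
    then have w: "L ^ c1 < 2 ^ w" "L ^ c2 < 2 ^ w" using L by linarith+
    have "runs w (prog (p # ps)) \<sigma> (L ^ c2 + L ^ c1) (\<lambda>\<sigma>'. ready L \<sigma>' \<and> mem \<sigma>' = \<mu>')"
      unfolding p prog.simps
      by (intro runs_Seq runs_weaken[OF c2[OF L(1) w(2) r(1) s(1)] order_refl] c1 L w) (use s in auto)
    moreover have "L ^ c2 + L ^ c1 \<le> L ^ (c1 + c2 + 1)" by (rule pow_add_bound[OF L(1) order_refl order_refl]) auto
    ultimately show ?thesis by (rule runs_weaken)
  qed
  then show ?case by blast
qed

section \<open>Expressions for the tables\<close>

definition Arr :: "nat \<Rightarrow> exp \<Rightarrow> exp" where
  "Arr A e = Mem (Bin Add (Bin Mul (Num A) (Var 0)) e)"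

definition IEq :: "exp \<Rightarrow> exp \<Rightarrow> exp \<Rightarrow> exp \<Rightarrow> exp" where
  "IEq a b c d = ILt a b d (ILt b a d c)"

text \<open>The inner sum is zero exactly if nothing up to the current \<open>v\<close> satisfies
  \<open>e\<close>; counting such \<open>v\<close> below \<open>b\<close> is
  \<open>least_upto\<close>.\<close>

definition Least_exp :: "nat \<Rightarrow> nat \<Rightarrow> exp \<Rightarrow> exp \<Rightarrow> exp" where
  "Least_exp v u b e = Sum v b (ILt (Sum u (Bin Add (Var v) (Num 1)) e) (Num 1) (Num 1) (Num 0))"

abbreviation "add \<equiv> Bin Add"
abbreviation "sub \<equiv> Bin Sub"
abbreviation "mul \<equiv> Bin Mul"
abbreviation "quot \<equiv> Bin Div"
abbreviation "rem \<equiv> Bin Mod"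
abbreviation "shr \<equiv> Bin Shr"

lemma eval_Arr [simp]: "eval (Arr A e) \<rho> \<mu> = cell (\<rho> 0) \<mu> A (eval e \<rho> \<mu>)"
  by (simp add: Arr_def cell_def)

lemma eval_IEq [simp]:
  "eval (IEq a b c d) \<rho> \<mu> = (if eval a \<rho> \<mu> = eval b \<rho> \<mu> then eval c \<rho> \<mu> else eval d \<rho> \<mu>)"
  by (simp add: IEq_def)

lemma wf_Arr [simp]: "0 < r \<Longrightarrow> wf_exp r (Arr A e) \<longleftrightarrow> wf_exp r e"
  by (simp add: Arr_def)

lemma wf_IEq [simp]: "wf_exp r (IEq a b c d) \<longleftrightarrow> wf_exp r a \<and> wf_exp r b \<and> wf_exp r c \<and> wf_exp r d"
  by (auto simp: IEq_def)

lemma wf_Least [simp]: "wf_exp r (Least_exp v u b e) \<longleftrightarrow> v < r \<and> u < r \<and> wf_exp r b \<and> wf_exp r e"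
  by (auto simp: Least_exp_def)

lemma sum_eq_card:
  fixes n :: nat
  shows "(\<Sum>i<n. if P i then (1::nat) else 0) = card {i. i < n \<and> P i}"
proof -
  have "card {i \<in> {..<n}. P i} = (\<Sum>i\<in>{i \<in> {..<n}. P i}. 1)" by simp
  also have "\<dots> = (\<Sum>i<n. if P i then 1 else 0)" by (rule sum.inter_filter) simp
  finally show ?thesis by simp
qed

lemma eval_Least:
  assumes "eval b \<rho> \<mu> = B" "u \<noteq> v"
    and "\<And>i j. j < B \<Longrightarrow> 0 < eval e (\<rho>(v := i, u := j)) \<mu> \<longleftrightarrow> P j"
  shows "eval (Least_exp v u b e) \<rho> \<mu> = least_upto B P"
proof -
  have "(\<Sum>j<Suc i. eval e (\<rho>(v := i, u := j)) \<mu>) < 1 \<longleftrightarrow> (\<forall>j\<le>i. \<not> P j)" if "i < B" for i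
  proof -
    have "(\<Sum>j<Suc i. eval e (\<rho>(v := i, u := j)) \<mu>) < 1 \<longleftrightarrow> (\<forall>j<Suc i. \<not> 0 < eval e (\<rho>(v := i, u := j)) \<mu>)"
      by (simp only: less_one sum_eq_0_iff finite_lessThan lessThan_iff Ball_def not_gr_zero)
    also have "\<dots> \<longleftrightarrow> (\<forall>j\<le>i. \<not> P j)" using assms(3) that by (simp add: less_Suc_eq_le)
    finally show ?thesis .
  qed
  then have "(\<Sum>i<B. if (\<Sum>j<Suc i. eval e (\<rho>(v := i, u := j)) \<mu>) < 1 then 1 else 0) =
    (\<Sum>i<B. if \<forall>j\<le>i. \<not> P j then (1::nat) else 0)" by (intro sum.cong) auto
  then show ?thesis unfolding Least_exp_def least_upto_def sum_eq_card[symmetric] using assms(1,2)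
    by (simp del: sum.lessThan_Suc less_one cong: if_cong)
qed

section \<open>Expressions for the reachability thresholds\<close>

definition k_exp :: exp where "k_exp = Mem (Num 4)"

text \<open>Array 4 holds the reachability relation \<open>\<rho>\<close> between positions.\<close>

definition reach_exp :: "exp \<Rightarrow> exp \<Rightarrow> exp \<Rightarrow> exp" where
  "reach_exp x i j = Arr 4 (add (mul (add (mul x k_exp) i) k_exp) j)"

lemma wf_k_exp [simp]: "wf_exp r k_exp"
  by (simp add: k_exp_def)

lemma wf_reach_exp [simp]: "0 < r \<Longrightarrow> wf_exp r (reach_exp x i j) \<longleftrightarrow> wf_exp r x \<and> wf_exp r i \<and> wf_exp r j"
  by (auto simp: reach_exp_def)

definition low_exp :: exp where
  "low_exp = ILt (add (Var 1) (Num 1)) k_exp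
    (Least_exp 2 3 (Var 1) (reach_exp (add (Var 1) (Num 1)) (Var 1) (Var 3))) (Num 0)"

text \<open>The same array serves the reversed chain: position \<open>i\<close> is read as
  \<open>k - Suc i\<close>, and the ends of the path are exchanged.\<close>

definition low_rev_exp :: exp where
  "low_rev_exp = ILt (add (Var 1) (Num 1)) k_exp
    (Least_exp 2 3 (Var 1) (reach_exp (sub k_exp (add (Var 1) (Num 2))) (sub k_exp (add (Var 3) (Num 1)))
      (sub k_exp (add (Var 1) (Num 1))))) (Num 0)"

definition landing_exp :: exp where
  "landing_exp = Least_exp 2 3 (Var 1) (Sum 4 (Var 1)
    (ILt (Var 3) (Var 4) (ILt (Num 0) (reach_exp (Var 4) (Var 1) (Var 3))
      (ILt (Sum 5 (sub (Var 1) (add (Var 4) (Num 1)))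
          (reach_exp (Var 4) (Var 1) (add (add (Var 4) (Num 1)) (Var 5)))) (Num 1)
        (ILt (Sum 5 (sub (Var 4) (add (Var 3) (Num 1)))
            (reach_exp (Var 4) (add (add (Var 3) (Num 1)) (Var 5)) (Var 3))) (Num 1) (Num 1) (Num 0))
        (Num 0)) (Num 0)) (Num 0)))"

text \<open>Sums start at 0, so the positions strictly between \<open>a\<close> and \<open>b\<close>
  are enumerated as \<open>Suc (a + u)\<close>.\<close>

lemma all_between_iff:
  fixes P :: "nat \<Rightarrow> bool"
  shows "(\<forall>u<b - Suc a. P (Suc (a + u))) \<longleftrightarrow> (\<forall>l\<in>{a<..<b}. P l)"
proof (intro iffI ballI allI impI)
  fix l assume a: "\<forall>u<b - Suc a. P (Suc (a + u))" and l: "l \<in> {a<..<b}"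
  have "P (Suc (a + (l - Suc a)))" by (rule a[rule_format]) (use l in auto)
  then show "P l" using l by simp
qed auto

definition rev_rel :: "nat \<Rightarrow> (nat \<Rightarrow> nat \<Rightarrow> nat \<Rightarrow> bool) \<Rightarrow> nat \<Rightarrow> nat \<Rightarrow> nat \<Rightarrow> bool" where
  "rev_rel k \<rho> x i j \<longleftrightarrow> x < k \<and> i < k \<and> j < k \<and> \<rho> (k - Suc x) (k - Suc j) (k - Suc i)"

text \<open>At the last position \<open>low\<close> would delete the nonexistent position
  \<open>k\<close>. Queried ranges end at some \<open>x < k\<close> exclusively and never reach this
  default.\<close>

definition low_on :: "nat \<Rightarrow> (nat \<Rightarrow> nat \<Rightarrow> nat \<Rightarrow> bool) \<Rightarrow> nat \<Rightarrow> nat" where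
  "low_on k \<rho> a = (if Suc a < k then chain.low \<rho> a else 0)"

locale reach_memory = chain k R for k R +
  fixes L :: nat and \<mu> :: "nat \<Rightarrow> nat"
  assumes k: "\<mu> 4 = k"
    and reach: "x < k \<Longrightarrow> i < k \<Longrightarrow> j < k \<Longrightarrow> cell L \<mu> 4 ((x * k + i) * k + j) = of_bool (R x i j)"
begin

lemma eval_k [simp]: "eval k_exp \<rho> \<mu> = k"
  by (simp add: k_exp_def k)

lemma eval_reach:
  assumes "\<rho> 0 = L" "eval x \<rho> \<mu> < k" "eval i \<rho> \<mu> < k" "eval j \<rho> \<mu> < k"
  shows "eval (reach_exp x i j) \<rho> \<mu> = of_bool (R (eval x \<rho> \<mu>) (eval i \<rho> \<mu>) (eval j \<rho> \<mu>))"
  using assms by (simp add: reach_exp_def reach)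

lemma eval_low:
  assumes "\<rho> 0 = L" "\<rho> 1 = a"
  shows "eval low_exp \<rho> \<mu> = low_on k R a"
proof (cases "Suc a < k")
  case True
  have "eval (Least_exp 2 3 (Var 1) (reach_exp (add (Var 1) (Num 1)) (Var 1) (Var 3))) \<rho> \<mu> = least_upto a (R (Suc a) a)"
    by (rule eval_Least) (use assms True in \<open>auto simp: eval_reach\<close>)
  then show ?thesis using assms True by (simp add: low_exp_def low_on_def low_def)
qed (use assms in \<open>simp add: low_exp_def low_on_def\<close>)

lemma eval_low_rev:
  assumes "\<rho> 0 = L" "\<rho> 1 = a"
  shows "eval low_rev_exp \<rho> \<mu> = low_on k (rev_rel k R) a"
proof (cases "Suc a < k")
  case True
  interpret rev: chain k "rev_rel k R" unfolding rev_rel_def using chain_reverse[OF chain_axioms] .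
  have "eval (Least_exp 2 3 (Var 1) (reach_exp (sub k_exp (add (Var 1) (Num 2))) (sub k_exp (add (Var 3) (Num 1)))
      (sub k_exp (add (Var 1) (Num 1))))) \<rho> \<mu> = least_upto a (rev_rel k R (Suc a) a)"
    by (rule eval_Least) (use assms True in \<open>auto simp: eval_reach rev_rel_def numeral_2_eq_2\<close>)
  then show ?thesis using assms True by (simp add: low_rev_exp_def low_on_def rev.low_def)
qed (use assms in \<open>simp add: low_rev_exp_def low_on_def\<close>)

lemma eval_landing:
  assumes "\<rho> 0 = L" "\<rho> 1 = a" "a < k"
  shows "eval landing_exp \<rho> \<mu> = landing a"
  unfolding landing_exp_def landing_def
proof (rule eval_Least)
  fix i d assume d: "d < a"
  define \<rho>' where "\<rho>' = \<rho>(2 := i, 3 := d)"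
  have \<rho>': "\<rho>' 0 = L" "\<rho>' (Suc 0) = a" "\<rho>' 3 = d" using assms by (simp_all add: \<rho>'_def)
  let ?A = "Sum 5 (sub (Var 1) (add (Var 4) (Num 1))) (reach_exp (Var 4) (Var 1) (add (add (Var 4) (Num 1)) (Var 5)))"
  let ?B = "Sum 5 (sub (Var 4) (add (Var 3) (Num 1))) (reach_exp (Var 4) (add (add (Var 3) (Num 1)) (Var 5)) (Var 3))"
  have e: "eval (ILt (Var 3) (Var 4) (ILt (Num 0) (reach_exp (Var 4) (Var 1) (Var 3))
      (ILt ?A (Num 1) (ILt ?B (Num 1) (Num 1) (Num 0)) (Num 0)) (Num 0)) (Num 0)) (\<rho>'(4 := x)) \<mu> = of_bool (jump a x d)"
    if x: "x < a" for x
  proof (cases "d < x")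
    case True
    have "eval ?A (\<rho>'(4 := x)) \<mu> = (\<Sum>u<a - Suc x. of_bool (R x a (Suc (x + u))))"
      unfolding eval.simps(6) by (rule sum.cong) (use assms x \<rho>' in \<open>auto simp: eval_reach\<close>)
    then have s1: "eval ?A (\<rho>'(4 := x)) \<mu> = 0 \<longleftrightarrow> (\<forall>a'\<in>{x<..<a}. \<not> R x a a')"
      unfolding all_between_iff[symmetric] by auto
    have "eval ?B (\<rho>'(4 := x)) \<mu> = (\<Sum>u<x - Suc d. of_bool (R x (Suc (d + u)) d))"
      unfolding eval.simps(6) by (rule sum.cong) (use assms x d \<rho>' in \<open>auto simp: eval_reach\<close>)
    then have s2: "eval ?B (\<rho>'(4 := x)) \<mu> = 0 \<longleftrightarrow> (\<forall>d'\<in>{d<..<x}. \<not> R x d' d)"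
      unfolding all_between_iff[symmetric] by auto
    have s3: "eval (reach_exp (Var 4) (Var 1) (Var 3)) (\<rho>'(4 := x)) \<mu> = of_bool (R x a d)"
      using assms x d \<rho>' by (simp add: eval_reach)
    show ?thesis using True x \<rho>' s1 s2 s3 by (simp add: jump_def del: eval.simps(6) cong: if_cong)
  next
    case False
    then show ?thesis using \<rho>' by (simp add: jump_def)
  qed
  let ?J = "ILt (Var 3) (Var 4) (ILt (Num 0) (reach_exp (Var 4) (Var 1) (Var 3))
      (ILt ?A (Num 1) (ILt ?B (Num 1) (Num 1) (Num 0)) (Num 0)) (Num 0)) (Num 0)"
  have "eval (Sum 4 (Var 1) ?J) \<rho>' \<mu> = (\<Sum>x<a. of_bool (jump a x d))"
    unfolding eval.simps(6)
  proof (rule sum.cong)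
    show "{..<eval (Var 1) \<rho>' \<mu>} = {..<a}" using \<rho>' by simp
    fix x assume "x \<in> {..<a}"
    then show "eval ?J (\<rho>'(4 := x)) \<mu> = of_bool (jump a x d)" by (intro e) simp
  qed
  moreover have "0 < (\<Sum>x<a. of_bool (jump a x d) :: nat) \<longleftrightarrow> (\<exists>x<a. jump a x d)"
  proof -
    have "(\<Sum>x<a. of_bool (jump a x d) :: nat) = 0 \<longleftrightarrow> \<not> (\<exists>x<a. jump a x d)" by auto
    then show ?thesis by (metis gr0I less_irrefl)
  qed
  ultimately show "0 < eval (Sum 4 (Var 1) ?J) (\<rho>(2 := i, 3 := d)) \<mu> \<longleftrightarrow> (\<exists>x<a. jump a x d)"
    unfolding \<rho>'_def[symmetric] by simp
qed (use assms in auto)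

end

section \<open>Expressions for the range minimum tables\<close>

definition b_exp :: exp where "b_exp = Arr 22 (Num 0)"

definition bits_exp :: exp where
  "bits_exp = Sum 2 k_exp (ILt (Num 0) (shr k_exp (Var 2)) (Num 1) (Num 0))"

definition pow_exp :: exp where
  "pow_exp = ILt (Var 1) (Num 1) (Num 1) (mul (Num 2) (Arr 28 (sub (Var 1) (Num 1))))"

definition lowest_exp :: exp where
  "lowest_exp = Least_exp 2 3 b_exp (rem (shr (Var 1) (Var 3)) (Num 2))"

definition level_exp :: exp where
  "level_exp = Sum 2 b_exp (ILt (Num 0) (shr (Var 1) (add (Var 2) (Num 1))) (Num 1) (Num 0))"

definition mask_exp :: "nat \<Rightarrow> exp" where
  "mask_exp D = Sum 2 b_exp (LetE 3 (add (mul (quot (Var 1) b_exp) b_exp) (Var 2))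
    (ILt (Var 1) (Var 3) (Num 0)
      (ILt (Sum 4 (sub (Var 1) (Var 3))
          (ILt (Arr D (Var 3)) (Arr D (add (add (Var 3) (Num 1)) (Var 4))) (Num 0) (Num 1))) (Num 1)
        (Arr 28 (Var 2)) (Num 0))))"

text \<open>The sum of \<open>rmin\<close>, with \<open>is_rmin\<close> tested by counting
  violations in the inner sum. The second binding of variable 3 caps the right end at
  \<open>k\<close>.\<close>

definition sparse_exp :: "nat \<Rightarrow> exp" where
  "sparse_exp D = LetE 2 (mul (quot (Var 1) b_exp) b_exp)
    (LetE 3 (add (Var 2) (mul (Arr 28 (rem (Var 1) b_exp)) b_exp))
    (LetE 3 (ILt (Var 3) k_exp (Var 3) k_exp)
      (Sum 4 (Var 3) (ILt (Var 4) (Var 2) (Num 0)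
        (ILt (Sum 5 (Var 3) (ILt (Var 5) (Var 2) (Num 0)
            (ILt (Var 4) (Var 5) (ILt (Arr D (Var 4)) (Arr D (Var 5)) (Num 0) (Num 1))
              (ILt (Arr D (Var 5)) (Arr D (Var 4)) (Num 1) (Num 0))))) (Num 1) (Var 4) (Num 0))))))"

lemma wf_b_exp [simp]: "0 < r \<Longrightarrow> wf_exp r b_exp"
  by (simp add: b_exp_def)

lemma eval_bits: "\<mu> 4 = k \<Longrightarrow> eval bits_exp \<rho> \<mu> = bits k"
  by (simp add: bits_exp_def k_exp_def bits_def sum_eq_card[symmetric] cong: if_cong)

lemma eval_pow:
  assumes "\<rho> 0 = L" "\<rho> 1 = i" "\<And>j. j < i \<Longrightarrow> cell L \<mu> 28 j = 2 ^ j"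
  shows "eval pow_exp \<rho> \<mu> = 2 ^ i"
  using assms by (cases i) (auto simp: pow_exp_def)

lemma eval_lowest:
  assumes "\<rho> 0 = L" "\<rho> 1 = v" "cell L \<mu> 22 0 = b"
  shows "eval lowest_exp \<rho> \<mu> = lowest_bit b v"
  unfolding lowest_exp_def lowest_bit_def
  by (rule eval_Least) (use assms in \<open>auto simp: b_exp_def odd_iff_mod_2_eq_one\<close>)

lemma eval_level:
  assumes "\<rho> 0 = L" "\<rho> 1 = v" "cell L \<mu> 22 0 = b"
  shows "eval level_exp \<rho> \<mu> = level b v"
  using assms by (simp add: level_exp_def b_exp_def level_def sum_eq_card[symmetric] cong: if_cong)

lemma eval_mask:
  assumes \<rho>: "\<rho> 0 = L" "\<rho> 1 = j" "cell L \<mu> 22 0 = b" and j: "j < k"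
    and D: "\<And>i. i < k \<Longrightarrow> cell L \<mu> D i = d i" and p: "\<And>i. i < b \<Longrightarrow> cell L \<mu> 28 i = 2 ^ i"
  shows "eval (mask_exp D) \<rho> \<mu> = block_mask b d j"
proof -
  let ?S = "Sum 4 (sub (Var 1) (Var 3)) (ILt (Arr D (Var 3)) (Arr D (add (add (Var 3) (Num 1)) (Var 4))) (Num 0) (Num 1))"
  have at: "eval ?S (\<rho>(2 := o', 3 := s)) \<mu> = 0 \<longleftrightarrow> (\<forall>u<j - s. d s < d (s + 1 + u))" if "s \<le> j" for s o'
  proof -
    have "eval ?S (\<rho>(2 := o', 3 := s)) \<mu> = (\<Sum>u<j - s. if d s < d (s + 1 + u) then 0 else 1)"
      unfolding eval.simps(6) by (rule sum.cong) (use \<rho> j that in \<open>auto simp: D\<close>)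
    then show ?thesis by auto
  qed
  show ?thesis
    unfolding mask_exp_def block_mask_def eval.simps(6)
  proof (rule sum.cong)
    show "{..<eval b_exp \<rho> \<mu>} = {..<b}" using \<rho> by (simp add: b_exp_def)
    fix o' assume "o' \<in> {..<b}"
    then have o': "cell L \<mu> 28 o' = 2 ^ o'" using p by simp
    define s where "s = j div b * b + o'"
    have "eval (add (mul (quot (Var 1) b_exp) b_exp) (Var 2)) (\<rho>(2 := o')) \<mu> = s"
      using \<rho> by (simp add: b_exp_def s_def)
    then show "eval (LetE 3 (add (mul (quot (Var 1) b_exp) b_exp) (Var 2))
      (ILt (Var 1) (Var 3) (Num 0)
        (ILt (Sum 4 (sub (Var 1) (Var 3))
            (ILt (Arr D (Var 3)) (Arr D (add (add (Var 3) (Num 1)) (Var 4))) (Num 0) (Num 1))) (Num 1)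
          (Arr 28 (Var 2)) (Num 0)))) (\<rho>(2 := o')) \<mu> = (if mask_at b d j o' then 2 ^ o' else 0)"
      unfolding mask_at_def s_def[symmetric]
      using \<rho> o' at[of s o'] by (simp del: eval.simps(6) cong: if_cong)
  qed
qed

text \<open>One uniform test for every \<open>j\<close> of the range, as the inner sum of
  \<open>sparse_exp\<close> performs it. At \<open>j = i\<close> it compares
  \<open>d i < d i\<close> and finds no violation.\<close>

lemma is_rmin_iff:
  assumes "i < hi" "lo \<le> i"
  shows "is_rmin d lo hi i \<longleftrightarrow> (\<forall>j<hi. \<not> (lo \<le> j \<and> (if i < j then d j \<le> d i else d j < d i)))"
proof
  assume "is_rmin d lo hi i"
  then show "\<forall>j<hi. \<not> (lo \<le> j \<and> (if i < j then d j \<le> d i else d j < d i))"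
    unfolding is_rmin_def by (metis atLeastLessThan_iff greaterThanLessThan_iff linorder_not_less nat_neq_iff)
next
  assume a: "\<forall>j<hi. \<not> (lo \<le> j \<and> (if i < j then d j \<le> d i else d j < d i))"
  have "d i \<le> d j" if "j \<in> {lo..<i}" for j using a[rule_format, of j] that assms by auto
  moreover have "d i < d j" if "j \<in> {i<..<hi}" for j using a[rule_format, of j] that assms by auto
  ultimately show "is_rmin d lo hi i" using assms by (simp add: is_rmin_def)
qed

lemma eval_sparse:
  assumes \<rho>: "\<rho> 0 = L" "\<rho> 1 = q" "cell L \<mu> 22 0 = b" "\<mu> 4 = k" and b: "0 < b"
    and D: "\<And>i. i < k \<Longrightarrow> cell L \<mu> D i = d i" and p: "\<And>i. i < b \<Longrightarrow> cell L \<mu> 28 i = 2 ^ i"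
  shows "eval (sparse_exp D) \<rho> \<mu> = sparse k b d q"
proof -
  define lo hi where "lo = q div b * b" and "hi = min k (q div b * b + 2 ^ (q mod b) * b)"
  let ?e = "ILt (Var 5) (Var 2) (Num 0)
            (ILt (Var 4) (Var 5) (ILt (Arr D (Var 4)) (Arr D (Var 5)) (Num 0) (Num 1))
              (ILt (Arr D (Var 5)) (Arr D (Var 4)) (Num 1) (Num 0)))"
  have at: "(\<Sum>j<hi. eval ?e (\<rho>(2 := lo, 3 := hi, 4 := i, 5 := j)) \<mu>) = 0 \<longleftrightarrow> is_rmin d lo hi i" if i: "i < hi" "lo \<le> i" for i
  proof -
    have "(\<Sum>j<hi. eval ?e (\<rho>(2 := lo, 3 := hi, 4 := i, 5 := j)) \<mu>) =
      (\<Sum>j<hi. if lo \<le> j \<and> (if i < j then d j \<le> d i else d j < d i) then 1 else 0)"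
      by (rule sum.cong) (use i \<rho> in \<open>auto simp: D hi_def\<close>)
    moreover have "(\<Sum>j<hi. if lo \<le> j \<and> (if i < j then d j \<le> d i else d j < d i) then 1 else 0) = (0::nat)
      \<longleftrightarrow> (\<forall>j<hi. \<not> (lo \<le> j \<and> (if i < j then d j \<le> d i else d j < d i)))"
      by (simp only: sum_eq_card) auto
    ultimately show ?thesis using is_rmin_iff[OF i] by simp
  qed
  have "eval (sparse_exp D) \<rho> \<mu> = (\<Sum>i<hi. if i < lo then 0 else
    if (\<Sum>j<hi. eval ?e (\<rho>(2 := lo, 3 := hi, 4 := i, 5 := j)) \<mu>) < 1 then i else 0)"
  proof -
    have m: "(if x < k then x else k) = min k x" for x by auto
    have [simp]: "cell L \<mu> 28 (q mod b) = 2 ^ (q mod b)" using b by (intro p) simp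
    show ?thesis using \<rho> unfolding sparse_exp_def lo_def hi_def
      by (simp add: b_exp_def k_exp_def m del: less_one cong: if_cong)
  qed
  also have "\<dots> = (\<Sum>i<hi. if is_rmin d lo hi i then i else 0)"
    by (rule sum.cong) (use at in \<open>auto simp: is_rmin_def\<close>)
  finally show ?thesis by (simp add: sparse_def rmin_def lo_def hi_def)
qed


section \<open>Expressions for the dictionary\<close>

definition n_exp :: exp where "n_exp = Mem (Num 0)"
definition m_exp :: exp where "m_exp = Mem (Num 1)"
definition s_exp :: exp where "s_exp = Mem (Num 2)"

text \<open>In the input, the list of cut-vertices follows 5 header words and two words per
  arc.\<close>

definition key_exp :: "exp \<Rightarrow> exp" where
  "key_exp e = Mem (add (add (Num 5) (mul (Num 2) m_exp)) e)"

definition hash_exp :: "exp \<Rightarrow> exp \<Rightarrow> exp \<Rightarrow> exp \<Rightarrow> exp" where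
  "hash_exp n a r x = quot (rem (mul a x) (mul n r)) n"

lemma eval_hash [simp]:
  "eval (hash_exp n a r x) \<rho> \<mu> = hash (eval n \<rho> \<mu>) (eval a \<rho> \<mu>) (eval r \<rho> \<mu>) (eval x \<rho> \<mu>)"
  by (simp add: hash_exp_def hash_def)

lemma wf_key_exps [simp]:
  "wf_exp r n_exp" "wf_exp r m_exp" "wf_exp r s_exp" "wf_exp r (key_exp e) \<longleftrightarrow> wf_exp r e"
  "wf_exp r (hash_exp n a b x) \<longleftrightarrow> wf_exp r n \<and> wf_exp r a \<and> wf_exp r b \<and> wf_exp r x"
  by (auto simp: n_exp_def m_exp_def s_exp_def key_exp_def hash_exp_def)

text \<open>The bucket function \<open>g\<close> is a parameter so that both hash levels share the
  expression; the first level passes the constant 0, which makes every key a member.\<close>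

definition coll_exp :: "(exp \<Rightarrow> exp) \<Rightarrow> exp \<Rightarrow> exp \<Rightarrow> exp" where
  "coll_exp g b r = Sum 4 k_exp (Sum 5 k_exp (IEq (g (Var 4)) b (IEq (g (Var 5)) b
    (IEq (Var 4) (Var 5) (Num 0) (IEq (hash_exp n_exp (Var 3) r (key_exp (Var 4)))
      (hash_exp n_exp (Var 3) r (key_exp (Var 5))) (Num 1) (Num 0))) (Num 0)) (Num 0)))"

definition mult_exp :: "(exp \<Rightarrow> exp) \<Rightarrow> exp \<Rightarrow> exp \<Rightarrow> exp \<Rightarrow> exp" where
  "mult_exp g b r c = Least_exp 2 3 (mul n_exp r)
    (ILt (mul (Num 9) (mul c (sub c (Num 1)))) (mul (coll_exp g b r) r) (Num 0) (Num 1))"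

definition first_exp :: exp where
  "first_exp = mult_exp (\<lambda>_. Num 0) (Num 0) k_exp k_exp"

definition bucket_exp :: exp where
  "bucket_exp = hash_exp n_exp (Arr 23 (Num 0)) k_exp (key_exp (Var 1))"

definition count_exp :: exp where
  "count_exp = Sum 3 k_exp (IEq (Arr 6 (Var 3)) (Var 1) (Num 1) (Num 0))"

definition width_exp :: exp where
  "width_exp = LetE 2 count_exp (mul (Num 9) (mul (Var 2) (Var 2)))"

definition offset_exp :: exp where
  "offset_exp = Sum 2 (Var 1) (Arr 25 (Var 2))"

definition factor_exp :: exp where
  "factor_exp = LetE 6 count_exp (mult_exp (Arr 6) (Var 1) (Arr 25 (Var 1)) (Var 6))"

definition slot_exp :: exp where
  "slot_exp = LetE 2 (Arr 6 (Var 1)) (add (Arr 24 (Var 2))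
    (hash_exp n_exp (Arr 26 (Var 2)) (Arr 25 (Var 2)) (key_exp (Var 1))))"

definition table_exp :: exp where
  "table_exp = Sum 2 k_exp (IEq (Arr 7 (Var 2)) (Var 1) (Arr 2 (Var 2)) (Num 0))"

lemma collisions_eq_sum:
  fixes k :: nat
  shows "collisions n {i. i < k \<and> P i} f r a = (\<Sum>i<k. \<Sum>j<k.
    if P i \<and> P j \<and> i \<noteq> j \<and> hash n a r (f i) = hash n a r (f j) then 1 else 0)"
proof -
  let ?Q = "\<lambda>i j. P i \<and> P j \<and> i \<noteq> j \<and> hash n a r (f i) = hash n a r (f j)"
  have "{(i, j). i \<in> {i. i < k \<and> P i} \<and> j \<in> {i. i < k \<and> P i} \<and> i \<noteq> j \<and> hash n a r (f i) = hash n a r (f j)} =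
    (SIGMA i:{..<k}. {j. j < k \<and> ?Q i j})" by auto
  then show ?thesis unfolding collisions_def by (simp add: sum_eq_card)
qed

locale key_memory = dictionary n k f g for n k f g +
  fixes L :: nat and \<mu> :: "nat \<Rightarrow> nat"
  assumes n: "\<mu> 0 = n" and k: "\<mu> 4 = k" and key: "j < k \<Longrightarrow> \<mu> (5 + 2 * \<mu> 1 + j) = f j"
begin

lemma eval_n [simp]: "eval n_exp \<rho> \<mu> = n"
  by (simp add: n_exp_def n)

lemma eval_k [simp]: "eval k_exp \<rho> \<mu> = k"
  by (simp add: k_exp_def k)

lemma eval_key: "eval e \<rho> \<mu> < k \<Longrightarrow> eval (key_exp e) \<rho> \<mu> = f (eval e \<rho> \<mu>)"
  using key by (simp add: key_exp_def m_exp_def)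

lemma eval_coll:
  assumes "\<And>\<rho>' v. \<rho>' 0 = \<rho> 0 \<Longrightarrow> \<rho>' v < k \<Longrightarrow> eval (h (Var v)) \<rho>' \<mu> = G (\<rho>' v)"
    and "\<And>\<rho>'. \<rho>' 0 = \<rho> 0 \<Longrightarrow> \<rho>' 1 = \<rho> 1 \<Longrightarrow> \<rho>' 6 = \<rho> 6 \<Longrightarrow> eval b \<rho>' \<mu> = bv"
    and "\<And>\<rho>'. \<rho>' 0 = \<rho> 0 \<Longrightarrow> \<rho>' 1 = \<rho> 1 \<Longrightarrow> \<rho>' 6 = \<rho> 6 \<Longrightarrow> eval r \<rho>' \<mu> = rv"
  shows "eval (coll_exp h b r) \<rho> \<mu> = collisions n {i. i < k \<and> G i = bv} f rv (\<rho> 3)"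
  unfolding coll_exp_def collisions_eq_sum eval.simps(6) eval_k
proof (intro sum.cong refl)
  fix i j assume ij: "i \<in> {..<k}" "j \<in> {..<k}"
  let ?\<rho> = "\<rho>(4 := i, 5 := j)"
  have "eval (h (Var 4)) ?\<rho> \<mu> = G (?\<rho> 4)" "eval (h (Var 5)) ?\<rho> \<mu> = G (?\<rho> 5)"
    "eval b ?\<rho> \<mu> = bv" "eval r ?\<rho> \<mu> = rv"
    "eval (key_exp (Var 4)) ?\<rho> \<mu> = f i" "eval (key_exp (Var 5)) ?\<rho> \<mu> = f j"
    by (rule assms; use ij in simp)+ (use ij in \<open>simp_all add: eval_key\<close>)
  then show "eval (IEq (h (Var 4)) b (IEq (h (Var 5)) b
    (IEq (Var 4) (Var 5) (Num 0) (IEq (hash_exp n_exp (Var 3) r (key_exp (Var 4)))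
      (hash_exp n_exp (Var 3) r (key_exp (Var 5))) (Num 1) (Num 0))) (Num 0)) (Num 0)) ?\<rho> \<mu> =
    (if G i = bv \<and> G j = bv \<and> i \<noteq> j \<and> hash n (\<rho> 3) rv (f i) = hash n (\<rho> 3) rv (f j) then 1 else 0)"
    by simp
qed

text \<open>The search and the counting overwrite variables 2 to 5, so the arguments may rely on
  registers 0, 1 and 6 only. For this reason \<open>factor_exp\<close> keeps the bucket size in
  variable 6.\<close>

lemma eval_mult:
  assumes h: "\<And>\<rho>' v. \<rho>' 0 = \<rho> 0 \<Longrightarrow> \<rho>' v < k \<Longrightarrow> eval (h (Var v)) \<rho>' \<mu> = G (\<rho>' v)"
    and b: "\<And>\<rho>'. \<rho>' 0 = \<rho> 0 \<Longrightarrow> \<rho>' 1 = \<rho> 1 \<Longrightarrow> \<rho>' 6 = \<rho> 6 \<Longrightarrow> eval b \<rho>' \<mu> = bv"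
    and r: "\<And>\<rho>'. \<rho>' 0 = \<rho> 0 \<Longrightarrow> \<rho>' 1 = \<rho> 1 \<Longrightarrow> \<rho>' 6 = \<rho> 6 \<Longrightarrow> eval r \<rho>' \<mu> = rv"
    and c: "\<And>\<rho>'. \<rho>' 0 = \<rho> 0 \<Longrightarrow> \<rho>' 1 = \<rho> 1 \<Longrightarrow> \<rho>' 6 = \<rho> 6 \<Longrightarrow> eval c \<rho>' \<mu> = card {i. i < k \<and> G i = bv}"
  shows "eval (mult_exp h b r c) \<rho> \<mu> = multiplier n {i. i < k \<and> G i = bv} f rv"
  unfolding mult_exp_def multiplier_def
proof (rule eval_Least)
  show "eval (mul n_exp r) \<rho> \<mu> = n * rv" using r[of \<rho>] by simp
  fix i a
  let ?\<rho> = "\<rho>(2 := i, 3 := a)"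
  have e: "eval r ?\<rho> \<mu> = rv" "eval c ?\<rho> \<mu> = card {i. i < k \<and> G i = bv}" by (rule r c; simp)+
  have "eval (coll_exp h b r) ?\<rho> \<mu> = collisions n {i. i < k \<and> G i = bv} f rv (?\<rho> 3)"
    by (rule eval_coll) (use h b r in auto)
  then show "0 < eval (ILt (mul (Num 9) (mul c (sub c (Num 1)))) (mul (coll_exp h b r) r) (Num 0) (Num 1)) ?\<rho> \<mu>
    \<longleftrightarrow> collisions n {i. i < k \<and> G i = bv} f rv a * rv \<le> 9 * (card {i. i < k \<and> G i = bv} * (card {i. i < k \<and> G i = bv} - 1))"
    using e by (simp add: not_less)
qed simp

lemma eval_first: "eval first_exp \<rho> \<mu> = multiplier n {..<k} f k"
proof -
  have "{i. i < k \<and> (0::nat) = 0} = {..<k}" by auto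
  moreover have "eval first_exp \<rho> \<mu> = multiplier n {i. i < k \<and> (0::nat) = 0} f k"
    unfolding first_exp_def by (rule eval_mult) simp_all
  ultimately show ?thesis by simp
qed

lemma eval_bucket:
  assumes "\<rho> 0 = L" "\<rho> 1 = j" "j < k" "cell L \<mu> 23 0 = multiplier n {..<k} f k"
  shows "eval bucket_exp \<rho> \<mu> = bucket j"
  using assms by (simp add: bucket_exp_def bucket_def eval_key)

lemma eval_count:
  assumes "\<rho> 0 = L" "\<rho> 1 = i" "\<And>j. j < k \<Longrightarrow> cell L \<mu> 6 j = bucket j"
  shows "eval count_exp \<rho> \<mu> = card (members i)"
proof -
  have "eval count_exp \<rho> \<mu> = (\<Sum>j<k. if bucket j = i then 1 else 0)"
    unfolding count_exp_def eval.simps(6) eval_k by (rule sum.cong) (use assms in auto)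
  then show ?thesis by (simp add: sum_eq_card members_def)
qed

lemma eval_width:
  assumes "\<rho> 0 = L" "\<rho> 1 = i" "\<And>j. j < k \<Longrightarrow> cell L \<mu> 6 j = bucket j"
  shows "eval width_exp \<rho> \<mu> = width i"
  using eval_count[OF assms] by (simp add: width_exp_def width_def)

lemma eval_offset:
  assumes "\<rho> 0 = L" "\<rho> 1 = i" "i \<le> k" "\<And>j. j < k \<Longrightarrow> cell L \<mu> 25 j = width j"
  shows "eval offset_exp \<rho> \<mu> = offset i"
  unfolding offset_exp_def offset_def eval.simps(6) by (rule sum.cong) (use assms in auto)

lemma eval_factor:
  assumes "\<rho> 0 = L" "\<rho> 1 = i" "i < k" "\<And>j. j < k \<Longrightarrow> cell L \<mu> 6 j = bucket j"
    and "\<And>j. j < k \<Longrightarrow> cell L \<mu> 25 j = width j"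
  shows "eval factor_exp \<rho> \<mu> = factor i"
proof -
  let ?\<rho> = "\<rho>(6 := card (members i))"
  have "eval (mult_exp (Arr 6) (Var 1) (Arr 25 (Var 1)) (Var 6)) ?\<rho> \<mu> =
    multiplier n {j. j < k \<and> bucket j = i} f (width i)"
    by (rule eval_mult) (use assms in \<open>auto simp: members_def\<close>)
  then show ?thesis using eval_count[OF assms(1,2,4)] by (simp add: factor_exp_def factor_def members_def)
qed

lemma eval_slot:
  assumes "\<rho> 0 = L" "\<rho> 1 = j" "j < k" "\<And>j. j < k \<Longrightarrow> cell L \<mu> 6 j = bucket j"
    and "\<And>j. j < k \<Longrightarrow> cell L \<mu> 24 j = offset j" "\<And>j. j < k \<Longrightarrow> cell L \<mu> 25 j = width j"
    and "\<And>j. j < k \<Longrightarrow> cell L \<mu> 26 j = factor j"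
  shows "eval slot_exp \<rho> \<mu> = slot j"
  using assms bucket_less[of j] by (simp add: slot_exp_def slot_def eval_key)

lemma eval_table:
  assumes "\<rho> 0 = L" "\<rho> 1 = u" "\<And>j. j < k \<Longrightarrow> cell L \<mu> 7 j = slot j"
    and "\<And>j. j < k \<Longrightarrow> cell L \<mu> 2 j = g j"
  shows "eval table_exp \<rho> \<mu> = table u"
  unfolding table_exp_def table_def eval.simps(6) eval_k by (rule sum.cong) (use assms in auto)

end

section \<open>The preprocessed instance\<close>

text \<open>Reachability in rounds, in the manner of Bellman and Ford, so that each round can be
  tabulated from the previous one.\<close>

fun walk_within :: "('a, 'b) pre_digraph \<Rightarrow> 'a \<Rightarrow> 'a \<Rightarrow> nat \<Rightarrow> 'a \<Rightarrow> bool" where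
  "walk_within G x y 0 v \<longleftrightarrow> v = y \<and> v \<noteq> x"
| "walk_within G x y (Suc r) v \<longleftrightarrow> walk_within G x y r v \<or>
    (\<exists>e\<in>arcs G. head G e = v \<and> v \<noteq> x \<and> walk_within G x y r (tail G e))"

lemma walk_within_mono:
  assumes "walk_within G x y r v" "r \<le> r'" shows "walk_within G x y r' v"
  using assms(2,1) by (induction rule: dec_induct) auto

lemma (in wf_digraph) walk_within_avoids:
  "walk_within G x y r v \<Longrightarrow> y \<in> verts G \<Longrightarrow> avoids G {x} y v"
proof (induction r arbitrary: v)
  case 0
  then show ?case by (auto intro: avoids_refl)
next
  case (Suc r)
  show ?case
  proof (cases "walk_within G x y r v")
    case False
    then obtain e where e: "e \<in> arcs G" "head G e = v" "v \<noteq> x" "walk_within G x y r (tail G e)"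
      using Suc.prems by auto
    then have "(y, tail G e) \<in> rtrancl_on (verts G - {x}) (arcs_ends G)"
      using Suc by (simp add: avoids_def)
    moreover have "(tail G e, v) \<in> arcs_ends G" using e by (auto intro: in_arcs_imp_in_arcs_ends)
    ultimately show ?thesis unfolding avoids_def
      by (rule rtrancl_on_into_rtrancl_on) (use e in auto)
  qed (use Suc in blast)
qed

lemma (in wf_digraph) awalk_walk_within:
  assumes "pre_digraph.awalk (del_vert x) y p v"
  shows "walk_within G x y (length p) v"
  using assms
proof (induction p arbitrary: v rule: rev_induct)
  interpret D: wf_digraph "del_vert x" by (rule wf_digraph_del_vert)
  case Nil
  then show ?case by (auto simp: D.awalk_Nil_iff verts_del_vert)
next
  interpret D: wf_digraph "del_vert x" by (rule wf_digraph_del_vert)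
  case (snoc e p)
  then have e: "D.awalk y p (tail G e)" "e \<in> arcs (del_vert x)" "head G e = v"
    by (auto simp: D.awalk_simps D.awalk_Cons_iff D.awalk_Nil_iff tail_del_vert head_del_vert dest: D.awalk_ends)
  then show ?case using snoc.IH by (auto simp: arcs_del_vert)
qed

text \<open>A path without repeated vertices has fewer arcs than there are vertices, so this many
  rounds suffice.\<close>

lemma (in fin_digraph) walk_within_iff_avoids:
  assumes "y \<in> verts G"
  shows "walk_within G x y (card (verts G)) v \<longleftrightarrow> avoids G {x} y v"
proof
  assume "avoids G {x} y v"
  then have "has_path (del_vert x) y v" by (simp add: has_path_del_vert_iff_avoids)
  then obtain p where p: "pre_digraph.apath (del_vert x) y p v" by (auto simp: has_path_def)
  interpret D: fin_digraph "del_vert x" by (rule fin_digraph_del_vert)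
  have "length p < card (verts (del_vert x))" using p by (rule D.length_apath_less)
  also have "\<dots> \<le> card (verts G)" by (rule card_mono) (auto simp: verts_del_vert)
  finally show "walk_within G x y (card (verts G)) v"
    using awalk_walk_within[OF D.awalkI_apath[OF p]] by (auto intro: walk_within_mono)
qed (use assms walk_within_avoids in auto)

text \<open>A mixed-radix index with \<open>v\<close> as lowest digit and the round above it: the
  same entry of the previous round lies exactly \<open>n\<close> cells earlier.\<close>

definition row :: "nat \<Rightarrow> nat \<Rightarrow> nat \<Rightarrow> nat \<Rightarrow> nat \<Rightarrow> nat" where
  "row n x y r v = ((x * n + y) * (n + 1) + r) * n + v"

definition row_rel :: "(nat, nat) pre_digraph \<Rightarrow> nat \<Rightarrow> nat \<Rightarrow> nat" where
  "row_rel G n i = of_bool (walk_within G (i div n div (n + 1) div n) (i div n div (n + 1) mod n)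
    (i div n mod (n + 1)) (i mod n))"

lemma row_less:
  assumes "x < n" "y < n" "r \<le> n" "v < n" shows "row n x y r v < n * n * (n + 1) * n"
proof -
  have l: "a * c + b < a' * c" if "a < a'" "b < c" for a a' b c :: nat
  proof -
    have "Suc a * c \<le> a' * c" using that by (intro mult_le_mono) auto
    then show ?thesis using that by simp
  qed
  show ?thesis unfolding row_def using assms by (intro l) auto
qed

lemma row_decode:
  assumes "y < n" "r \<le> n" "v < n"
  shows "row n x y r v mod n = v" "row n x y r v div n mod (n + 1) = r"
    "row n x y r v div n div (n + 1) mod n = y" "row n x y r v div n div (n + 1) div n = x"
proof -
  have 1: "row n x y r v div n = (x * n + y) * (n + 1) + r" using assms by (simp add: row_def)
  have 2: "row n x y r v div n div (n + 1) = x * n + y" unfolding 1 using assms by (simp del: mult_Suc_right)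
  show "row n x y r v mod n = v" using assms by (simp add: row_def)
  show "row n x y r v div n mod (n + 1) = r" unfolding 1 using assms by (simp del: mult_Suc_right)
  show "row n x y r v div n div (n + 1) mod n = y" "row n x y r v div n div (n + 1) div n = x"
    unfolding 2 using assms by simp_all
qed

lemma row_rel_row:
  "y < n \<Longrightarrow> r \<le> n \<Longrightarrow> v < n \<Longrightarrow> row_rel G n (row n x y r v) = of_bool (walk_within G x y r v)"
  by (simp only: row_rel_def row_decode)

text \<open>Variables 2 to 5 are the digits \<open>v\<close>, \<open>r\<close>, \<open>y\<close>,
  \<open>x\<close> of the index. Subtracting \<open>n\<close> leads to \<open>v\<close> in the
  previous round, subtracting \<open>v\<close> as well to the start of that round, where the tail of
  an arc is the offset.\<close>

definition row_exp :: exp where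
  "row_exp = LetE 2 (rem (Var 1) n_exp) (LetE 3 (rem (quot (Var 1) n_exp) (add n_exp (Num 1)))
    (LetE 4 (rem (quot (quot (Var 1) n_exp) (add n_exp (Num 1))) n_exp)
    (LetE 5 (quot (quot (quot (Var 1) n_exp) (add n_exp (Num 1))) n_exp)
    (ILt (Var 3) (Num 1) (IEq (Var 2) (Var 4) (IEq (Var 2) (Var 5) (Num 0) (Num 1)) (Num 0))
      (ILt (Num 0) (add (Arr 1 (sub (Var 1) n_exp)) (Sum 6 m_exp
        (IEq (Mem (add (Num 6) (mul (Num 2) (Var 6)))) (Var 2) (IEq (Var 2) (Var 5) (Num 0)
          (Arr 1 (add (sub (sub (Var 1) n_exp) (Var 2)) (Mem (add (Num 5) (mul (Num 2) (Var 6))))))) (Num 0))))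
        (Num 1) (Num 0))))))"

definition avoid_exp :: "exp \<Rightarrow> exp \<Rightarrow> exp \<Rightarrow> exp" where
  "avoid_exp x y v = Arr 1 (add (mul (add (mul (add (mul x n_exp) y) (add n_exp (Num 1))) n_exp) n_exp) v)"

definition pos_exp :: exp where
  "pos_exp = Sum 2 k_exp (avoid_exp (key_exp (Var 1)) s_exp (key_exp (Var 2)))"

definition vertex_exp :: exp where
  "vertex_exp = Sum 2 k_exp (IEq (Arr 2 (Var 2)) (Var 1) (key_exp (Var 2)) (Num 0))"

definition rel_exp :: exp where
  "rel_exp = LetE 2 (Arr 3 (quot (quot (Var 1) k_exp) k_exp)) (LetE 3 (Arr 3 (rem (quot (Var 1) k_exp) k_exp))
    (LetE 4 (Arr 3 (rem (Var 1) k_exp)) (avoid_exp (Var 2) (Var 3) (Var 4))))"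

lemma wf_avoid_exp [simp]: "0 < r \<Longrightarrow> wf_exp r (avoid_exp x y v) \<longleftrightarrow> wf_exp r x \<and> wf_exp r y \<and> wf_exp r v"
  by (auto simp: avoid_exp_def)

section \<open>From a graph instance to its chain of positions\<close>

locale graph_instance =
  fixes G :: "(nat, nat) pre_digraph" and s t :: nat and cs :: "nat list"
  assumes num: "numbered_digraph G" and st: "s \<in> verts G" "t \<in> verts G" "has_path G s t"
    and cut: "set cs \<subseteq> {x. st_cut_vertex G s t x}" and dist: "distinct cs"
begin

sublocale fin_digraph G
  using num by (simp add: numbered_digraph_def)

abbreviation n :: nat where "n \<equiv> card (verts G)"
abbreviation m :: nat where "m \<equiv> card (arcs G)"
abbreviation k :: nat where "k \<equiv> length cs"

lemma verts: "verts G = {..<n}" and arcs: "arcs G = {..<m}"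
  using num by (simp_all add: numbered_digraph_def)

lemma in_verts: "v \<in> verts G \<longleftrightarrow> v < n"
  using verts by blast

lemma n_pos: "0 < n"
  using st(1) by (auto simp: card_gt_0_iff)

sublocale cut_vertices G s t "set cs"
  by unfold_locales (use st(3) cut in \<open>auto simp: has_path_iff_avoids st_cut_vertex_def has_path_del_vert_iff_avoids\<close>)

lemma k_le: "k \<le> n"
proof -
  have "card (set cs) \<le> card (verts G)" using cut by (intro card_mono) (auto simp: st_cut_vertex_def)
  then show ?thesis using dist by (simp add: distinct_card)
qed

lemma cs_less: "j < k \<Longrightarrow> cs ! j < n"
  using cut verts by (auto simp: st_cut_vertex_def dest!: nth_mem)

text \<open>The inverse of \<open>pos\<close>: injectivity leaves one selected term in the
  sum.\<close>

definition vertex :: "nat \<Rightarrow> nat" where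
  "vertex i = (\<Sum>j<k. if pos (cs ! j) = i then cs ! j else 0)"

lemma pos_less_k: "c \<in> set cs \<Longrightarrow> pos c < k"
  using pos_bij dist by (auto simp: bij_betw_def distinct_card)

lemma vertex_pos:
  assumes "c \<in> set cs" shows "vertex (pos c) = c"
proof -
  obtain j where j: "j < k" "c = cs ! j" using assms by (auto simp: in_set_conv_nth)
  have "pos (cs ! i) = pos c \<longleftrightarrow> i = j" if "i < k" for i
    using inj_on_eq_iff[OF bij_betw_imp_inj_on[OF pos_bij], of "cs ! i" c] that j dist
    by (simp add: nth_eq_iff_index_eq)
  then have "vertex (pos c) = (\<Sum>i<k. if i = j then c else 0)"
    unfolding vertex_def using j by (intro sum.cong) auto
  then show ?thesis using j by simp
qed

lemma pos_vertex:
  assumes "i < k" shows "vertex i \<in> set cs" "pos (vertex i) = i"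
proof -
  have "i \<in> pos ` set cs" using pos_bij assms dist by (auto simp: bij_betw_def distinct_card)
  then obtain c where "c \<in> set cs" "i = pos c" by blast
  then show "vertex i \<in> set cs" "pos (vertex i) = i" using vertex_pos by auto
qed

lemma vertex_less: "i < k \<Longrightarrow> vertex i < n"
  using pos_vertex(1) cs_less by (metis in_set_conv_nth)

definition rel :: "nat \<Rightarrow> nat \<Rightarrow> nat \<Rightarrow> bool" where
  "rel x i j \<longleftrightarrow> x < k \<and> i < k \<and> j < k \<and> avoids G {vertex x} (vertex i) (vertex j)"

lemma vertex_before: "i < k \<Longrightarrow> j < k \<Longrightarrow> before (vertex i) (vertex j) \<longleftrightarrow> i < j"
  using pos_less_iff pos_vertex by metis

lemma vertex_inj: "i < k \<Longrightarrow> j < k \<Longrightarrow> vertex i = vertex j \<longleftrightarrow> i = j"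
  using pos_vertex(2) by metis

lemma chain_rel: "chain k rel"
proof
  fix x y i j l
  show "i < k \<Longrightarrow> x < k \<Longrightarrow> x \<noteq> i \<Longrightarrow> rel x i i"
    using vertex_less[of i] vertex_inj[of i x] verts by (auto simp: rel_def intro!: avoids_refl)
  show "x < k \<Longrightarrow> rel x i j \<Longrightarrow> x \<noteq> i \<and> x \<noteq> j"
    unfolding rel_def using avoids_notin by fastforce
  show "rel x i j \<Longrightarrow> rel x j l \<Longrightarrow> rel x i l"
    unfolding rel_def using avoids_trans[of G "{vertex x}" "vertex i" "vertex j" "vertex l"] by blast
  show "x < k \<Longrightarrow> y < k \<Longrightarrow> rel x i j \<Longrightarrow> rel y i j \<or> rel x i y \<and> rel x y j"
    unfolding rel_def using avoids_hit[of G "{vertex x}" "vertex i" "vertex j" "vertex y"]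
      avoids_antimono[of G "{vertex y, vertex x}" "vertex i" "vertex j" "{vertex y}"] by auto
  show "i < k \<Longrightarrow> j < k \<Longrightarrow> x < k \<Longrightarrow> i \<le> j \<Longrightarrow> x < i \<or> j < x \<Longrightarrow> rel x i j"
  \<comment> \<open>\<open>avoids_forward\<close> is about two vertices in strict order, so equal
    ends are settled by reflexivity.\<close>
  proof (cases "i = j")
    case True
    assume "i < k" "j < k" "x < k" "i \<le> j" "x < i \<or> j < x"
    with True show ?thesis
      using vertex_less[of i] vertex_inj[of i x] verts by (auto simp: rel_def intro!: avoids_refl)
  next
    case False
    assume "i < k" "j < k" "x < k" "i \<le> j" "x < i \<or> j < x"
    with False show ?thesis
      using avoids_forward[of "vertex i" "vertex j" "vertex x"] pos_vertex(1) vertex_before vertex_inj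
      by (auto simp: rel_def)
  qed
  show "i < k \<Longrightarrow> j < k \<Longrightarrow> x < k \<Longrightarrow> i < x \<Longrightarrow> x < j \<Longrightarrow> \<not> rel x i j"
    using avoids_blocked[of "vertex i" "vertex j" "vertex x"] pos_vertex(1) vertex_before
    by (auto simp: rel_def)
qed

definition input :: "nat \<Rightarrow> nat" where
  "input = mem (init_state [] (encode_instance G s t cs))"

lemma length_arcs: "length (concat (map (\<lambda>e. [tail G e, head G e]) [0..<j])) = 2 * j"
  by (induction j) auto

lemma nth_arcs:
  "e < j \<Longrightarrow> concat (map (\<lambda>e. [tail G e, head G e]) [0..<j]) ! (2 * e) = tail G e"
  "e < j \<Longrightarrow> concat (map (\<lambda>e. [tail G e, head G e]) [0..<j]) ! Suc (2 * e) = head G e"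
  by (induction j) (auto simp: nth_append length_arcs less_Suc_eq)

lemma input:
  "input 0 = n" "input 1 = m" "input 2 = s" "input 4 = k"
  "e < m \<Longrightarrow> input (5 + 2 * e) = tail G e" "e < m \<Longrightarrow> input (6 + 2 * e) = head G e"
  "j < k \<Longrightarrow> input (5 + 2 * m + j) = cs ! j"
proof -
  show "e < m \<Longrightarrow> input (6 + 2 * e) = head G e"
    using nth_arcs(2)[of e m]
    by (simp add: input_def init_state_def encode_instance_def nth_append length_arcs)
qed (simp_all add: input_def init_state_def encode_instance_def nth_append length_arcs nth_arcs)

lemma input_le: "input a \<le> n + m"
proof -
  have "\<forall>b\<in>set (encode_instance G s t cs). b \<le> n + m"
    using st verts k_le cs_less arcs
    by (auto simp: encode_instance_def in_set_conv_nth[of _ cs] less_imp_le intro: trans_le_add1)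
      (metis lessThan_iff tail_in_verts head_in_verts less_imp_le trans_le_add1)+
  then show ?thesis by (simp add: input_def init_state_def)
qed

end

locale graph_memory = graph_instance +
  fixes L :: nat and \<mu> :: "nat \<Rightarrow> nat"
  assumes agree: "a < 5 + 2 * m + k \<Longrightarrow> \<mu> a = input a"
begin

lemma \<mu>: "\<mu> 0 = n" "\<mu> 1 = m" "\<mu> 2 = s" "\<mu> 4 = k"
  "e < m \<Longrightarrow> \<mu> (5 + 2 * e) = tail G e" "e < m \<Longrightarrow> \<mu> (6 + 2 * e) = head G e"
  "j < k \<Longrightarrow> \<mu> (5 + 2 * m + j) = cs ! j"
  using input by (auto simp: agree)

lemma eval_exps [simp]: "eval n_exp \<rho> \<mu> = n" "eval m_exp \<rho> \<mu> = m" "eval s_exp \<rho> \<mu> = s" "eval k_exp \<rho> \<mu> = k"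
  using \<mu> by (simp_all add: n_exp_def m_exp_def s_exp_def k_exp_def)

lemma eval_key: "eval e \<rho> \<mu> < k \<Longrightarrow> eval (key_exp e) \<rho> \<mu> = cs ! (eval e \<rho> \<mu>)"
  using \<mu>(7) by (simp add: key_exp_def)

lemma eval_row:
  assumes \<rho>: "\<rho> 0 = L" "\<rho> 1 = i" and i: "i < n * n * (n + 1) * n"
    and prev: "\<And>j. j < i \<Longrightarrow> cell L \<mu> 1 j = row_rel G n j"
  shows "eval row_exp \<rho> \<mu> = row_rel G n i"
proof -
  define v r y x where "v = i mod n" and "r = i div n mod (n + 1)"
    and "y = i div n div (n + 1) mod n" and "x = i div n div (n + 1) div n"
  have lt: "v < n" "r \<le> n" "y < n" using n_pos by (simp_all add: v_def r_def y_def less_Suc_eq_le[symmetric] del: mult_Suc_right)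
  have ix: "i = row n x y r v" unfolding row_def v_def r_def y_def x_def by (simp only: div_mult_mod_eq)
  let ?\<rho> = "\<rho>(2 := v, 3 := r, 4 := y, 5 := x)"
  show ?thesis
  proof (cases r)
    case 0
    then show ?thesis using \<rho> lt
      by (simp add: row_exp_def row_rel_def v_def[symmetric] r_def[symmetric, simplified] y_def[symmetric, simplified] x_def[symmetric, simplified])
  next
    case (Suc r')
    have i': "i - n = row n x y r' v" "i - n - v = row n x y r' 0" "n \<le> i"
      using lt unfolding ix Suc by (simp_all add: row_def)
    have less: "row n x y r' u < i" if "u < n" for u
      using that unfolding ix Suc by (simp add: row_def)
    have c: "cell L \<mu> 1 (row n x y r' u) = of_bool (walk_within G x y r' u)" if "u < n" for u
      using that lt Suc by (subst prev[OF less[OF that]]) (simp add: row_rel_row)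
    let ?S = "Sum 6 m_exp
        (IEq (Mem (add (Num 6) (mul (Num 2) (Var 6)))) (Var 2) (IEq (Var 2) (Var 5) (Num 0)
          (Arr 1 (add (sub (sub (Var 1) n_exp) (Var 2)) (Mem (add (Num 5) (mul (Num 2) (Var 6))))))) (Num 0))"
    have "eval ?S ?\<rho> \<mu> = (\<Sum>e<m. of_bool (head G e = v \<and> v \<noteq> x \<and> walk_within G x y r' (tail G e)))"
      unfolding eval.simps(6) eval_exps
    proof (rule sum.cong[OF refl])
      fix e assume "e \<in> {..<m}"
      then have e: "e < m" "tail G e < n" using arcs verts tail_in_verts by auto
      have "row n x y r' 0 + tail G e = row n x y r' (tail G e)" by (simp add: row_def)
      then show "eval (IEq (Mem (add (Num 6) (mul (Num 2) (Var 6)))) (Var 2) (IEq (Var 2) (Var 5) (Num 0)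
          (Arr 1 (add (sub (sub (Var 1) n_exp) (Var 2)) (Mem (add (Num 5) (mul (Num 2) (Var 6))))))) (Num 0))
          (?\<rho>(6 := e)) \<mu> = of_bool (head G e = v \<and> v \<noteq> x \<and> walk_within G x y r' (tail G e))"
        using \<rho> \<mu>(5,6)[OF e(1)] i'(2) c[OF e(2)] by simp
    qed
    then have S: "eval ?S ?\<rho> \<mu> = 0 \<longleftrightarrow> \<not> (\<exists>e\<in>arcs G. head G e = v \<and> v \<noteq> x \<and> walk_within G x y r' (tail G e))"
      using arcs by auto
    have A: "eval (Arr 1 (sub (Var 1) n_exp)) ?\<rho> \<mu> = of_bool (walk_within G x y r' v)"
      using \<rho> i'(1) c[OF lt(1)] by simp
    have "eval row_exp \<rho> \<mu> = eval (ILt (Num 0) (add (Arr 1 (sub (Var 1) n_exp)) ?S) (Num 1) (Num 0)) ?\<rho> \<mu>"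
      using \<rho> Suc unfolding row_exp_def
      by (simp del: eval.simps(6) eval_Arr add: v_def[symmetric] r_def[symmetric, simplified] y_def[symmetric, simplified] x_def[symmetric, simplified])
    also have "\<dots> = of_bool (walk_within G x y r v)"
      using S A Suc by (simp del: eval.simps(6) eval_Arr)
    finally show ?thesis using ix row_rel_row lt by simp
  qed
qed

lemma eval_avoid:
  assumes "\<rho> 0 = L" "eval x \<rho> \<mu> < n" "eval y \<rho> \<mu> < n" "eval v \<rho> \<mu> < n"
    and T: "\<And>j. j < n * n * (n + 1) * n \<Longrightarrow> cell L \<mu> 1 j = row_rel G n j"
  shows "eval (avoid_exp x y v) \<rho> \<mu> = of_bool (avoids G {eval x \<rho> \<mu>} (eval y \<rho> \<mu>) (eval v \<rho> \<mu>))"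
proof -
  have "eval (avoid_exp x y v) \<rho> \<mu> = cell L \<mu> 1 (row n (eval x \<rho> \<mu>) (eval y \<rho> \<mu>) n (eval v \<rho> \<mu>))"
    using assms(1) by (simp add: avoid_exp_def row_def)
  also have "\<dots> = of_bool (walk_within G (eval x \<rho> \<mu>) (eval y \<rho> \<mu>) n (eval v \<rho> \<mu>))"
    using assms(2-4) by (simp only: T[OF row_less] row_rel_row order_refl)
  also have "walk_within G (eval x \<rho> \<mu>) (eval y \<rho> \<mu>) n (eval v \<rho> \<mu>) \<longleftrightarrow>
      avoids G {eval x \<rho> \<mu>} (eval y \<rho> \<mu>) (eval v \<rho> \<mu>)"
    using assms(3) in_verts by (intro walk_within_iff_avoids) blast
  finally show ?thesis .
qed

lemma eval_pos:
  assumes "\<rho> 0 = L" "\<rho> 1 = j" "j < k"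
    and T: "\<And>j. j < n * n * (n + 1) * n \<Longrightarrow> cell L \<mu> 1 j = row_rel G n j"
  shows "eval pos_exp \<rho> \<mu> = pos (cs ! j)"
proof -
  have "eval pos_exp \<rho> \<mu> = (\<Sum>i<k. if before (cs ! i) (cs ! j) then 1 else 0)"
    unfolding pos_exp_def eval.simps(6) eval_exps
  proof (rule sum.cong[OF refl])
    fix i assume "i \<in> {..<k}"
    then have i: "i < k" by simp
    have "eval (avoid_exp (key_exp (Var 1)) s_exp (key_exp (Var 2))) (\<rho>(2 := i)) \<mu> =
      of_bool (avoids G {eval (key_exp (Var 1)) (\<rho>(2 := i)) \<mu>} (eval s_exp (\<rho>(2 := i)) \<mu>)
        (eval (key_exp (Var 2)) (\<rho>(2 := i)) \<mu>))"
      by (rule eval_avoid[OF _ _ _ _ T])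
        (use assms(1-3) i st(1) in_verts cs_less in \<open>simp_all add: eval_key\<close>)
    then show "eval (avoid_exp (key_exp (Var 1)) s_exp (key_exp (Var 2))) (\<rho>(2 := i)) \<mu> =
      (if before (cs ! i) (cs ! j) then 1 else 0)"
      using assms(1-3) i by (simp add: eval_key before_def)
  qed
  also have "\<dots> = card {i. i < k \<and> before (cs ! i) (cs ! j)}" by (rule sum_eq_card)
  also have "\<dots> = card {a \<in> set cs. before a (cs ! j)}"
  proof (rule bij_betw_same_card[of "nth cs"])
    show "bij_betw (nth cs) {i. i < k \<and> before (cs ! i) (cs ! j)} {a \<in> set cs. before a (cs ! j)}"
      using dist by (auto simp: bij_betw_def inj_on_def nth_eq_iff_index_eq in_set_conv_nth)
  qed
  finally show ?thesis by (simp add: pos_def)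
qed

lemma eval_vertex:
  assumes "\<rho> 0 = L" "\<rho> 1 = i" and P: "\<And>j. j < k \<Longrightarrow> cell L \<mu> 2 j = pos (cs ! j)"
  shows "eval vertex_exp \<rho> \<mu> = vertex i"
  unfolding vertex_exp_def vertex_def eval.simps(6) eval_exps
  by (rule sum.cong) (use assms in \<open>auto simp: eval_key\<close>)

lemma eval_rel:
  assumes "\<rho> 0 = L" "\<rho> 1 = i" "i < k * k * k"
    and V: "\<And>j. j < k \<Longrightarrow> cell L \<mu> 3 j = vertex j"
    and T: "\<And>j. j < n * n * (n + 1) * n \<Longrightarrow> cell L \<mu> 1 j = row_rel G n j"
  shows "eval rel_exp \<rho> \<mu> = of_bool (rel (i div k div k) (i div k mod k) (i mod k))"
proof -
  have k0: "0 < k" using assms(3) by (cases "k = 0") auto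
  have lt: "i div k div k < k" "i div k mod k < k" "i mod k < k"
    using assms(3) k0 by (auto simp: less_mult_imp_div_less)
  let ?\<rho> = "\<rho>(2 := vertex (i div k div k), 3 := vertex (i div k mod k), 4 := vertex (i mod k))"
  have "eval rel_exp \<rho> \<mu> = eval (avoid_exp (Var 2) (Var 3) (Var 4)) ?\<rho> \<mu>"
    using assms(1,2) lt V by (simp add: rel_exp_def)
  also have "\<dots> = of_bool (avoids G {eval (Var 2) ?\<rho> \<mu>} (eval (Var 3) ?\<rho> \<mu>) (eval (Var 4) ?\<rho> \<mu>))"
    by (rule eval_avoid[OF _ _ _ _ T]) (use assms(1) lt vertex_less in simp_all)
  finally show ?thesis using lt by (simp add: rel_def)
qed

end

section \<open>Answering queries\<close>

lemma is_rmin_cong: "(\<And>i. i < hi \<Longrightarrow> d i = d' i) \<Longrightarrow> is_rmin d lo hi i \<longleftrightarrow> is_rmin d' lo hi i"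
  by (auto simp: is_rmin_def)

text \<open>The last position below \<open>x\<close> from which \<open>z\<close> is reached in
  \<open>G - x\<close>. As \<open>rmq\<close> includes its right end, the range stops at
  \<open>x - 1\<close>.\<close>

definition up_end :: "nat \<Rightarrow> (nat \<Rightarrow> nat) \<Rightarrow> nat \<Rightarrow> nat \<Rightarrow> nat" where
  "up_end k d z x = rmq k (bits k) d z (x - 1)"

text \<open>\<open>up_end\<close> on the reversed chain, mirrored back: \<open>y\<close> and
  \<open>x\<close> become \<open>k - Suc y\<close> and \<open>k - Suc x\<close>, and the inclusive
  right end is one less than the latter.\<close>

definition down_end :: "nat \<Rightarrow> (nat \<Rightarrow> nat) \<Rightarrow> nat \<Rightarrow> nat \<Rightarrow> nat" where
  "down_end k d y x = k - Suc (rmq k (bits k) d (k - Suc y) (k - Suc (Suc x)))"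

lemma (in chain) up_end:
  assumes "z < x" "x < k"
  shows "z \<le> up_end k (low_on k \<rho>) z x" "up_end k (low_on k \<rho>) z x < x"
    "z \<le> a \<Longrightarrow> a < x \<Longrightarrow> \<rho> x a z \<longleftrightarrow> a \<le> up_end k (low_on k \<rho>) z x"
proof -
  let ?i = "up_end k (low_on k \<rho>) z x"
  have "is_rmin (low_on k \<rho>) z (Suc (x - 1)) ?i"
    unfolding up_end_def by (rule rmq) (use assms bits_pos[of k] less_power_bits in auto)
  then have i: "is_rmin low z x ?i"
    using assms is_rmin_cong[of x "low_on k \<rho>" low] by (simp add: low_on_def)
  then show "z \<le> ?i" "?i < x" by (auto simp: is_rmin_def)
  show "z \<le> a \<Longrightarrow> a < x \<Longrightarrow> \<rho> x a z \<longleftrightarrow> a \<le> ?i" using reach_back_iff[OF i] assms by blast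
qed

lemma (in chain) down_end:
  assumes "x < y" "y < k"
  shows "x < down_end k (low_on k (rev_rel k \<rho>)) y x" "down_end k (low_on k (rev_rel k \<rho>)) y x \<le> y"
    "x < a \<Longrightarrow> a \<le> y \<Longrightarrow> \<rho> x y a \<longleftrightarrow> down_end k (low_on k (rev_rel k \<rho>)) y x \<le> a"
proof -
  interpret rev: chain k "rev_rel k \<rho>" unfolding rev_rel_def using chain_reverse[OF chain_axioms] .
  define i where "i = up_end k (low_on k (rev_rel k \<rho>)) (k - Suc y) (k - Suc x)"
  have l: "down_end k (low_on k (rev_rel k \<rho>)) y x = k - Suc i"
    by (simp add: down_end_def i_def up_end_def)
  have yx: "k - Suc y < k - Suc x" "k - Suc x < k" using assms by auto
  note i = rev.up_end[OF yx, folded i_def]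
  show "x < down_end k (low_on k (rev_rel k \<rho>)) y x" "down_end k (low_on k (rev_rel k \<rho>)) y x \<le> y"
    unfolding l using i(1,2) assms by auto
  assume a: "x < a" "a \<le> y"
  have "rev_rel k \<rho> (k - Suc x) (k - Suc a) (k - Suc y) \<longleftrightarrow> k - Suc a \<le> i"
    by (rule i(3)) (use a assms in auto)
  then show "\<rho> x y a \<longleftrightarrow> down_end k (low_on k (rev_rel k \<rho>)) y x \<le> a"
    unfolding l using a assms i(2) by (auto simp: rev_rel_def)
qed

definition answer :: "nat \<Rightarrow> (nat \<Rightarrow> nat) \<Rightarrow> (nat \<Rightarrow> nat) \<Rightarrow> (nat \<Rightarrow> nat) \<Rightarrow> nat \<Rightarrow> nat \<Rightarrow> nat \<Rightarrow> bool" where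
  "answer k d d' h x y z \<longleftrightarrow> x \<noteq> y \<and> x \<noteq> z \<and>
    (if z < y then
      if y < x then y \<le> up_end k d z x
      else if x < z then down_end k d' y x \<le> z
      else h (down_end k d' y x) \<le> up_end k d z x
    else \<not> (y < x \<and> x < z))"

lemma (in chain) answer:
  assumes "x < k" "y < k" "z < k"
  shows "\<rho> x y z \<longleftrightarrow> answer k (low_on k \<rho>) (low_on k (rev_rel k \<rho>)) landing x y z"
proof (cases "x = y \<or> x = z")
  case True
  then show ?thesis using ends[of x y z] assms by (auto simp: answer_def)
next
  case ne: False
  show ?thesis
  proof (cases "z < y")
    case zy: True
    consider "y < x" | "x < z" | "z < x" "x < y" using ne by linarith
    then show ?thesis
    proof cases
      case 1
      then show ?thesis using up_end(3)[of z x y] zy ne assms by (auto simp: answer_def)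
    next
      case 2
      then show ?thesis using down_end(3)[of x y z] zy ne assms by (auto simp: answer_def)
    next
      case 3
      have "\<rho> x y z \<longleftrightarrow> landing (down_end k (low_on k (rev_rel k \<rho>)) y x) \<le> up_end k (low_on k \<rho>) z x"
        by (rule reach_across_iff) (use 3 assms up_end[of z x] down_end[of x y] in auto)
      then show ?thesis using 3 zy ne by (auto simp: answer_def)
    qed
  next
    case False
    then show ?thesis using ne assms forward[of y z x] blocked[of y z x]
      by (cases "y < x \<and> x < z") (auto simp: answer_def)
  qed
qed

text \<open>Entry \<open>i\<close> of table \<open>A < 18\<close> of the oracle, which holds array \<open>20 + A\<close> of the preprocessing.\<close>

definition Tab :: "nat \<Rightarrow> exp \<Rightarrow> exp" where
  "Tab A e = Mem (add (mul (Num 18) e) (Num A))"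

text \<open>Interleaving spares the query all table lengths: an address depends on the entry and the
  number of the table only.\<close>

definition tab :: "(nat \<Rightarrow> nat) \<Rightarrow> nat \<Rightarrow> nat \<Rightarrow> nat" where
  "tab \<mu> A i = \<mu> (18 * i + A)"

lemma eval_Tab [simp]: "eval (Tab A e) \<rho> \<mu> = tab \<mu> A (eval e \<rho> \<mu>)"
  by (simp add: Tab_def tab_def)

lemma wf_Tab [simp]: "wf_exp r (Tab A e) \<longleftrightarrow> wf_exp r e"
  by (simp add: Tab_def)

lemma sum_free_Tab [simp]: "sum_free (Tab A e) \<longleftrightarrow> sum_free e"
  by (simp add: Tab_def)

lemma sum_free_IEq [simp]:
  "sum_free (IEq a b c d) \<longleftrightarrow> sum_free a \<and> sum_free b \<and> sum_free c \<and> sum_free d"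
  by (auto simp: IEq_def)

lemma sum_free_hash [simp]:
  "sum_free (hash_exp n a r x) \<longleftrightarrow> sum_free n \<and> sum_free a \<and> sum_free r \<and> sum_free x"
  by (auto simp: hash_exp_def)

section \<open>The query: range minima, dictionary lookup and case distinction\<close>

definition pick_exp :: "nat \<Rightarrow> exp \<Rightarrow> exp \<Rightarrow> exp" where
  "pick_exp D a b = ILt (Tab D a) (Tab D b) a b"

lemma eval_pick:
  assumes "tab \<mu> D (eval a \<rho> \<mu>) = d (eval a \<rho> \<mu>)" "tab \<mu> D (eval b \<rho> \<mu>) = d (eval b \<rho> \<mu>)"
  shows "eval (pick_exp D a b) \<rho> \<mu> = pick d (eval a \<rho> \<mu>) (eval b \<rho> \<mu>)"
  using assms by (simp add: pick_exp_def pick_def)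

lemma pick_less: "i < k \<Longrightarrow> j < k \<Longrightarrow> pick d i j < k"
  by (simp add: pick_def)

definition merge_exp :: "nat \<Rightarrow> exp" where
  "merge_exp D = LetE 13 (pick_exp D (Var 13) (Var 16)) (LetE 13 (pick_exp D (Var 13) (Var 17))
    (pick_exp D (Var 13) (Var 14)))"

definition blocks_exp :: "nat \<Rightarrow> exp" where
  "blocks_exp D = ILt (add (Var 11) (Num 1)) (Var 12)
    (LetE 15 (Tab 10 (sub (Var 12) (add (Var 11) (Num 1))))
    (LetE 16 (Tab (D + 2) (add (mul (add (Var 11) (Num 1)) (Var 10)) (Var 15)))
    (LetE 17 (Tab (D + 2) (add (mul (sub (Var 12) (Tab 8 (Var 15))) (Var 10)) (Var 15)))
      (merge_exp D))))
    (pick_exp D (Var 13) (Var 14))"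

text \<open>Tables \<open>D\<close>, \<open>D + 1\<close> and \<open>D + 2\<close> hold the keys,
  their masks and their sparse table; tables 2, 8, 9 and 10 hold block length, powers of 2, lowest
  bits and levels. The scratch variables 8 to 17 avoid those of the surrounding query.\<close>

definition rmq_exp :: "nat \<Rightarrow> exp \<Rightarrow> exp \<Rightarrow> exp" where
  "rmq_exp D z j = LetE 8 z (LetE 9 j (LetE 10 (Tab 2 (Num 0))
    (LetE 11 (quot (Var 8) (Var 10)) (LetE 12 (quot (Var 9) (Var 10))
    (IEq (Var 11) (Var 12) (add (Var 8) (Tab 9 (shr (Tab (D + 1) (Var 9)) (rem (Var 8) (Var 10)))))
    (LetE 13 (add (Var 8) (Tab 9 (shr (Tab (D + 1) (add (mul (Var 11) (Var 10)) (sub (Var 10) (Num 1))))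
      (rem (Var 8) (Var 10)))))
    (LetE 14 (add (mul (Var 12) (Var 10)) (Tab 9 (Tab (D + 1) (Var 9))))
      (blocks_exp D))))))))"

lemma wf_rmq_exps [simp]:
  "wf_exp r (pick_exp D a b) \<longleftrightarrow> wf_exp r a \<and> wf_exp r b"
  "17 < r \<Longrightarrow> wf_exp r (rmq_exp D z j) \<longleftrightarrow> wf_exp r z \<and> wf_exp r j"
  by (auto simp: pick_exp_def rmq_exp_def blocks_exp_def merge_exp_def)

lemma sum_free_rmq_exps [simp]:
  "sum_free (pick_exp D a b) \<longleftrightarrow> sum_free a \<and> sum_free b"
  "sum_free (rmq_exp D z j) \<longleftrightarrow> sum_free z \<and> sum_free j"
  by (auto simp: pick_exp_def rmq_exp_def blocks_exp_def merge_exp_def)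

locale rmq_memory =
  fixes k D :: nat and d \<mu> :: "nat \<Rightarrow> nat"
  assumes b: "tab \<mu> 2 0 = bits k" and pow: "i < bits k \<Longrightarrow> tab \<mu> 8 i = 2 ^ i"
    and lowest: "v < 2 * k + 2 \<Longrightarrow> tab \<mu> 9 v = lowest_bit (bits k) v"
    and level: "v \<le> k \<Longrightarrow> tab \<mu> 10 v = level (bits k) v"
    and d: "i < k \<Longrightarrow> tab \<mu> D i = d i"
    and mask: "i < k \<Longrightarrow> tab \<mu> (D + 1) i = block_mask (bits k) d i"
    and sparse: "i < k + bits k \<Longrightarrow> tab \<mu> (D + 2) i = sparse k (bits k) d i"
begin

lemma lowest_mask:
  "tab \<mu> 9 (drop_bit a (block_mask (bits k) d j)) = lowest_bit (bits k) (drop_bit a (block_mask (bits k) d j))"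
proof (rule lowest)
  have "drop_bit a (block_mask (bits k) d j) \<le> block_mask (bits k) d j" by (simp add: drop_bit_eq_div)
  also have "\<dots> < 2 ^ bits k" by (rule block_mask_less)
  also have "\<dots> \<le> 2 * k + 1" by (rule power_bits_le)
  finally show "drop_bit a (block_mask (bits k) d j) < 2 * k + 2" by simp
qed

lemma eval_rmq:
  assumes z: "eval z \<rho> \<mu> = zv" "eval j (\<rho>(8 := zv)) \<mu> = jv" "zv \<le> jv" "jv < k"
  shows "eval (rmq_exp D z j) \<rho> \<mu> = rmq k (bits k) d zv jv"
proof -
  let ?b = "bits k"
  have b0: "0 < ?b" using z bits_pos[of k] by simp
  define q p where "q = zv div ?b" and "p = jv div ?b"
  have qp: "q \<le> p" unfolding q_def p_def using z(3) by (rule div_le_mono)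
  let ?\<rho> = "\<rho>(8 := zv, 9 := jv, 10 := ?b, 11 := q, 12 := p)"
  show ?thesis
  proof (cases "q = p")
    case True
    then show ?thesis using z b lowest_mask[of "zv mod ?b" jv] mask[of jv]
      unfolding rmq_def q_def p_def by (simp add: rmq_exp_def)
  next
    case False
    then have lt: "q < p" using qp by simp
    define l r where "l = block_suffix ?b d zv" and "r = block_prefix ?b d jv"
    have pj: "p * ?b \<le> jv" unfolding p_def by simp
    have qb: "(q + 1) * ?b \<le> p * ?b" using lt by (intro mult_le_mono1) simp
    have s: "q * ?b + (?b - 1) < k"
    proof -
      have "q * ?b + (?b - 1) < (q + 1) * ?b" using b0 by simp
      then show ?thesis using qb pj z by linarith
    qed
    have l: "l < k" using block_suffix[OF b0, of d zv, folded q_def l_def] qb pj z unfolding is_rmin_def by linarith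
    have r: "r < k" using block_prefix[OF b0, of d jv, folded p_def r_def] z unfolding is_rmin_def by linarith
    have le: "zv + tab \<mu> 9 (drop_bit (zv mod ?b) (tab \<mu> (D + 1) (q * ?b + (?b - 1)))) = l"
      using mask[OF s] lowest_mask by (simp add: l_def block_suffix_def q_def)
    have re: "p * ?b + tab \<mu> 9 (tab \<mu> (D + 1) jv) = r"
      using mask[of jv] lowest_mask[of 0 jv] z by (simp add: r_def block_prefix_def p_def drop_bit_0)
    have e: "eval (rmq_exp D z j) \<rho> \<mu> = eval (blocks_exp D) (?\<rho>(13 := l, 14 := r)) \<mu>"
      using z b False le re by (simp add: rmq_exp_def q_def[symmetric] p_def[symmetric])
    show ?thesis
    proof (cases "q + 1 < p")
      case True
      define e where "e = level ?b (p - (q + 1))"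
      note m = middle_blocks[OF b0 less_power_bits z(4), of q, folded p_def, OF True, folded e_def]
      define i1 i2 where "i1 = sparse k ?b d ((q + 1) * ?b + e)" and "i2 = sparse k ?b d ((p - 2 ^ e) * ?b + e)"
      have "(q + 1 + 2 ^ e) * ?b \<le> p * ?b" using m(5) by (rule mult_le_mono1)
      then have i: "i1 < k" "i2 < k" using m(1,2)[of d, folded i1_def i2_def] pj z unfolding is_rmin_def by linarith+
      have "(p - 2 ^ e) * ?b \<le> p * ?b" by (intro mult_le_mono1) simp
      then have ix: "(q + 1) * ?b + e < k + ?b" "(p - 2 ^ e) * ?b + e < k + ?b"
        using qb pj z m(6) by linarith+
      have "p \<le> jv" unfolding p_def by simp
      then have lv: "p - (q + 1) \<le> k" using z by linarith
      have "eval (blocks_exp D) (?\<rho>(13 := l, 14 := r)) \<mu> =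
        eval (merge_exp D) (?\<rho>(13 := l, 14 := r, 15 := e, 16 := i1, 17 := i2)) \<mu>"
        using True level[OF lv] pow[OF m(6)] sparse[OF ix(1)] sparse[OF ix(2)]
        by (simp add: blocks_exp_def e_def[symmetric, simplified] i1_def i2_def)
      also have "\<dots> = pick d (pick d (pick d l i1) i2) r"
        using l r i by (simp add: merge_exp_def eval_pick[of _ _ _ _ d] d pick_less)
      finally show ?thesis using True False e
        unfolding rmq_def Let_def q_def[symmetric] p_def[symmetric] l_def r_def i1_def i2_def e_def by simp
    next
      case F: False
      then show ?thesis using False e l r
        unfolding rmq_def Let_def q_def[symmetric] p_def[symmetric] l_def[symmetric] r_def[symmetric]
        by (simp add: blocks_exp_def eval_pick[of _ _ _ _ d] d)
    qed
  qed
qed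

end

definition lookup_exp :: "nat \<Rightarrow> exp" where
  "lookup_exp v = LetE 3 (hash_exp (Tab 0 (Num 0)) (Tab 3 (Num 0)) (Tab 1 (Num 0)) (Var v))
    (Tab 7 (add (Tab 4 (Var 3)) (hash_exp (Tab 0 (Num 0)) (Tab 6 (Var 3)) (Tab 5 (Var 3)) (Var v))))"

definition up_exp :: exp where
  "up_exp = rmq_exp 11 (Var 6) (sub (Var 4) (Num 1))"

definition down_exp :: exp where
  "down_exp = sub (Tab 1 (Num 0)) (add (rmq_exp 14 (sub (Tab 1 (Num 0)) (add (Var 5) (Num 1)))
    (sub (Tab 1 (Num 0)) (add (Var 4) (Num 2)))) (Num 1))"

definition answer_exp :: exp where
  "answer_exp = IEq (Var 4) (Var 5) (Num 0) (IEq (Var 4) (Var 6) (Num 0)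
    (ILt (Var 6) (Var 5)
      (ILt (Var 5) (Var 4) (ILt up_exp (Var 5) (Num 0) (Num 1))
        (LetE 7 down_exp (ILt (Var 4) (Var 6) (ILt (Var 6) (Var 7) (Num 0) (Num 1))
          (ILt up_exp (Tab 17 (Var 7)) (Num 0) (Num 1)))))
      (ILt (Var 5) (Var 4) (ILt (Var 4) (Var 6) (Num 0) (Num 1)) (Num 1))))"

text \<open>The names in registers 0 to 2 become positions in variables 4 to 6; nothing after that
  depends on the naming of vertices.\<close>

definition query_exp :: exp where
  "query_exp = LetE 4 (lookup_exp 0) (LetE 5 (lookup_exp 1) (LetE 6 (lookup_exp 2) answer_exp))"

lemma wf_query: "wf_exp 20 query_exp"
  by (simp add: query_exp_def lookup_exp_def answer_exp_def up_exp_def down_exp_def)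

lemma sum_free_query: "sum_free query_exp"
  by (simp add: query_exp_def lookup_exp_def answer_exp_def up_exp_def down_exp_def)

locale oracle_memory = up: rmq_memory k 11 d \<mu> + down: rmq_memory k 14 d' \<mu> + dictionary n k f g
  for n k f g d d' \<mu> +
  fixes h :: "nat \<Rightarrow> nat"
  assumes n: "tab \<mu> 0 0 = n" and k: "tab \<mu> 1 0 = k" and first: "tab \<mu> 3 0 = multiplier n {..<k} f k"
    and offset: "i < k \<Longrightarrow> tab \<mu> 4 i = offset i" and width: "i < k \<Longrightarrow> tab \<mu> 5 i = width i"
    and factor: "i < k \<Longrightarrow> tab \<mu> 6 i = factor i" and table: "u < 90 * k \<Longrightarrow> tab \<mu> 7 u = table u"
    and h: "i < k \<Longrightarrow> tab \<mu> 17 i = h i"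
begin

lemma eval_lookup:
  assumes "\<rho> v = f j" "j < k" "v \<noteq> 3" shows "eval (lookup_exp v) \<rho> \<mu> = g j"
proof -
  have b: "hash n (multiplier n {..<k} f k) k (f j) = bucket j" by (simp add: bucket_def)
  have "eval (lookup_exp v) \<rho> \<mu> = tab \<mu> 7 (slot j)"
    using assms bucket_less[of j] by (simp add: lookup_exp_def n k[simplified] first b offset width factor slot_def)
  then show ?thesis using table[OF slot_less] table_slot assms by simp
qed

lemma eval_answer:
  assumes \<rho>: "\<rho> 4 = x" "\<rho> 5 = y" "\<rho> 6 = z" and lt: "x < k" "y < k" "z < k"
  shows "eval answer_exp \<rho> \<mu> = of_bool (answer k d d' h x y z)"
proof -
  have up: "eval up_exp \<rho>' \<mu> = up_end k d z x" if "\<rho>' 4 = x" "\<rho>' 6 = z" "z < x" for \<rho>'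
    unfolding up_exp_def up_end_def by (rule up.eval_rmq) (use that lt in auto)
  have rm: "eval (rmq_exp 14 (sub (Tab 1 (Num 0)) (add (Var 5) (Num 1)))
    (sub (Tab 1 (Num 0)) (add (Var 4) (Num 2)))) \<rho> \<mu> = rmq k (bits k) d' (k - Suc y) (k - Suc (Suc x))" if "x < y"
    by (rule down.eval_rmq) (use that lt \<rho> k in auto)
  have down: "eval down_exp \<rho> \<mu> = down_end k d' y x" if "x < y"
    using rm[OF that] k by (simp add: down_exp_def down_end_def)
  consider "x = y \<or> x = z" | "x \<noteq> y" "x \<noteq> z" "\<not> z < y" | "x \<noteq> y" "x \<noteq> z" "z < y" "y < x"
    | "x < z" "z < y" | "z < x" "x < y" by linarith
  then show ?thesis
  proof cases
    case 1
    then show ?thesis using \<rho> by (auto simp: answer_exp_def answer_def)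
  next
    case 2
    then show ?thesis using \<rho> by (simp add: answer_exp_def answer_def)
  next
    case 3
    then show ?thesis using \<rho> up by (simp add: answer_exp_def answer_def)
  next
    case 4
    then show ?thesis using \<rho> down by (simp add: answer_exp_def answer_def)
  next
    case 5
    \<comment> \<open>A value of the form \<open>k - Suc _\<close> is below \<open>k\<close>
      whatever the range minimum is, so the landing table applies.\<close>
    have "k - Suc (rmq k (bits k) d' (k - Suc y) (k - Suc (Suc x))) < k" using lt by simp
    then have "tab \<mu> 17 (down_end k d' y x) = h (down_end k d' y x)" unfolding down_end_def by (rule h)
    with 5 show ?thesis using \<rho> down up by (simp add: answer_exp_def answer_def)
  qed
qed

lemma eval_query:
  assumes "\<rho> 0 = f i" "\<rho> 1 = f j" "\<rho> 2 = f l" "i < k" "j < k" "l < k"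
    and "g i < k" "g j < k" "g l < k"
  shows "eval query_exp \<rho> \<mu> = of_bool (answer k d d' h (g i) (g j) (g l))"
proof -
  have "eval (lookup_exp 0) \<rho> \<mu> = g i" "eval (lookup_exp 1) (\<rho>(4 := g i)) \<mu> = g j"
    "eval (lookup_exp 2) (\<rho>(4 := g i, 5 := g j)) \<mu> = g l"
    by (rule eval_lookup; use assms in simp)+
  then show ?thesis unfolding query_exp_def
    using eval_answer[of "\<rho>(4 := g i, 5 := g j, 6 := g l)" "g i" "g j" "g l"] assms by simp
qed

end

section \<open>Correctness of the preprocessing\<close>

text \<open>The inverse of the addressing by \<open>Tab\<close>: word \<open>u\<close> of the oracle
  is entry \<open>u div 18\<close> of table \<open>u mod 18\<close>.\<close>

definition out_exp :: exp where
  "out_exp = Mem (add (mul (add (Num 20) (rem (Var 1) (Num 18))) (Var 0)) (quot (Var 1) (Num 18)))"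

text \<open>Arrays 20 to 37 form the oracle, interleaved into array 38 in the end; the others are auxiliary.\<close>

definition stages :: "(nat \<times> exp \<times> exp) list" where
  "stages =
   [(1, mul (mul (mul n_exp n_exp) (add n_exp (Num 1))) n_exp, row_exp),
    (2, k_exp, pos_exp), (3, k_exp, vertex_exp), (4, mul (mul k_exp k_exp) k_exp, rel_exp),
    (20, Num 1, n_exp), (21, Num 1, k_exp), (22, Num 1, bits_exp), (28, b_exp, pow_exp),
    (29, add (mul (Num 2) k_exp) (Num 2), lowest_exp), (30, add k_exp (Num 1), level_exp),
    (31, k_exp, low_exp), (34, k_exp, low_rev_exp), (32, k_exp, mask_exp 31), (35, k_exp, mask_exp 34),
    (33, add k_exp b_exp, sparse_exp 31), (36, add k_exp b_exp, sparse_exp 34), (37, k_exp, landing_exp),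
    (23, Num 1, first_exp), (6, k_exp, bucket_exp), (25, k_exp, width_exp), (24, k_exp, offset_exp),
    (26, k_exp, factor_exp), (7, k_exp, slot_exp), (27, mul (Num 90) k_exp, table_exp)]"

lemma wf_stages: "\<forall>(A, len, e)\<in>set stages. wf_exp 20 len \<and> wf_exp 20 e"
  by (simp add: stages_def row_exp_def pos_exp_def vertex_exp_def rel_exp_def bits_exp_def pow_exp_def
      lowest_exp_def level_exp_def low_exp_def low_rev_exp_def mask_exp_def sparse_exp_def landing_exp_def
      first_exp_def mult_exp_def coll_exp_def bucket_exp_def width_exp_def count_exp_def offset_exp_def
      factor_exp_def slot_exp_def table_exp_def)

text \<open>The exponent 8 is dictated by the output length \<open>1620 * k\<close>: the base is at
  least 3, \<open>1620 \<le> 3 ^ 7\<close>, and \<open>k\<close> takes one more factor. Three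
  squarings compute this power.\<close>

locale sized_instance = graph_instance +
  fixes L :: nat
  assumes L: "L = (n + m + 2) ^ 8"
begin

sublocale chain k rel by (rule chain_rel)

sublocale dictionary n k "nth cs" "\<lambda>j. pos (cs ! j)"
  by unfold_locales (use dist cs_less in \<open>auto simp: inj_on_def nth_eq_iff_index_eq\<close>)

abbreviation D where "D \<equiv> low_on k rel"
abbreviation D' where "D' \<equiv> low_on k (rev_rel k rel)"

text \<open>The list records the arrays filled so far and their contents. The first \<open>L\<close>
  cells form array 0 and keep the input, since filled arrays have numbers from 1 on.\<close>

definition holds :: "(nat \<times> nat \<times> (nat \<Rightarrow> nat)) list \<Rightarrow> (nat \<Rightarrow> nat) \<Rightarrow> bool" where
  "holds xs \<mu> \<longleftrightarrow> (\<forall>a<L. \<mu> a = input a) \<and> (\<forall>a. \<mu> a \<le> L) \<and>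
    (\<forall>(A, l, f)\<in>set xs. l \<le> L \<and> (\<forall>i<l. cell L \<mu> A i = f i))"

lemma holdsD: "holds xs \<mu> \<Longrightarrow> (A, l, f) \<in> set xs \<Longrightarrow> i < l \<Longrightarrow> cell L \<mu> A i = f i"
  unfolding holds_def by fast

lemma holds_put:
  assumes "holds xs \<mu>" "1 \<le> A" "\<forall>(B, _)\<in>set xs. B \<noteq> A" "l \<le> L" "\<And>i. i < l \<Longrightarrow> f i \<le> L"
  shows "holds ((A, l, f) # xs) (put L A l f \<mu>)"
proof -
  have "put L A l f \<mu> a = input a" if "a < L" for a
  proof -
    have "L \<le> A * L" using assms(2) by simp
    then have "\<not> A * L \<le> a" using that by linarith
    then show ?thesis using assms(1) that by (simp add: put_def holds_def)
  qed
  moreover have "put L A l f \<mu> a \<le> L" for a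
    using assms(1,5) by (auto simp: put_def holds_def)
  moreover have "l' \<le> L \<and> (\<forall>i<l'. cell L (put L A l f \<mu>) B i = g i)" if "(B, l', g) \<in> set xs" for B l' g
  proof -
    have "l' \<le> L" "\<forall>i<l'. cell L \<mu> B i = g i" "B \<noteq> A" using that assms(1,3) unfolding holds_def by auto
    then show ?thesis using assms(4) by (simp add: cell_put_other)
  qed
  ultimately show ?thesis using assms(4) by (auto simp: holds_def cell_put_same)
qed

text \<open>Unlike \<open>step\<close>, this ranges over all memories in which the listed tables
  hold. Each table is thus verified in isolation, given only the presence of the tables it
  reads.\<close>

definition stage :: "(nat \<times> nat \<times> (nat \<Rightarrow> nat)) list \<Rightarrow> nat \<Rightarrow> exp \<Rightarrow> exp \<Rightarrow> nat \<Rightarrow> (nat \<Rightarrow> nat) \<Rightarrow> bool" where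
  "stage xs A len e l f \<longleftrightarrow> l \<le> L \<and> (\<forall>i<l. f i \<le> L) \<and>
    (\<forall>\<mu> \<rho>. holds xs \<mu> \<longrightarrow> \<rho> 0 = L \<longrightarrow> eval len \<rho> \<mu> = l) \<and>
    (\<forall>i<l. \<forall>\<mu> \<rho>. holds ((A, i, f) # xs) \<mu> \<longrightarrow> \<rho> 0 = L \<longrightarrow> \<rho> 1 = i \<longrightarrow> eval e \<rho> \<mu> = f i)"

fun all_stages :: "(nat \<times> nat \<times> (nat \<Rightarrow> nat)) list \<Rightarrow> (nat \<times> exp \<times> exp) list \<Rightarrow>
    (nat \<times> nat \<times> (nat \<Rightarrow> nat)) list \<Rightarrow> bool" where
  "all_stages xs [] ys \<longleftrightarrow> ys = []"
| "all_stages xs ((A, len, e) # ps) ys \<longleftrightarrow> (case ys of [] \<Rightarrow> False | (B, l, f) # ys \<Rightarrow>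
    A = B \<and> 1 \<le> A \<and> (\<forall>(C, _)\<in>set xs. C \<noteq> A) \<and> stage xs A len e l f \<and> all_stages ((A, l, f) # xs) ps ys)"

lemma steps_all_stages:
  "all_stages xs ps ys \<Longrightarrow> holds xs \<mu> \<Longrightarrow> \<exists>\<mu>'. steps L \<mu> ps \<mu>' \<and> holds (rev ys @ xs) \<mu>'"
proof (induction ps arbitrary: xs ys \<mu>)
  case (Cons p ps)
  obtain A len e where p: "p = (A, len, e)" by (cases p)
  obtain l f ys' where ys: "ys = (A, l, f) # ys'" "1 \<le> A" "\<forall>(C, _)\<in>set xs. C \<noteq> A"
    "stage xs A len e l f" "all_stages ((A, l, f) # xs) ps ys'"
    using Cons.prems p by (auto split: list.splits)
  have h: "holds ((A, i, f) # xs) (put L A i f \<mu>)" if "i \<le> l" for i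
    by (rule holds_put[OF Cons.prems(2) ys(2,3)]) (use ys(4) that in \<open>auto simp: stage_def\<close>)
  have "step L \<mu> A len e l f"
    using ys(4) h Cons.prems(2) by (auto simp: step_def stage_def)
  moreover obtain \<mu>' where "steps L (put L A l f \<mu>) ps \<mu>'" "holds (rev ys' @ (A, l, f) # xs) \<mu>'"
    using Cons.IH[OF ys(5) h[OF order_refl]] by blast
  ultimately show ?case using p ys(1) by auto
qed auto

lemma pow_le_L: "j \<le> 8 \<Longrightarrow> (n + m + 2) ^ j \<le> L"
  unfolding L by (rule power_increasing) auto

lemma bounds:
  "k < n + m + 2" "n < n + m + 2" "3 \<le> n + m + 2"
  using k_le n_pos by auto

text \<open>There is at least one vertex, so the base is at least 3 and numerals are absorbed by
  comparison with powers of 3.\<close>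

lemma num_le: "c \<le> 3 ^ j \<Longrightarrow> c \<le> (n + m + 2) ^ j"
  using power_mono[OF bounds(3), of j] by simp

lemma L_bounds:
  "n * n * (n + 1) * n \<le> L" "k * k * k \<le> L" "1620 * k \<le> L" "k * k \<le> L" "n * k \<le> L" "9 * (k * k) \<le> L"
  "n * (9 * (k * k)) \<le> L" "90 * k \<le> L" "2 * k + 2 \<le> L" "5 + 2 * m + k \<le> L" "k \<le> L" "n \<le> L" "1 \<le> L"
proof -
  define N where "N = n + m + 2"
  have N: "k \<le> N ^ 1" "n \<le> N ^ 1" "n + 1 \<le> N ^ 1" "9 \<le> N ^ 2" "1620 \<le> N ^ 7" "k + 1 \<le> N ^ 1" "2 \<le> N ^ 1"
    "5 + 2 * m + k \<le> 4 * N" "4 \<le> N ^ 2" "1 \<le> N ^ 1"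
    using bounds num_le[of 9 2] num_le[of 1620 7] num_le[of 4 2] by (auto simp: N_def)
  have mul: "a * b \<le> N ^ (i + j)" if "a \<le> N ^ i" "b \<le> N ^ j" for a b i j
    unfolding power_add using that by (rule mult_le_mono)
  have L: "a \<le> L" if "a \<le> N ^ i" "i \<le> 8" for a i
    using that pow_le_L[of i] unfolding N_def by linarith
  show "n * n * (n + 1) * n \<le> L" using mul[OF mul[OF mul[OF N(2) N(2)] N(3)] N(2)] by (rule L) simp
  show "k * k * k \<le> L" using mul[OF mul[OF N(1) N(1)] N(1)] by (rule L) simp
  show k: "1620 * k \<le> L" using mul[OF N(5) N(1)] by (rule L) simp
  then show "90 * k \<le> L" "k \<le> L" by simp_all
  show "k * k \<le> L" using mul[OF N(1) N(1)] by (rule L) simp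
  show "n * k \<le> L" using mul[OF N(2) N(1)] by (rule L) simp
  show "9 * (k * k) \<le> L" using mul[OF N(4) mul[OF N(1) N(1)]] by (rule L) simp
  show "n * (9 * (k * k)) \<le> L" using mul[OF N(2) mul[OF N(4) mul[OF N(1) N(1)]]] by (rule L) simp
  have "2 * (k + 1) \<le> L" using mul[OF N(7) N(6)] by (rule L) simp
  then show "2 * k + 2 \<le> L" by simp
  have "4 * N \<le> L" using mul[OF N(9), of N 1] by (intro L[of _ "2 + 1"]) auto
  then show "5 + 2 * m + k \<le> L" using N(8) by linarith
  show "n \<le> L" "1 \<le> L" using N(2,10) by (auto intro: L[of _ 1])
qed

lemma holds_input: "holds xs \<mu> \<Longrightarrow> a < 5 + 2 * m + k \<Longrightarrow> \<mu> a = input a"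
  using L_bounds(10) by (simp add: holds_def)

lemma graph_memory: "holds xs \<mu> \<Longrightarrow> graph_memory G s t cs \<mu>"
  by unfold_locales (rule holds_input)

lemma holds_memory:
  assumes "holds xs \<mu>" shows "\<mu> 0 = n" "\<mu> 1 = m" "\<mu> 4 = k" "j < k \<Longrightarrow> \<mu> (5 + 2 * \<mu> 1 + j) = cs ! j"
proof -
  interpret graph_memory G s t cs L \<mu> by (rule graph_memory[OF assms])
  show "\<mu> 0 = n" "\<mu> 1 = m" "\<mu> 4 = k" "j < k \<Longrightarrow> \<mu> (5 + 2 * \<mu> 1 + j) = cs ! j" using \<mu> by simp_all
qed

lemma eval_sizes:
  assumes "holds xs \<mu>" shows "eval n_exp \<rho> \<mu> = n" "eval k_exp \<rho> \<mu> = k"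
  using holds_memory[OF assms] by (simp_all add: n_exp_def k_exp_def)

abbreviation "rows \<equiv> (1, n * n * (n + 1) * n, row_rel G n)"
abbreviation "positions \<equiv> (2, k, \<lambda>j. pos (cs ! j))"
abbreviation "rels \<equiv> (4, k * k * k, \<lambda>i. of_bool (rel (i div k div k) (i div k mod k) (i mod k)))"
abbreviation "lengths \<equiv> (22, 1, \<lambda>_. bits k)"
abbreviation "powers \<equiv> (28, bits k, \<lambda>i. 2 ^ i)"

lemma stageI:
  assumes "l \<le> L" "\<And>i. i < l \<Longrightarrow> f i \<le> L" "\<And>\<mu> \<rho>. holds xs \<mu> \<Longrightarrow> \<rho> 0 = L \<Longrightarrow> eval len \<rho> \<mu> = l"
    "\<And>i \<mu> \<rho>. i < l \<Longrightarrow> holds ((A, i, f) # xs) \<mu> \<Longrightarrow> \<rho> 0 = L \<Longrightarrow> \<rho> 1 = i \<Longrightarrow> eval e \<rho> \<mu> = f i"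
  shows "stage xs A len e l f"
  using assms by (auto simp: stage_def)

lemma holds_mem: "holds ((A, i, f) # xs) \<mu> \<Longrightarrow> (B, l, g) \<in> set xs \<Longrightarrow> j < l \<Longrightarrow> cell L \<mu> B j = g j"
  using holdsD[of "(A, i, f) # xs" \<mu> B l g j] by simp

lemma stage_rows: "stage xs 1 (mul (mul (mul n_exp n_exp) (add n_exp (Num 1))) n_exp) row_exp (n * n * (n + 1) * n) (row_rel G n)"
proof (rule stageI)
  fix i :: nat and \<mu> \<rho> :: "nat \<Rightarrow> nat" assume i: "i < n * n * (n + 1) * n" and h: "holds ((1, i, row_rel G n) # xs) \<mu>" "\<rho> 0 = L" "\<rho> 1 = i"
  interpret graph_memory G s t cs L \<mu> by (rule graph_memory[OF h(1)])
  show "eval row_exp \<rho> \<mu> = row_rel G n i"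
    by (rule eval_row[OF h(2,3) i]) (rule holdsD[OF h(1)], auto)
qed (use L_bounds(1,13) eval_sizes in \<open>auto simp: row_rel_def\<close>)

lemma stage_positions:
  assumes "rows \<in> set xs" shows "stage xs 2 k_exp pos_exp k (\<lambda>j. pos (cs ! j))"
proof (rule stageI)
  fix i :: nat and \<mu> \<rho> :: "nat \<Rightarrow> nat" assume i: "i < k" and h: "holds ((2, i, \<lambda>j. pos (cs ! j)) # xs) \<mu>" "\<rho> 0 = L" "\<rho> 1 = i"
  interpret graph_memory G s t cs L \<mu> by (rule graph_memory[OF h(1)])
  show "eval pos_exp \<rho> \<mu> = pos (cs ! i)" using i h(2,3) holds_mem[OF h(1) assms] by (intro eval_pos)
next
  fix i assume "i < k" then show "pos (cs ! i) \<le> L" using pos_less_k[of "cs ! i"] L_bounds(11) by simp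
qed (use L_bounds(11) eval_sizes in auto)

lemma stage_vertices:
  assumes "positions \<in> set xs" shows "stage xs 3 k_exp vertex_exp k vertex"
proof (rule stageI)
  fix i :: nat and \<mu> \<rho> :: "nat \<Rightarrow> nat" assume i: "i < k" and h: "holds ((3, i, vertex) # xs) \<mu>" "\<rho> 0 = L" "\<rho> 1 = i"
  interpret graph_memory G s t cs L \<mu> by (rule graph_memory[OF h(1)])
  show "eval vertex_exp \<rho> \<mu> = vertex i" using h(2,3) holds_mem[OF h(1) assms] by (intro eval_vertex)
next
  fix i assume "i < k" then show "vertex i \<le> L" using vertex_less[of i] L_bounds(12) by linarith
qed (use L_bounds(11) eval_sizes in auto)

lemma stage_rels:
  assumes "rows \<in> set xs" "(3, k, vertex) \<in> set xs"
  shows "stage xs 4 (mul (mul k_exp k_exp) k_exp) rel_exp (k * k * k)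
    (\<lambda>i. of_bool (rel (i div k div k) (i div k mod k) (i mod k)))"
proof (rule stageI)
  fix i :: nat and \<mu> \<rho> :: "nat \<Rightarrow> nat" assume i: "i < k * k * k" and \<rho>: "\<rho> 0 = L" "\<rho> 1 = i"
    and h: "holds ((4, i, \<lambda>i. of_bool (rel (i div k div k) (i div k mod k) (i mod k))) # xs) \<mu>"
  interpret graph_memory G s t cs L \<mu> by (rule graph_memory[OF h(1)])
  show "eval rel_exp \<rho> \<mu> = of_bool (rel (i div k div k) (i div k mod k) (i mod k))"
    using \<rho> i holds_mem[OF h assms(2)] holds_mem[OF h assms(1)] by (intro eval_rel)
qed (use L_bounds(2,13) eval_sizes in auto)

lemma stage_sizes:
  "stage xs 20 (Num 1) n_exp 1 (\<lambda>_. n)" "stage xs 21 (Num 1) k_exp 1 (\<lambda>_. k)"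
  "stage xs 22 (Num 1) bits_exp 1 (\<lambda>_. bits k)"
proof -
  show "stage xs 20 (Num 1) n_exp 1 (\<lambda>_. n)"
    by (rule stageI) (use L_bounds(12,13) in \<open>auto simp: eval_sizes\<close>)
  show "stage xs 21 (Num 1) k_exp 1 (\<lambda>_. k)"
    by (rule stageI) (use L_bounds(11,13) in \<open>auto simp: eval_sizes\<close>)
  show "stage xs 22 (Num 1) bits_exp 1 (\<lambda>_. bits k)"
    by (rule stageI) (use L_bounds(11,13) bits_le[of k] eval_bits holds_memory(3) in auto)
qed

lemma eval_b_exp: "holds xs \<mu> \<Longrightarrow> lengths \<in> set xs \<Longrightarrow> \<rho> 0 = L \<Longrightarrow> eval b_exp \<rho> \<mu> = bits k"
  using holdsD[of xs \<mu> 22 1 "\<lambda>_. bits k" 0] by (simp add: b_exp_def)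

lemma power_le_L: "i < bits k \<Longrightarrow> 2 ^ i \<le> L"
  using less_bits_iff[of i k] L_bounds(11) by linarith

lemma stage_powers:
  assumes "lengths \<in> set xs" shows "stage xs 28 b_exp pow_exp (bits k) (\<lambda>i. 2 ^ i)"
proof (rule stageI)
  fix i :: nat and \<mu> \<rho> :: "nat \<Rightarrow> nat" assume h: "holds ((28, i, \<lambda>i. 2 ^ i) # xs) \<mu>" "\<rho> 0 = L" "\<rho> 1 = i"
  show "eval pow_exp \<rho> \<mu> = 2 ^ i"
    by (rule eval_pow[OF h(2,3)]) (rule holdsD[OF h(1)], simp_all)
qed (use assms bits_le[of k] L_bounds(11) power_le_L eval_b_exp in auto)

lemma stage_lowest:
  assumes "lengths \<in> set xs"
  shows "stage xs 29 (add (mul (Num 2) k_exp) (Num 2)) lowest_exp (2 * k + 2) (lowest_bit (bits k))"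
proof (rule stageI)
  fix i :: nat and \<mu> \<rho> :: "nat \<Rightarrow> nat" assume h: "holds ((29, i, lowest_bit (bits k)) # xs) \<mu>" "\<rho> 0 = L" "\<rho> 1 = i"
  then show "eval lowest_exp \<rho> \<mu> = lowest_bit (bits k) i"
    using holds_mem[OF h(1) assms] by (intro eval_lowest) auto
next
  fix i show "lowest_bit (bits k) i \<le> L"
    using least_upto_le[of "bits k"] bits_le[of k] L_bounds(11) unfolding lowest_bit_def by (meson order_trans)
qed (use L_bounds(9) eval_sizes in auto)

lemma stage_levels:
  assumes "lengths \<in> set xs"
  shows "stage xs 30 (add k_exp (Num 1)) level_exp (k + 1) (level (bits k))"
proof (rule stageI)
  fix i :: nat and \<mu> \<rho> :: "nat \<Rightarrow> nat" assume h: "holds ((30, i, level (bits k)) # xs) \<mu>" "\<rho> 0 = L" "\<rho> 1 = i"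
  then show "eval level_exp \<rho> \<mu> = level (bits k) i"
    using holds_mem[OF h(1) assms] by (intro eval_level) auto
next
  fix i
  have "level (bits k) i \<le> card {..<bits k}" unfolding level_def by (rule card_mono) auto
  then show "level (bits k) i \<le> L" using bits_le[of k] L_bounds(11) by simp
qed (use L_bounds(9) eval_sizes in auto)

lemma reach_memory:
  assumes "holds ((A, l, f) # xs) \<mu>" "rels \<in> set xs" shows "reach_memory k rel L \<mu>"
proof
  fix x i j assume lt: "x < k" "i < k" "j < k"
  have "Suc x * k \<le> k * k" "Suc (x * k + i) * k \<le> k * k * k"
  proof -
    show 1: "Suc x * k \<le> k * k" using lt by (intro mult_le_mono1) simp
    show "Suc (x * k + i) * k \<le> k * k * k" using lt 1 by (intro mult_le_mono1) simp
  qed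
  then have "(x * k + i) * k + j < k * k * k" using lt by simp
  moreover have "((x * k + i) * k + j) div k = x * k + i" "(x * k + i) div k = x"
    using lt by (auto intro!: div_nat_eqI simp: algebra_simps)
  moreover have "((x * k + i) * k + j) mod k = j" "(x * k + i) mod k = i"
    using lt by simp_all
  ultimately show "cell L \<mu> 4 ((x * k + i) * k + j) = of_bool (rel x i j)"
    using holds_mem[OF assms, of "(x * k + i) * k + j"] by simp
qed (rule holds_memory(3)[OF assms(1)])

lemma low_on_le: "low_on k \<rho> a \<le> a" if "chain k \<rho>" for \<rho>
  using that by (auto simp: low_on_def intro: chain.low_reached(2))

lemma chain_rev: "chain k (rev_rel k rel)"
  unfolding rev_rel_def using chain_reverse[OF chain_rel] .

lemma stage_low:
  assumes "rels \<in> set xs"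
  shows "stage xs 31 k_exp low_exp k D" "stage xs 34 k_exp low_rev_exp k D'"
proof -
  have le: "low_on k \<rho> i \<le> L" if "chain k \<rho>" "i < k" for \<rho> i
    using low_on_le[OF that(1), of i] that(2) L_bounds(11) by linarith
  show "stage xs 31 k_exp low_exp k D"
  proof (rule stageI)
    fix i :: nat and \<mu> \<rho> :: "nat \<Rightarrow> nat" assume h: "holds ((31, i, D) # xs) \<mu>" "\<rho> 0 = L" "\<rho> 1 = i"
    interpret reach_memory k rel L \<mu> by (rule reach_memory[OF h(1) assms])
    show "eval low_exp \<rho> \<mu> = D i" using h(2,3) by (rule eval_low)
  qed (use le[OF chain_rel] L_bounds(11) eval_sizes in auto)
  show "stage xs 34 k_exp low_rev_exp k D'"
  proof (rule stageI)
    fix i :: nat and \<mu> \<rho> :: "nat \<Rightarrow> nat" assume h: "holds ((34, i, D') # xs) \<mu>" "\<rho> 0 = L" "\<rho> 1 = i"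
    interpret reach_memory k rel L \<mu> by (rule reach_memory[OF h(1) assms])
    show "eval low_rev_exp \<rho> \<mu> = D' i" using h(2,3) by (rule eval_low_rev)
  qed (use le[OF chain_rev] L_bounds(11) eval_sizes in auto)
qed

lemma stage_landing:
  assumes "rels \<in> set xs" shows "stage xs 37 k_exp landing_exp k landing"
proof (rule stageI)
  fix i :: nat and \<mu> \<rho> :: "nat \<Rightarrow> nat" assume i: "i < k" and h: "holds ((37, i, landing) # xs) \<mu>" "\<rho> 0 = L" "\<rho> 1 = i"
  interpret reach_memory k rel L \<mu> by (rule reach_memory[OF h(1) assms])
  show "eval landing_exp \<rho> \<mu> = landing i" using h(2,3) i by (rule eval_landing)
next
  fix i assume "i < k" then show "landing i \<le> L"
    using least_upto_le[of i] L_bounds(11) unfolding landing_def by (meson less_imp_le order_trans)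
qed (use L_bounds(11) eval_sizes in auto)

lemma stage_masks:
  assumes "lengths \<in> set xs" "powers \<in> set xs" "(A, k, d) \<in> set xs"
  shows "stage xs B k_exp (mask_exp A) k (block_mask (bits k) d)"
proof (rule stageI)
  fix i :: nat and \<mu> \<rho> :: "nat \<Rightarrow> nat" assume i: "i < k" and h: "holds ((B, i, block_mask (bits k) d) # xs) \<mu>" "\<rho> 0 = L" "\<rho> 1 = i"
  show "eval (mask_exp A) \<rho> \<mu> = block_mask (bits k) d i"
    by (rule eval_mask[OF h(2,3) _ i])
      (use holds_mem[OF h(1) assms(1)] holds_mem[OF h(1) assms(2)] holds_mem[OF h(1) assms(3)] in auto)
next
  fix i
  show "block_mask (bits k) d i \<le> L"
    using block_mask_less[of "bits k" d i] power_bits_le[of k] L_bounds(9) by linarith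
qed (use L_bounds(11) eval_sizes in auto)

lemma stage_sparse:
  assumes "lengths \<in> set xs" "powers \<in> set xs" "(A, k, d) \<in> set xs"
  shows "stage xs B (add k_exp b_exp) (sparse_exp A) (k + bits k) (sparse k (bits k) d)"
proof (rule stageI)
  fix i :: nat and \<mu> \<rho> :: "nat \<Rightarrow> nat" assume i: "i < k + bits k" and h: "holds ((B, i, sparse k (bits k) d) # xs) \<mu>" "\<rho> 0 = L" "\<rho> 1 = i"
  \<comment> \<open>For \<open>k = 0\<close> the table would be empty because
    \<open>bits k \<le> k\<close>; a positive \<open>k\<close> makes the block length
    positive.\<close>
  have "0 < k" using i bits_le[of k] by (cases "k = 0") auto
  then show "eval (sparse_exp A) \<rho> \<mu> = sparse k (bits k) d i"
    using h(2,3) holds_memory(3)[OF h(1)] bits_pos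
      holds_mem[OF h(1) assms(1)] holds_mem[OF h(1) assms(2)] holds_mem[OF h(1) assms(3)]
    by (intro eval_sparse[of _ L]) auto
next
  fix i
  have "sparse k (bits k) d i \<le> k" unfolding sparse_def by (rule order_trans[OF rmin_le]) simp
  then show "sparse k (bits k) d i \<le> L" using L_bounds(11) by simp
qed (use L_bounds(9) bits_le[of k] eval_sizes eval_b_exp[OF _ assms(1)] in auto)

lemma key_memory:
  assumes "holds xs \<mu>" shows "key_memory n k (nth cs) \<mu>"
  by unfold_locales (use holds_memory[OF assms] in auto)

abbreviation "first \<equiv> (23, 1, \<lambda>_. multiplier n {..<k} (nth cs) k)"

lemma stage_dictionary:
  "stage xs 23 (Num 1) first_exp 1 (\<lambda>_. multiplier n {..<k} (nth cs) k)"
  "first \<in> set xs \<Longrightarrow> stage xs 6 k_exp bucket_exp k bucket"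
  "(6, k, bucket) \<in> set xs \<Longrightarrow> stage xs 25 k_exp width_exp k width"
  "(25, k, width) \<in> set xs \<Longrightarrow> stage xs 24 k_exp offset_exp k offset"
  "(6, k, bucket) \<in> set xs \<Longrightarrow> (25, k, width) \<in> set xs \<Longrightarrow> stage xs 26 k_exp factor_exp k factor"
  "(6, k, bucket) \<in> set xs \<Longrightarrow> (24, k, offset) \<in> set xs \<Longrightarrow> (25, k, width) \<in> set xs \<Longrightarrow>
    (26, k, factor) \<in> set xs \<Longrightarrow> stage xs 7 k_exp slot_exp k slot"
  "(7, k, slot) \<in> set xs \<Longrightarrow> positions \<in> set xs \<Longrightarrow> stage xs 27 (mul (Num 90) k_exp) table_exp (90 * k) table"
proof -
  have mult: "multiplier n J (nth cs) r \<le> L" if "n * r \<le> L" for J r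
    using multiplier_le that by (rule order_trans)
  have width: "width i \<le> 9 * (k * k)" for i
    unfolding width_def using card_members_le[of i] by (intro mult_le_mono) auto
  show "stage xs 23 (Num 1) first_exp 1 (\<lambda>_. multiplier n {..<k} (nth cs) k)"
  proof (rule stageI)
    fix i :: nat and \<mu> \<rho> :: "nat \<Rightarrow> nat" assume h: "holds ((23, i, \<lambda>_. multiplier n {..<k} (nth cs) k) # xs) \<mu>"
    interpret key_memory n k "nth cs" "\<lambda>j. pos (cs ! j)" L \<mu> by (rule key_memory[OF h])
    show "eval first_exp \<rho> \<mu> = multiplier n {..<k} (nth cs) k" by (rule eval_first)
  qed (use L_bounds mult in auto)
  show "stage xs 6 k_exp bucket_exp k bucket" if m: "first \<in> set xs"
  proof (rule stageI)
    fix i :: nat and \<mu> \<rho> :: "nat \<Rightarrow> nat" assume i: "i < k" and h: "holds ((6, i, bucket) # xs) \<mu>" "\<rho> 0 = L" "\<rho> 1 = i"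
    interpret key_memory n k "nth cs" "\<lambda>j. pos (cs ! j)" L \<mu> by (rule key_memory[OF h(1)])
    show "eval bucket_exp \<rho> \<mu> = bucket i" using holds_mem[OF h(1) m] by (intro eval_bucket[OF h(2,3) i]) simp
  next
    fix i assume "i < k" then show "bucket i \<le> L" using bucket_less[of i] L_bounds(11) by linarith
  qed (use L_bounds(11) eval_sizes in auto)
  show "stage xs 25 k_exp width_exp k width" if m: "(6, k, bucket) \<in> set xs"
  proof (rule stageI)
    fix i :: nat and \<mu> \<rho> :: "nat \<Rightarrow> nat" assume i: "i < k" and h: "holds ((25, i, width) # xs) \<mu>" "\<rho> 0 = L" "\<rho> 1 = i"
    interpret key_memory n k "nth cs" "\<lambda>j. pos (cs ! j)" L \<mu> by (rule key_memory[OF h(1)])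
    show "eval width_exp \<rho> \<mu> = width i" by (rule eval_width[OF h(2,3) holds_mem[OF h(1) m]])
  next
    fix i show "width i \<le> L" using width[of i] L_bounds(6) by linarith
  qed (use L_bounds(11) eval_sizes in auto)
  show "stage xs 24 k_exp offset_exp k offset" if m: "(25, k, width) \<in> set xs"
  proof (rule stageI)
    fix i :: nat and \<mu> \<rho> :: "nat \<Rightarrow> nat" assume i: "i < k" and h: "holds ((24, i, offset) # xs) \<mu>" "\<rho> 0 = L" "\<rho> 1 = i"
    interpret key_memory n k "nth cs" "\<lambda>j. pos (cs ! j)" L \<mu> by (rule key_memory[OF h(1)])
    show "eval offset_exp \<rho> \<mu> = offset i"
      using i by (intro eval_offset[OF h(2,3) _ holds_mem[OF h(1) m]]) simp
  next
    fix i assume "i < k" then show "offset i \<le> L" using offset_le[of i] L_bounds(8) by linarith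
  qed (use L_bounds(11) eval_sizes in auto)
  show "stage xs 26 k_exp factor_exp k factor" if m: "(6, k, bucket) \<in> set xs" "(25, k, width) \<in> set xs"
  proof (rule stageI)
    fix i :: nat and \<mu> \<rho> :: "nat \<Rightarrow> nat" assume i: "i < k" and h: "holds ((26, i, factor) # xs) \<mu>" "\<rho> 0 = L" "\<rho> 1 = i"
    interpret key_memory n k "nth cs" "\<lambda>j. pos (cs ! j)" L \<mu> by (rule key_memory[OF h(1)])
    show "eval factor_exp \<rho> \<mu> = factor i"
      by (rule eval_factor[OF h(2,3) i holds_mem[OF h(1) m(1)] holds_mem[OF h(1) m(2)]])
  next
    fix i
    have "n * width i \<le> n * (9 * (k * k))" using width by (rule mult_le_mono2)
    then show "factor i \<le> L" unfolding factor_def using L_bounds(7) by (intro mult) linarith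
  qed (use L_bounds(11) eval_sizes in auto)
  show "stage xs 7 k_exp slot_exp k slot" if m: "(6, k, bucket) \<in> set xs" "(24, k, offset) \<in> set xs"
    "(25, k, width) \<in> set xs" "(26, k, factor) \<in> set xs"
  proof (rule stageI)
    fix i :: nat and \<mu> \<rho> :: "nat \<Rightarrow> nat" assume i: "i < k" and h: "holds ((7, i, slot) # xs) \<mu>" "\<rho> 0 = L" "\<rho> 1 = i"
    interpret key_memory n k "nth cs" "\<lambda>j. pos (cs ! j)" L \<mu> by (rule key_memory[OF h(1)])
    show "eval slot_exp \<rho> \<mu> = slot i"
      by (rule eval_slot[OF h(2,3) i holds_mem[OF h(1) m(1)] holds_mem[OF h(1) m(2)]
            holds_mem[OF h(1) m(3)] holds_mem[OF h(1) m(4)]])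
  next
    fix i assume "i < k" then show "slot i \<le> L" using slot_less[of i] L_bounds(8) by linarith
  qed (use L_bounds(11) eval_sizes in auto)
  show "stage xs 27 (mul (Num 90) k_exp) table_exp (90 * k) table" if m: "(7, k, slot) \<in> set xs" "positions \<in> set xs"
  proof (rule stageI)
    fix i :: nat and \<mu> \<rho> :: "nat \<Rightarrow> nat" assume h: "holds ((27, i, table) # xs) \<mu>" "\<rho> 0 = L" "\<rho> 1 = i"
    interpret key_memory n k "nth cs" "\<lambda>j. pos (cs ! j)" L \<mu> by (rule key_memory[OF h(1)])
    show "eval table_exp \<rho> \<mu> = table i"
      by (rule eval_table[OF h(2,3) holds_mem[OF h(1) m(1)] holds_mem[OF h(1) m(2)]])
  next
    fix i
    have "pos (cs ! j) \<le> k" if "j < k" for j using pos_less_k[of "cs ! j"] that by simp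
    then have "table i \<le> of_nat (card {..<k}) * k" unfolding table_def
      by (intro sum_bounded_above) auto
    then show "table i \<le> L" using L_bounds(4) by simp
  qed (use L_bounds(8) eval_sizes in auto)
qed

definition tables :: "(nat \<times> nat \<times> (nat \<Rightarrow> nat)) list" where
  "tables = [rows, positions, (3, k, vertex), rels, (20, 1, \<lambda>_. n), (21, 1, \<lambda>_. k), lengths, powers,
    (29, 2 * k + 2, lowest_bit (bits k)), (30, k + 1, level (bits k)), (31, k, D), (34, k, D'),
    (32, k, block_mask (bits k) D), (35, k, block_mask (bits k) D'), (33, k + bits k, sparse k (bits k) D),
    (36, k + bits k, sparse k (bits k) D'), (37, k, landing), first, (6, k, bucket), (25, k, width),
    (24, k, offset), (26, k, factor), (7, k, slot), (27, 90 * k, table)]"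

text \<open>The order of \<open>stages\<close> respects the dependencies: each rule leaves only the
  membership of its prerequisites in the list of earlier tables.\<close>

lemma all_stages: "all_stages [] stages tables"
  unfolding stages_def tables_def all_stages.simps list.case prod.case
  by (intro conjI stage_rows stage_positions stage_vertices stage_rels stage_sizes stage_powers stage_lowest
      stage_levels stage_low stage_masks stage_sparse stage_landing stage_dictionary) simp_all

lemma holds_init: "holds [] input"
proof -
  have "n + m \<le> L" using pow_le_L[of 1] by simp
  then show ?thesis using order_trans[OF input_le] by (simp add: holds_def)
qed

lemma holds_tables:
  assumes "holds (rev tables) \<mu>" "(A, l, f) \<in> set tables" "i < l"
  shows "cell L \<mu> A i = f i"
  using holdsD[OF assms(1), of A l f i] assms by simp

text \<open>The value 0 beyond the output matches the memory of a query, which is 0 outside the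
  oracle; this function is that entire memory.\<close>

definition out_words :: "(nat \<Rightarrow> nat) \<Rightarrow> nat \<Rightarrow> nat" where
  "out_words \<mu> u = (if u < 1620 * k then cell L \<mu> (20 + u mod 18) (u div 18) else 0)"

text \<open>All tables share the length \<open>90 * k\<close> of the longest one. For
  \<open>k > 0\<close> no table is truncated by this, and 18 of them occupy \<open>1620 * k\<close>
  words.\<close>

lemma tab_oracle:
  assumes "holds (rev tables) \<mu>" "(20 + A, l, f) \<in> set tables" "A < 18" "i < l" "i < 90 * k"
  shows "tab (out_words \<mu>) A i = f i"
proof -
  have "18 * i + A < 1620 * k" using assms(3,5) by simp
  moreover have "(18 * i + A) mod 18 = A" "(18 * i + A) div 18 = i" using assms(3) by auto
  ultimately show ?thesis using holds_tables[OF assms(1,2,4)] by (simp add: tab_def out_words_def)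
qed

lemma rmq_tables:
  assumes h: "holds (rev tables) \<mu>"
    and t: "(20 + A, k, d) \<in> set tables" "(20 + (A + 1), k, block_mask (bits k) d) \<in> set tables"
      "(20 + (A + 2), k + bits k, sparse k (bits k) d) \<in> set tables" and A: "A + 2 < 18" and k: "0 < k"
  shows "rmq_memory k A d (out_words \<mu>)"
proof
  have m: "(20 + 2, 1, \<lambda>_. bits k) \<in> set tables" "(20 + 8, bits k, \<lambda>i. 2 ^ i) \<in> set tables"
    "(20 + 9, 2 * k + 2, lowest_bit (bits k)) \<in> set tables" "(20 + 10, k + 1, level (bits k)) \<in> set tables"
    by (simp_all add: tables_def)
  have b: "bits k \<le> k" by (rule bits_le)
  show "tab (out_words \<mu>) 2 0 = bits k" using tab_oracle[OF h m(1), of 0] k by simp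
  show "i < bits k \<Longrightarrow> tab (out_words \<mu>) 8 i = 2 ^ i" for i using tab_oracle[OF h m(2), of i] b k by simp
  show "v < 2 * k + 2 \<Longrightarrow> tab (out_words \<mu>) 9 v = lowest_bit (bits k) v" for v
    using tab_oracle[OF h m(3), of v] k by simp
  show "v \<le> k \<Longrightarrow> tab (out_words \<mu>) 10 v = level (bits k) v" for v
    using tab_oracle[OF h m(4), of v] k by simp
  show "i < k \<Longrightarrow> tab (out_words \<mu>) A i = d i" for i using tab_oracle[OF h t(1), of i] A by simp
  show "i < k \<Longrightarrow> tab (out_words \<mu>) (A + 1) i = block_mask (bits k) d i" for i
    using tab_oracle[OF h t(2), of i] A by simp
  show "i < k + bits k \<Longrightarrow> tab (out_words \<mu>) (A + 2) i = sparse k (bits k) d i" for i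
    using tab_oracle[OF h t(3), of i] A b k by simp
qed

text \<open>For \<open>k = 0\<close> the oracle is empty and could not even store \<open>n\<close>,
  but then there are no queries either.\<close>

lemma oracle_tables:
  assumes h: "holds (rev tables) \<mu>" and k: "0 < k"
  shows "oracle_memory n k (nth cs) (\<lambda>j. pos (cs ! j)) D D' (out_words \<mu>) landing"
proof -
  interpret up: rmq_memory k 11 D "out_words \<mu>"
    by (rule rmq_tables[OF h _ _ _ _ k]) (simp_all add: tables_def)
  interpret down: rmq_memory k 14 D' "out_words \<mu>"
    by (rule rmq_tables[OF h _ _ _ _ k]) (simp_all add: tables_def)
  have m: "(20 + 0, 1, \<lambda>_. n) \<in> set tables" "(20 + 1, 1, \<lambda>_. k) \<in> set tables"
    "(20 + 3, 1, \<lambda>_. multiplier n {..<k} (nth cs) k) \<in> set tables" "(20 + 4, k, offset) \<in> set tables"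
    "(20 + 5, k, width) \<in> set tables" "(20 + 6, k, factor) \<in> set tables"
    "(20 + 7, 90 * k, table) \<in> set tables" "(20 + 17, k, landing) \<in> set tables"
    by (simp_all add: tables_def)
  show ?thesis
  proof
    show "tab (out_words \<mu>) 0 0 = n" using tab_oracle[OF h m(1), of 0] k by simp
    show "tab (out_words \<mu>) 1 0 = k" using tab_oracle[OF h m(2), of 0] k by simp
    show "tab (out_words \<mu>) 3 0 = multiplier n {..<k} (nth cs) k" using tab_oracle[OF h m(3), of 0] k by simp
    show "i < k \<Longrightarrow> tab (out_words \<mu>) 4 i = offset i" for i using tab_oracle[OF h m(4), of i] by simp
    show "i < k \<Longrightarrow> tab (out_words \<mu>) 5 i = width i" for i using tab_oracle[OF h m(5), of i] by simp
    show "i < k \<Longrightarrow> tab (out_words \<mu>) 6 i = factor i" for i using tab_oracle[OF h m(6), of i] by simp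
    show "u < 90 * k \<Longrightarrow> tab (out_words \<mu>) 7 u = table u" for u using tab_oracle[OF h m(7), of u] by simp
    show "i < k \<Longrightarrow> tab (out_words \<mu>) 17 i = landing i" for i using tab_oracle[OF h m(8), of i] by simp
  qed
qed

lemma eval_query_oracle:
  assumes h: "holds (rev tables) \<mu>" and x: "x \<in> set cs" "y \<in> set cs" "z \<in> set cs"
    and \<rho>: "\<rho> 0 = x" "\<rho> 1 = y" "\<rho> 2 = z"
  shows "eval query_exp \<rho> (out_words \<mu>) = of_bool (has_path (del_vert x) y z)"
proof -
  obtain i j l where ijl: "i < k" "x = cs ! i" "j < k" "y = cs ! j" "l < k" "z = cs ! l"
    using x by (auto simp: in_set_conv_nth)
  then have "0 < k" by linarith
  interpret oracle_memory n k "nth cs" "\<lambda>j. pos (cs ! j)" D D' "out_words \<mu>" landing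
    by (rule oracle_tables[OF h \<open>0 < k\<close>])
  have p: "pos x < k" "pos y < k" "pos z < k" using x pos_less_k by auto
  have "eval query_exp \<rho> (out_words \<mu>) = of_bool (answer k D D' landing (pos x) (pos y) (pos z))"
    using eval_query[of \<rho> i j l] ijl p \<rho> by simp
  also have "answer k D D' landing (pos x) (pos y) (pos z) \<longleftrightarrow> rel (pos x) (pos y) (pos z)"
    using answer[OF p] by simp
  also have "\<dots> \<longleftrightarrow> has_path (del_vert x) y z"
    using p x by (simp add: rel_def vertex_pos has_path_del_vert_iff_avoids)
  finally show ?thesis .
qed

lemma step_out:
  assumes h: "holds xs \<mu>"
  shows "step L \<mu> 38 (mul (Num 1620) k_exp) out_exp (1620 * k) (out_words \<mu>)"
  unfolding step_def
proof (intro conjI allI impI)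
  show "1620 * k \<le> L" by (rule L_bounds(3))
  show "out_words \<mu> i \<le> L" for i using h by (simp add: out_words_def holds_def cell_def)
  show "eval (mul (Num 1620) k_exp) \<rho> \<mu> = 1620 * k" for \<rho> using eval_sizes[OF h] by simp
  fix i and \<rho> :: "nat \<Rightarrow> nat" assume i: "i < 1620 * k" and \<rho>: "\<rho> 0 = L" "\<rho> 1 = i"
  \<comment> \<open>The sources are arrays 20 to 37; an index below \<open>L\<close> stays inside
    its array, so the part of array 38 already written does not interfere.\<close>
  have "i div 18 < L" using i L_bounds(3,8) by linarith
  then have "cell L (put L 38 i (out_words \<mu>) \<mu>) (20 + i mod 18) (i div 18) = cell L \<mu> (20 + i mod 18) (i div 18)"
    using i L_bounds(3) by (intro cell_put_other) auto
  then show "eval out_exp \<rho> (put L 38 i (out_words \<mu>) \<mu>) = out_words \<mu> i"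
    using i \<rho> by (simp add: out_exp_def out_words_def cell_def)
qed

lemma steps_append: "steps L \<mu> ps \<mu>1 \<Longrightarrow> steps L \<mu>1 qs \<mu>2 \<Longrightarrow> steps L \<mu> (ps @ qs) \<mu>2"
  by (induction ps arbitrary: \<mu>) (auto, blast)

lemma steps_program:
  "\<exists>\<mu>. holds (rev tables) \<mu> \<and>
    steps L input (stages @ [(38, mul (Num 1620) k_exp, out_exp)]) (put L 38 (1620 * k) (out_words \<mu>) \<mu>)"
proof -
  obtain \<mu> where \<mu>: "steps L input stages \<mu>" "holds (rev tables) \<mu>"
    using steps_all_stages[OF all_stages holds_init] by auto
  have "steps L \<mu> [(38, mul (Num 1620) k_exp, out_exp)] (put L 38 (1620 * k) (out_words \<mu>) \<mu>)"
    using step_out[OF \<mu>(2)] by auto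
  with steps_append[OF \<mu>(1)] \<mu>(2) show ?thesis by blast
qed

end

section \<open>The two programs and their final bounds\<close>

definition size_exp :: exp where
  "size_exp = LetE 2 (add (add (Mem (Num 0)) (Mem (Num 1))) (Num 2)) (LetE 2 (mul (Var 2) (Var 2))
    (LetE 2 (mul (Var 2) (Var 2)) (mul (Var 2) (Var 2))))"

text \<open>\<open>size_exp\<close> reads the header at absolute addresses because register 0 does
  not hold \<open>L\<close> yet. At the end \<open>38 * L\<close>, the start of the output, replaces
  \<open>L\<close> there.\<close>

definition preprocess :: com where
  "preprocess = Seq (compile size_exp 20) (Seq (Move 0 (Reg 20))
    (Seq (prog (stages @ [(38, mul (Num 1620) k_exp, out_exp)]))
    (Seq (compile (mul (Num 38) (Var 0)) 20) (Seq (compile (mul (Num 1620) k_exp) 21)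
    (Seq (Move 0 (Reg 20)) (Move 1 (Reg 21)))))))"

definition query :: com where
  "query = Seq (compile query_exp 20) (Move 0 (Reg 20))"

lemma preprocess_runs:
  "\<exists>c. \<forall>G s t cs L w. sized_instance G s t cs L \<longrightarrow> L ^ c < 2 ^ w \<longrightarrow>
    runs w preprocess (init_state [] (encode_instance G s t cs)) (L ^ c) (\<lambda>\<sigma>.
      \<exists>\<mu>. sized_instance.holds G s t cs L (rev (sized_instance.tables G s cs)) \<mu> \<and>
        output_block \<sigma> = map (sized_instance.out_words cs L \<mu>) [0..<1620 * length cs])"
proof -
  let ?p = "stages @ [(38, mul (Num 1620) k_exp, out_exp)]"
  have wf: "\<forall>(A, len, e)\<in>set ?p. wf_exp 20 len \<and> wf_exp 20 e"
    using wf_stages by (auto simp: out_exp_def)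
  have wf': "wf_exp 20 size_exp" "wf_exp 20 (mul (Num 38) (Var 0))" "wf_exp 20 (mul (Num 1620) k_exp)"
    by (simp_all add: size_exp_def)
  obtain c1 where c1: "\<And>L w \<sigma> \<mu>'. 2 \<le> L \<Longrightarrow> L ^ c1 < 2 ^ w \<Longrightarrow> ready L \<sigma> \<Longrightarrow> steps L (mem \<sigma>) ?p \<mu>' \<Longrightarrow>
    runs w (prog ?p) \<sigma> (L ^ c1) (\<lambda>\<sigma>'. ready L \<sigma>' \<and> mem \<sigma>' = \<mu>')"
    using prog_runs[OF wf] by blast
  obtain c2 c3 c4 where c: "computes 20 1 c2 20 size_exp" "computes 20 1 c3 20 (mul (Num 38) (Var 0))"
    "computes 20 1 c4 21 (mul (Num 1620) k_exp)"
    using computes_exists[OF wf'(1), of 20 1] computes_exists[OF wf'(2), of 20 1]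
      computes_exists[OF wf'(3), of 21 1] by auto
  define c where "c = c1 + c2 + c3 + c4 + 10"
  have "runs w preprocess (init_state [] (encode_instance G s t cs)) (L ^ c) (\<lambda>\<sigma>.
      \<exists>\<mu>. sized_instance.holds G s t cs L (rev (sized_instance.tables G s cs)) \<mu> \<and>
        output_block \<sigma> = map (sized_instance.out_words cs L \<mu>) [0..<1620 * length cs])"
    if I: "sized_instance G s t cs L" and w: "L ^ c < 2 ^ w" for G s t cs L w
  proof -
    interpret sized_instance G s t cs L by (rule I)
    obtain \<mu> where \<mu>: "holds (rev tables) \<mu>" "steps L input ?p (put L 38 (1620 * k) (out_words \<mu>) \<mu>)"
      using steps_program by blast
    let ?\<mu> = "put L 38 (1620 * k) (out_words \<mu>) \<mu>" and ?\<sigma> = "init_state [] (encode_instance G s t cs)"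
    have L2: "2 \<le> L" using pow_le_L[of 1] by simp
    have le: "L ^ a \<le> L ^ c" if "a \<le> c" for a using that L2 by (intro power_increasing) auto
    have wc: "L ^ c1 < 2 ^ w" "L ^ c2 < 2 ^ w" "L ^ c3 < 2 ^ w" "L ^ c4 < 2 ^ w"
      using le[of c1] le[of c2] le[of c3] le[of c4] w by (auto simp: c_def)
    have m: "mem ?\<sigma> = input" by (simp add: input_def)
    have ok: "env_ok L 1 20 ?\<sigma>"
      using holds_init by (auto simp: env_ok_def m holds_def) (simp add: init_state_def)
    have sz: "eval size_exp \<rho> input = L" for \<rho>
    proof -
      have "input 0 = n" "input (Suc 0) = m" using input(1,2) by simp_all
      moreover have "N ^ 8 = (N * N * (N * N)) * (N * N * (N * N))" for N :: nat
        by (simp add: numeral_eq_Suc mult.assoc)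
      ultimately show ?thesis unfolding L by (simp add: size_exp_def)
    qed
    have "runs w preprocess ?\<sigma> (L ^ c2 + (1 + (L ^ c1 + (L ^ c3 + (L ^ c4 + (1 + 1)))))) (\<lambda>\<sigma>.
      output_block \<sigma> = map (out_words \<mu>) [0..<1620 * k])"
      unfolding preprocess_def
    proof (intro runs_Seq runs_weaken[OF computes_pow[OF c(1) L2 wc(2) ok wf'(1)] order_refl] runs_Move)
      show "mem ?\<sigma> = mem ?\<sigma>" "\<And>j. reg ?\<sigma> j = reg ?\<sigma> j" by simp_all
      fix \<sigma>1 :: state assume p: "mem \<sigma>1 = mem ?\<sigma> \<and> reg \<sigma>1 20 = eval size_exp (reg ?\<sigma>) (mem ?\<sigma>) \<and> (\<forall>j<20. reg \<sigma>1 j = reg ?\<sigma> j)"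
      let ?\<sigma>1 = "\<sigma>1\<lparr>reg := (reg \<sigma>1)(0 := operand_val w \<sigma>1 (Reg 20))\<rparr>"
      have r: "ready L ?\<sigma>1"
        using p ok by (simp add: ready_def env_ok_def m sz)
      have s: "steps L (mem ?\<sigma>1) ?p ?\<mu>" using p \<mu>(2) m by simp
      show "runs w (prog ?p) ?\<sigma>1 (L ^ c1) (\<lambda>\<sigma>'. runs w (Seq (compile (mul (Num 38) (Var 0)) 20)
        (Seq (compile (mul (Num 1620) k_exp) 21) (Seq (Move 0 (Reg 20)) (Move 1 (Reg 21))))) \<sigma>'
          (L ^ c3 + (L ^ c4 + (1 + 1))) (\<lambda>\<sigma>. output_block \<sigma> = map (out_words \<mu>) [0..<1620 * k]))"
      proof (rule runs_weaken[OF c1[OF L2 wc(1) r s] order_refl], intro runs_Seq)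
        fix \<sigma>2 :: state assume q: "ready L \<sigma>2 \<and> mem \<sigma>2 = ?\<mu>"
        then have ok2: "env_ok L 1 20 \<sigma>2" using ready_env_ok by blast
        \<comment> \<open>Array 38 lies above the input, so the number of cut-vertices can still be
          read to obtain the output length.\<close>
        have in4: "?\<mu> 4 = k"
        proof -
          have "holds ((38, 1620 * k, out_words \<mu>) # rev tables) ?\<mu>"
            by (rule holds_put[OF \<mu>(1)]) (use step_out[OF \<mu>(1)] in \<open>auto simp: step_def tables_def\<close>)
          then show ?thesis by (rule holds_memory(3))
        qed
        show "runs w (compile (mul (Num 38) (Var 0)) 20) \<sigma>2 (L ^ c3) (\<lambda>\<sigma>'. runs w (Seq (compile (mul (Num 1620) k_exp) 21)
          (Seq (Move 0 (Reg 20)) (Move 1 (Reg 21)))) \<sigma>' (L ^ c4 + (1 + 1))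
            (\<lambda>\<sigma>. output_block \<sigma> = map (out_words \<mu>) [0..<1620 * k]))"
        proof (rule runs_weaken[OF computes_pow[OF c(2) L2 wc(3) ok2 wf'(2) HOL.refl HOL.refl] order_refl])
          fix \<sigma>3 :: state
          assume q3: "mem \<sigma>3 = mem \<sigma>2 \<and> reg \<sigma>3 20 = eval (mul (Num 38) (Var 0)) (reg \<sigma>2) (mem \<sigma>2) \<and> (\<forall>j<20. reg \<sigma>3 j = reg \<sigma>2 j)"
          show "runs w (Seq (compile (mul (Num 1620) k_exp) 21) (Seq (Move 0 (Reg 20)) (Move 1 (Reg 21)))) \<sigma>3
            (L ^ c4 + (1 + 1)) (\<lambda>\<sigma>. output_block \<sigma> = map (out_words \<mu>) [0..<1620 * k])"
          proof (rule runs_Seq, rule runs_weaken[OF computes_pow[OF c(3) L2 wc(4) ok2 wf'(3)] order_refl])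
            show "mem \<sigma>3 = mem \<sigma>2" "\<And>j. j < 20 \<Longrightarrow> reg \<sigma>3 j = reg \<sigma>2 j" using q3 by auto
            fix \<sigma>4 :: state
            assume q4: "mem \<sigma>4 = mem \<sigma>2 \<and> reg \<sigma>4 21 = eval (mul (Num 1620) k_exp) (reg \<sigma>2) (mem \<sigma>2) \<and> (\<forall>j<21. reg \<sigma>4 j = reg \<sigma>3 j)"
            have regs: "reg \<sigma>4 20 = 38 * L" "reg \<sigma>4 21 = 1620 * k" "mem \<sigma>4 = ?\<mu>"
              using q q3 q4 in4 by (auto simp: ready_def k_exp_def)
            have out: "?\<mu> (38 * L + u) = out_words \<mu> u" if "u < 1620 * k" for u
              using cell_put_same[OF that, of L 38] by (simp add: cell_def)
            show "runs w (Seq (Move 0 (Reg 20)) (Move 1 (Reg 21))) \<sigma>4 (1 + 1)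
              (\<lambda>\<sigma>. output_block \<sigma> = map (out_words \<mu>) [0..<1620 * k])"
              by (intro runs_Seq runs_Move) (use regs out in \<open>auto simp: output_block_def\<close>)
          qed
        qed
      qed
    qed
    moreover have "L ^ c2 + (1 + (L ^ c1 + (L ^ c3 + (L ^ c4 + (1 + 1))))) \<le> L ^ c"
    proof -
      have e: "x + y \<le> L ^ (a + b + 1)" if "x \<le> L ^ a" "y \<le> L ^ b" for x y a b
        by (rule pow_add_bound[OF L2 that]) auto
      \<comment> \<open>Each of the six additions costs one more exponent; the 10 in the definition
        of \<open>c\<close> covers them.\<close>
      have "L ^ c2 + (1 + (L ^ c1 + (L ^ c3 + (L ^ c4 + (1 + 1))))) \<le>
        L ^ (c2 + (0 + (c1 + (c3 + (c4 + (0 + 0 + 1) + 1) + 1) + 1) + 1) + 1)"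
        by (intro e order_refl) simp_all
      also have "\<dots> \<le> L ^ c" by (rule le) (simp add: c_def)
      finally show ?thesis .
    qed
    ultimately show ?thesis using \<mu>(1) by (auto elim!: runs_weaken)
  qed
  then show ?thesis by blast
qed

text \<open>As \<open>query_exp\<close> contains no sum, its running time is bounded by the exponent
  itself, independently of \<open>L\<close>. One more step moves the result to register 0.\<close>

lemma query_runs:
  "\<exists>c. \<forall>L w \<sigma>. 2 \<le> L \<longrightarrow> L ^ c < 2 ^ w \<longrightarrow> env_ok L 1 20 \<sigma> \<longrightarrow>
    runs w query \<sigma> (c + 1) (\<lambda>\<sigma>'. reg \<sigma>' 0 = eval query_exp (reg \<sigma>) (mem \<sigma>))"
proof -
  obtain c where c: "computes 20 1 c 20 query_exp" using computes_exists[OF wf_query, of 20 1] by auto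
  have "runs w query \<sigma> (c + 1) (\<lambda>\<sigma>'. reg \<sigma>' 0 = eval query_exp (reg \<sigma>) (mem \<sigma>))"
    if "2 \<le> L" "L ^ c < 2 ^ w" "env_ok L 1 20 \<sigma>" for L w \<sigma>
  proof -
    have t: "exp_time query_exp L c = c" using sum_free_query by (simp add: exp_time_def)
    show ?thesis unfolding query_def
      by (intro runs_Seq runs_Move runs_weaken[OF computesD(2)[OF c that, unfolded t] order_refl])
        (simp add: exp_post_def)
  qed
  then show ?thesis by blast
qed

theorem theorem5p2:
  shows "\<exists>(P :: com) (Q :: com) (time_poly :: nat poly) (word_c :: nat) (size_c :: nat) (query_c :: nat).
    \<forall>(G :: (nat, nat) pre_digraph) (s :: nat) (t :: nat) (C :: nat set) (cs :: nat list) (w :: nat).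
      numbered_digraph G \<longrightarrow> s \<in> verts G \<longrightarrow> t \<in> verts G \<longrightarrow> has_path G s t \<longrightarrow>
      C \<subseteq> {x. st_cut_vertex G s t x} \<longrightarrow>
      distinct cs \<longrightarrow> set cs = C \<longrightarrow>
      (graph_size G + 2) ^ word_c \<le> 2 ^ w \<longrightarrow>
      (\<exists>k \<sigma>. exec w P (init_state [] (encode_instance G s t cs)) k \<sigma> \<and>
         k \<le> poly time_poly (graph_size G) \<and>
         length (output_block \<sigma>) \<le> size_c * card C \<and>
         answers_queries w Q query_c (output_block \<sigma>) G C)"
proof -
  obtain c1 where c1: "\<And>G s t cs L w. sized_instance G s t cs L \<Longrightarrow> L ^ c1 < 2 ^ w \<Longrightarrow>
    runs w preprocess (init_state [] (encode_instance G s t cs)) (L ^ c1) (\<lambda>\<sigma>.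
      \<exists>\<mu>. sized_instance.holds G s t cs L (rev (sized_instance.tables G s cs)) \<mu> \<and>
        output_block \<sigma> = map (sized_instance.out_words cs L \<mu>) [0..<1620 * length cs])"
    using preprocess_runs by blast
  obtain c2 where c2: "\<And>L w \<sigma>. 2 \<le> L \<Longrightarrow> L ^ c2 < 2 ^ w \<Longrightarrow> env_ok L 1 20 \<sigma> \<Longrightarrow>
    runs w query \<sigma> (c2 + 1) (\<lambda>\<sigma>'. reg \<sigma>' 0 = eval query_exp (reg \<sigma>) (mem \<sigma>))"
    using query_runs by blast
  show ?thesis
  \<comment> \<open>The polynomial \<open>[:2, 1:]\<close> is the instance size plus 2, so its power
    evaluates to \<open>L ^ c1\<close>. The additional 1 in the word-length exponent turns the
    assumed non-strict inequality into the strict one that excludes overflow.\<close>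
  proof (rule exI[of _ preprocess], rule exI[of _ query], rule exI[of _ "[:2, 1:] ^ (8 * c1)"],
      rule exI[of _ "8 * (c1 + c2) + 1"], rule exI[of _ 1620], rule exI[of _ "c2 + 1"], intro allI impI)
    fix G :: "(nat, nat) pre_digraph" and s t :: nat and C :: "nat set" and cs :: "nat list" and w :: nat
    assume a: "numbered_digraph G" "s \<in> verts G" "t \<in> verts G" "has_path G s t"
      "C \<subseteq> {x. st_cut_vertex G s t x}" "distinct cs" "set cs = C"
      and w: "(graph_size G + 2) ^ (8 * (c1 + c2) + 1) \<le> 2 ^ w"
    define L where "L = (graph_size G + 2) ^ 8"
    interpret sized_instance G s t cs L
      by unfold_locales (use a in \<open>auto simp: L_def graph_size_def\<close>)
    have N: "2 \<le> graph_size G + 2" by simp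
    have L2: "2 \<le> L" using pow_le_L[of 1] by simp
    have "L ^ (c1 + c2) = (graph_size G + 2) ^ (8 * (c1 + c2))" by (simp only: L_def power_mult)
    also have "\<dots> < (graph_size G + 2) ^ (8 * (c1 + c2) + 1)" by (rule power_strict_increasing) auto
    finally have "L ^ (c1 + c2) < 2 ^ w" using w by linarith
    moreover have "L ^ c1 \<le> L ^ (c1 + c2)" "L ^ c2 \<le> L ^ (c1 + c2)" using L2 by (intro power_increasing; simp)+
    ultimately have wc: "L ^ c1 < 2 ^ w" "L ^ c2 < 2 ^ w" by linarith+
    obtain k' \<sigma> \<mu> where r: "exec w preprocess (init_state [] (encode_instance G s t cs)) k' \<sigma>" "k' \<le> L ^ c1"
      "holds (rev tables) \<mu>" "output_block \<sigma> = map (out_words \<mu>) [0..<1620 * k]"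
      using c1[OF sized_instance_axioms wc(1)] unfolding runs_def by blast
    have "answers_queries w query (c2 + 1) (output_block \<sigma>) G C"
      unfolding answers_queries_def
    proof (intro ballI)
      fix x y z assume C: "x \<in> C" "y \<in> C" "z \<in> C"
      let ?\<sigma> = "init_state [x, y, z] (output_block \<sigma>)"
      have m: "mem ?\<sigma> = out_words \<mu>"
        by (auto simp: init_state_def r(4) out_words_def fun_eq_iff)
      have "out_words \<mu> a \<le> L" for a using r(3) by (simp add: out_words_def holds_def cell_def)
      moreover have "x \<le> L" "y \<le> L" "z \<le> L"
        using C a(7) cs_less L_bounds(12) by (metis in_set_conv_nth less_imp_le order_trans)+
      moreover have "reg ?\<sigma> j \<in> {x, y, z, 0}" for j
        by (simp add: init_state_def nth_Cons split: nat.split)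
      ultimately have "env_ok L 1 20 ?\<sigma>" unfolding env_ok_def m by (metis empty_iff insert_iff le0 power_one_right)
      then obtain l \<sigma>' where "exec w query ?\<sigma> l \<sigma>'" "l \<le> c2 + 1"
        "reg \<sigma>' 0 = eval query_exp (reg ?\<sigma>) (mem ?\<sigma>)"
        using c2[OF L2 wc(2)] unfolding runs_def by blast
      moreover have "eval query_exp (reg ?\<sigma>) (mem ?\<sigma>) = of_bool (has_path (del_vert x) y z)"
        unfolding m by (rule eval_query_oracle[OF r(3)]) (use C a(7) in \<open>auto simp: init_state_def\<close>)
      ultimately show "\<exists>k \<sigma>'. exec w query ?\<sigma> k \<sigma>' \<and> k \<le> c2 + 1 \<and>
          reg \<sigma>' 0 = of_bool (has_path (del_vert x) y z)"
        by (intro exI[of _ l] exI[of _ \<sigma>']) simp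
    qed
    moreover have "k' \<le> poly ([:2, 1:] ^ (8 * c1)) (graph_size G)"
      using r(2) by (simp add: poly_power L_def power_mult add.commute)
    moreover have "length (output_block \<sigma>) \<le> 1620 * card C"
      using r(4) a(6,7) by (auto simp: distinct_card)
    ultimately show "\<exists>k \<sigma>. exec w preprocess (init_state [] (encode_instance G s t cs)) k \<sigma> \<and>
         k \<le> poly ([:2, 1:] ^ (8 * c1)) (graph_size G) \<and>
         length (output_block \<sigma>) \<le> 1620 * card C \<and>
         answers_queries w query (c2 + 1) (output_block \<sigma>) G C"
      using r(1) by blast
  qed
qed

end
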